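(* Let $\psi$ be an affine self-map of the right half-plane $\mathbb{C}_+$, i.e. $\psi(w)=aw+b$ with $a>0$ and $\mathrm{Re}(b)\ge 0$. Then there exists $\lambda\in\mathbb{C}$ such that $C_\psi-\lambda I$ is universal on $H^2(\mathbb{C}_+)$ if and only if $a\in(1,\infty)$ and $\mathrm{Re}(b)>0$.
   Context: $\mathbb{C}_+=\{w\in\mathbb{C}:\mathrm{Re}(w)>0\}$. $H^2(\mathbb{C}_+)$ is the Hilbert space of analytic functions $f$ on $\mathbb{C}_+$ with $\|f\|^2=\sup_{0<x<\infty}\int_{-\infty}^\infty|f(x+iy)|^2\,dy<\infty$. $C_\psi f=f\circ\psi$ is the composition operator, which is bounded on $H^2(\mathbb{C}_+)$ for the symbols considered. A bounded linear operator $U$ on a Hilbert space $\mathcal{H}$ is universal for (or on) $\mathcal{H}$ if for every bounded linear operator $T$ on $\mathcal{H}$ there exist a constant $\alpha\neq 0$ and a closed subspace $\mathcal{M}\subset\mathcal{H}$ with $U\mathcal{M}\subset\mathcal{M}$ such that $U|_{\mathcal{M}}$ is similar to $\alpha T$. *)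

theory Defs
  imports "HOL-Analysis.Analysis" "HOL-Library.Function_Algebras"
begin

text \<open>
  Complex Hilbert spaces are represented as linear spaces \<open>V\<close> of complex-valued functions (with
  pointwise operations) together with a norm \<open>N\<close>; operators are functions whose behaviour
  is only relevant on the carrier \<open>V\<close>.
\<close>

definition fun_scale :: "complex \<Rightarrow> ('x \<Rightarrow> complex) \<Rightarrow> ('x \<Rightarrow> complex)" where
  "fun_scale c f = (\<lambda>x. c * f x)"

global_interpretation cfun: vector_space fun_scale
  by unfold_locales (auto simp: fun_scale_def fun_eq_iff algebra_simps)

definition bounded_operator ::
  "(('x \<Rightarrow> complex) \<Rightarrow> real) \<Rightarrow> ('x \<Rightarrow> complex) set \<Rightarrow> ('x \<Rightarrow> complex) set
    \<Rightarrow> (('x \<Rightarrow> complex) \<Rightarrow> ('x \<Rightarrow> complex)) \<Rightarrow> bool" where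
  "bounded_operator N V W T \<longleftrightarrow>
     (\<forall>f\<in>V. T f \<in> W) \<and>
     (\<forall>f\<in>V. \<forall>g\<in>V. T (f + g) = T f + T g) \<and>
     (\<forall>c. \<forall>f\<in>V. T (fun_scale c f) = fun_scale c (T f)) \<and>
     (\<exists>K. \<forall>f\<in>V. N (T f) \<le> K * N f)"

definition closed_subspace ::
  "(('x \<Rightarrow> complex) \<Rightarrow> real) \<Rightarrow> ('x \<Rightarrow> complex) set \<Rightarrow> ('x \<Rightarrow> complex) set \<Rightarrow> bool" where
  "closed_subspace N V M \<longleftrightarrow>
     M \<subseteq> V \<and> cfun.subspace M \<and>
     (\<forall>s f. (\<forall>n::nat. s n \<in> M) \<and> f \<in> V \<and> (\<lambda>n. N (s n - f)) \<longlonglongrightarrow> 0 \<longrightarrow> f \<in> M)"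

text \<open>The operator \<open>A\<close> on \<open>V\<close> is similar to the operator \<open>B\<close> on \<open>W\<close>.\<close>

definition similar_operators ::
  "(('x \<Rightarrow> complex) \<Rightarrow> real)
    \<Rightarrow> ('x \<Rightarrow> complex) set \<Rightarrow> (('x \<Rightarrow> complex) \<Rightarrow> ('x \<Rightarrow> complex))
    \<Rightarrow> ('x \<Rightarrow> complex) set \<Rightarrow> (('x \<Rightarrow> complex) \<Rightarrow> ('x \<Rightarrow> complex)) \<Rightarrow> bool" where
  "similar_operators N V A W B \<longleftrightarrow>
     (\<exists>S R. bounded_operator N V W S \<and> bounded_operator N W V R \<and>
        (\<forall>f\<in>V. R (S f) = f) \<and> (\<forall>g\<in>W. S (R g) = g) \<and>
        (\<forall>f\<in>V. S (A f) = B (S f)))"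

definition universal_operator ::
  "(('x \<Rightarrow> complex) \<Rightarrow> real) \<Rightarrow> ('x \<Rightarrow> complex) set
    \<Rightarrow> (('x \<Rightarrow> complex) \<Rightarrow> ('x \<Rightarrow> complex)) \<Rightarrow> bool" where
  "universal_operator N V U \<longleftrightarrow>
     bounded_operator N V V U \<and>
     (\<forall>T. bounded_operator N V V T \<longrightarrow>
        (\<exists>\<alpha> M. \<alpha> \<noteq> 0 \<and> closed_subspace N V M \<and> U ` M \<subseteq> M \<and>
           similar_operators N M U V (\<lambda>f. fun_scale \<alpha> (T f))))"

definition right_half_plane :: "complex set" where
  "right_half_plane = {w. 0 < Re w}"

definition hardy_norm_sq :: "(complex \<Rightarrow> complex) \<Rightarrow> ennreal" where
  "hardy_norm_sq f =
     (SUP x\<in>{0<..}. \<integral>\<^sup>+ y. ennreal ((cmod (f (Complex x y)))\<^sup>2) \<partial>lborel)"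

text \<open>
  A function on the half-plane is represented by its extension by zero, so that equality
  in \<open>hardy2\<close> is equality on the half-plane.
\<close>

definition hardy2 :: "(complex \<Rightarrow> complex) set" where
  "hardy2 = {f. f holomorphic_on right_half_plane \<and> (\<forall>w. w \<notin> right_half_plane \<longrightarrow> f w = 0) \<and>
                hardy_norm_sq f < \<infinity>}"

definition hardy2_norm :: "(complex \<Rightarrow> complex) \<Rightarrow> real" where
  "hardy2_norm f = sqrt (enn2real (hardy_norm_sq f))"

text \<open>
  Extending by zero after composing is necessary because \<open>\<psi>\<close> may map points outside the
  half-plane into it.
\<close>

definition composition_operator ::
  "(complex \<Rightarrow> complex) \<Rightarrow> (complex \<Rightarrow> complex) \<Rightarrow> (complex \<Rightarrow> complex)" where
  "composition_operator \<psi> f = (\<lambda>w. if w \<in> right_half_plane then f (\<psi> w) else 0)"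

end

theory Submission
  imports Defs "HOL-Complex_Analysis.Complex_Analysis"
begin

text \<open>
  Let \<open>C f = f \<circ> \<psi>\<close> with \<open>\<psi> w = a w + b\<close>, and \<open>U = C - \<mu>\<close>.

  Suppose \<open>a > 1\<close> and \<open>Re b > 0\<close>. The fixed point \<open>-c\<close> of \<open>\<psi>\<close>, where \<open>c = b / (a - 1)\<close>, lies in the open left
  half-plane, and \<open>\<psi> w + c = a (w + c)\<close>. For \<open>\<mu> = 1 / a\<close> the operator \<open>U\<close> has a bounded right inverse and a kernel that
  contains a copy of the whole space; by the criterion of Caradus (\<open>caradus_intertwining\<close>,
  \<open>universal_of_right_inverse\<close>) such an operator is universal.

  For the right inverse (\<open>shifted_op_right_inverse\<close>) write \<open>f = \<tau> f + (f - \<tau> f)\<close> with the translation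
  \<open>\<tau> f w = f (w + c)\<close>. On the second part the inverse of \<open>C - \<mu>\<close> is expanded in powers of \<open>C\<close>, on the first part in
  powers of \<open>C\<^sup>-\<^sup>1\<close>, which is meaningful because the formal \<open>k\<close>-th inverse iterate of \<open>\<tau> f\<close> is \<open>w \<mapsto> f ((w + c) / a\<^sup>k)\<close>.
  Composition with a dilation by \<open>a\<^sup>k\<close> multiplies the norm by the power of \<open>a\<close> with exponent \<open>- k / 2\<close>, and
  \<open>f - \<tau> f\<close> is smaller than \<open>f\<close> by a factor of order \<open>1 / X\<close> on the line \<open>Re w = X\<close> (\<open>hardy2_translation_estimate\<close>). So both series
  converge when \<open>|\<mu>|\<close> lies strictly between \<open>a powr (-3/2)\<close> and \<open>a powr (-1/2)\<close>.

  The kernel contains \<open>q w / (w + c)\<close> for every bounded analytic \<open>q\<close> with \<open>q \<circ> \<psi> = q\<close>, such as the polynomials in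
  \<open>(w + c) powr (2 \<pi> \<i> / ln a)\<close>. These supply elements with enough prescribed zeros for an infinite orthonormal
  system (\<open>triangular_orthonormal_basis\<close>, \<open>shifted_op_kernel_isometry\<close>).

  Conversely, a universal \<open>U\<close> models every bounded \<open>T\<close> up to a scalar. The choice \<open>T = 0\<close> yields an eigenvector of
  \<open>C\<close> for \<open>\<mu>\<close>, and a rank one \<open>T\<close> with square zero yields a Jordan chain of length two (\<open>universal_imp_eigenvector\<close>,
  \<open>universal_imp_jordan_chain\<close>). If \<open>Re b = 0\<close>, then \<open>C\<close> is a multiple of an isometry and has no such chain. If
  \<open>Re b > 0\<close> and \<open>a < 1\<close>, then \<open>\<psi>\<close> has an attracting fixed point in the half-plane, and the behaviour of an eigenfunction
  along forward and backward orbits contradicts the bound \<open>|f w| \<le> 2 \<parallel>f\<parallel> / sqrt (Re w)\<close>. If \<open>Re b > 0\<close> and \<open>a = 1\<close>, then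
  an eigenfunction is an exponential, by an argument of Liouville type, and not square integrable on lines.

  The Hardy norm is a supremum of square means over vertical segments. The pointwise bound, the translation
  estimate and the monotonicity of the square mean in \<open>Re w\<close> all follow from one duality device: pairing the
  restrictions of \<open>f\<close> to translates of a fixed segment with a fixed function gives a bounded analytic function on the
  half-plane (\<open>dual_fn\<close>), to which the Cauchy estimate and the maximum principle apply. Monotonicity makes the norm a boundary
  limit of norms that come from inner products, so the space is a Hilbert space.
\<close>


section \<open>Orthonormal sequences and Hilbert space isomorphisms\<close>

text \<open>
  By the parallelogram law, midpoints of almost minimal elements force a minimising sequence to be
  Cauchy.
\<close>

lemma minimal_norm_element_exists:
  fixes A :: "'h::{real_inner, banach} set"
  assumes "closed A" "convex A" "A \<noteq> {}"
  obtains x where "x \<in> A" "\<And>y. y \<in> A \<Longrightarrow> norm x \<le> norm y"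
proof -
  define d where "d = Inf (norm ` A)"
  have bdd: "bdd_below (norm ` A)"
    by (rule bdd_belowI[of _ 0]) auto
  have d_le: "d \<le> norm y" if "y \<in> A" for y
    unfolding d_def using bdd that by (auto intro: cInf_lower)
  have "0 \<le> d"
    unfolding d_def using assms(3) by (auto intro!: cInf_greatest)
  have "\<exists>y\<in>A. norm y < d + 1 / Suc n" for n
  proof -
    have "Inf (norm ` A) < d + 1 / Suc n"
      unfolding d_def by simp
    then show ?thesis
      using cInf_less_iff[OF _ bdd] assms(3) by auto
  qed
  then obtain s where s: "\<And>n. s n \<in> A" "\<And>n. norm (s n) < d + 1 / Suc n"
    by metis
  have norm_lim: "(\<lambda>n. norm (s n)) \<longlonglongrightarrow> d"
  proof (rule tendsto_sandwich[of "\<lambda>_. d" _ _ "\<lambda>n. d + 1 / Suc n"])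
    show "(\<lambda>n. d + 1 / Suc n) \<longlonglongrightarrow> d"
      using tendsto_add[OF tendsto_const[of d] LIMSEQ_inverse_real_of_nat] by (simp add: field_simps)
  qed (use s d_le in \<open>auto intro!: always_eventually less_imp_le\<close>)
  have mid: "(norm (s m - s n))\<^sup>2 \<le> 2 * (norm (s m))\<^sup>2 + 2 * (norm (s n))\<^sup>2 - 4 * d\<^sup>2" for m n
  proof -
    have "(1/2) *\<^sub>R s m + (1/2) *\<^sub>R s n \<in> A"
      using s(1) assms(2) by (intro convexD) auto
    then have "d \<le> norm ((1/2) *\<^sub>R (s m + s n))"
      using d_le by (simp add: scaleR_right_distrib)
    then have "2 * d \<le> norm (s m + s n)"
      by simp
    then have "(2 * d)\<^sup>2 \<le> (norm (s m + s n))\<^sup>2"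
      using \<open>0 \<le> d\<close> by (intro power_mono) auto
    then show ?thesis
      by (simp add: power2_norm_eq_inner inner_simps inner_commute power_mult_distrib)
  qed
  have "Cauchy s"
  proof (rule metric_CauchyI)
    fix e :: real
    assume "0 < e"
    have "(\<lambda>n. (norm (s n))\<^sup>2) \<longlonglongrightarrow> d\<^sup>2"
      by (intro tendsto_intros norm_lim)
    then have "\<forall>\<^sub>F n in sequentially. (norm (s n))\<^sup>2 < d\<^sup>2 + e\<^sup>2 / 4"
      using \<open>0 < e\<close> by (intro order_tendstoD) auto
    then obtain M where M: "\<And>n. n \<ge> M \<Longrightarrow> (norm (s n))\<^sup>2 < d\<^sup>2 + e\<^sup>2 / 4"
      by (auto simp: eventually_sequentially)
    have "dist (s m) (s n) < e" if "m \<ge> M" "n \<ge> M" for m n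
    proof -
      have "(norm (s m - s n))\<^sup>2 < e\<^sup>2"
        using mid[of m n] M[OF that(1)] M[OF that(2)] by simp
      then show ?thesis
        using \<open>0 < e\<close> by (simp add: dist_norm power2_less_imp_less)
    qed
    then show "\<exists>M. \<forall>m\<ge>M. \<forall>n\<ge>M. dist (s m) (s n) < e"
      by blast
  qed
  then obtain x where x: "s \<longlonglongrightarrow> x"
    using Cauchy_convergent_iff convergent_def by blast
  show ?thesis
  proof
    show "x \<in> A"
      using x s(1) assms(1) closed_sequentially by blast
    have "norm x = d"
      using LIMSEQ_unique tendsto_norm[OF x] norm_lim by blast
    then show "norm x \<le> norm y" if "y \<in> A" for y
      using d_le that by simp
  qed
qed

definition orthonormal_seq :: "(nat \<Rightarrow> 'h::real_inner) \<Rightarrow> bool" where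
  "orthonormal_seq u \<longleftrightarrow> (\<forall>m n. u m \<bullet> u n = (if m = n then 1 else 0))"

lemma orthonormal_norm_sum:
  assumes "orthonormal_seq u" "finite A"
  shows "(norm (\<Sum>n\<in>A. c n *\<^sub>R u n))\<^sup>2 = (\<Sum>n\<in>A. (c n)\<^sup>2)"
proof -
  have "(norm (\<Sum>n\<in>A. c n *\<^sub>R u n))\<^sup>2 = (\<Sum>m\<in>A. \<Sum>n\<in>A. c n * (c m * (u m \<bullet> u n)))"
    by (simp add: power2_norm_eq_inner inner_sum_left inner_sum_right sum_distrib_left inner_commute)
  also have "\<dots> = (\<Sum>m\<in>A. \<Sum>n\<in>A. if m = n then c m * c n else 0)"
    using assms(1) by (intro sum.cong) (auto simp: orthonormal_seq_def)
  also have "\<dots> = (\<Sum>m\<in>A. (c m)\<^sup>2)"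
    using assms(2) by (simp add: power2_eq_square)
  finally show ?thesis .
qed

lemma bessel_inequality:
  assumes "orthonormal_seq u"
  shows "(\<Sum>n<N. (f \<bullet> u n)\<^sup>2) \<le> (norm f)\<^sup>2"
proof -
  define p where "p = (\<Sum>n<N. (f \<bullet> u n) *\<^sub>R u n)"
  have "f \<bullet> p = (\<Sum>n<N. (f \<bullet> u n)\<^sup>2)"
    by (simp add: p_def inner_sum_right power2_eq_square)
  moreover have "p \<bullet> p = (\<Sum>n<N. (f \<bullet> u n)\<^sup>2)"
    using orthonormal_norm_sum[OF assms, of "{..<N}" "\<lambda>n. f \<bullet> u n"]
    by (simp add: p_def power2_norm_eq_inner)
  moreover have "0 \<le> (f - p) \<bullet> (f - p)"
    by simp
  ultimately show ?thesis
    by (simp add: power2_norm_eq_inner inner_simps inner_commute)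
qed

lemma bessel_summable:
  assumes "orthonormal_seq u"
  shows "summable (\<lambda>n. (f \<bullet> u n)\<^sup>2)"
  by (rule bounded_imp_summable[of _ "(norm f)\<^sup>2"])
     (use bessel_inequality[OF assms, of f "Suc _"] in \<open>auto simp: lessThan_Suc_atMost\<close>)

lemma orthonormal_summable:
  fixes u :: "nat \<Rightarrow> 'h::{real_inner, banach}"
  assumes "orthonormal_seq u" "summable (\<lambda>n. (c n)\<^sup>2)"
  shows "summable (\<lambda>n. c n *\<^sub>R u n)"
proof (rule summable_Cauchy[THEN iffD2], intro allI impI)
  fix e :: real
  assume "0 < e"
  then obtain N where N: "\<And>m n. m \<ge> N \<Longrightarrow> norm (\<Sum>i=m..<n. (c i)\<^sup>2) < e\<^sup>2"
    using summable_Cauchy[THEN iffD1, OF assms(2), rule_format, of "e\<^sup>2"] by auto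
  have "norm (\<Sum>i=m..<n. c i *\<^sub>R u i) < e" if "m \<ge> N" for m n
  proof -
    have "(norm (\<Sum>i=m..<n. c i *\<^sub>R u i))\<^sup>2 < e\<^sup>2"
      using N[OF that, of n] orthonormal_norm_sum[OF assms(1), of "{m..<n}" c] by simp
    then show ?thesis
      using \<open>0 < e\<close> by (simp add: power2_less_imp_less)
  qed
  then show "\<exists>N. \<forall>m\<ge>N. \<forall>n. norm (\<Sum>i=m..<n. c i *\<^sub>R u i) < e"
    by blast
qed

text \<open>
  For orthonormal sequences this is the partial isometry that matches them term by term. A complex
  orthonormal basis will enter as the real sequence \<open>e\<^sub>0, i e\<^sub>0, e\<^sub>1, i e\<^sub>1, \<dots>\<close>, so real coefficients
  are enough.
\<close>

definition seq_map :: "(nat \<Rightarrow> 'h) \<Rightarrow> (nat \<Rightarrow> 'h) \<Rightarrow> 'h::{real_inner, banach} \<Rightarrow> 'h" where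
  "seq_map u v f = (\<Sum>n. (f \<bullet> u n) *\<^sub>R v n)"

lemma seq_map_sums:
  assumes "orthonormal_seq u" "orthonormal_seq v"
  shows "(\<lambda>n. (f \<bullet> u n) *\<^sub>R v n) sums seq_map u v f"
  unfolding seq_map_def
  by (intro summable_sums orthonormal_summable bessel_summable assms)

lemma bounded_linear_seq_map:
  assumes "orthonormal_seq u" "orthonormal_seq v"
  shows "bounded_linear (seq_map u v)"
proof (rule bounded_linear_intro[of _ 1])
  fix f g :: 'a and r :: real
  have "(\<lambda>n. ((f + g) \<bullet> u n) *\<^sub>R v n) sums (seq_map u v f + seq_map u v g)"
    using sums_add[OF seq_map_sums[OF assms, of f] seq_map_sums[OF assms, of g]]
    by (simp add: inner_simps scaleR_left_distrib)
  then show "seq_map u v (f + g) = seq_map u v f + seq_map u v g"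
    unfolding seq_map_def[of _ _ "f + g"] by (simp add: sums_iff)
  have "(\<lambda>n. ((r *\<^sub>R f) \<bullet> u n) *\<^sub>R v n) sums (r *\<^sub>R seq_map u v f)"
    using bounded_linear.sums[OF bounded_linear_scaleR_right seq_map_sums[OF assms, of f]]
    by simp
  then show "seq_map u v (r *\<^sub>R f) = r *\<^sub>R seq_map u v f"
    unfolding seq_map_def[of _ _ "r *\<^sub>R f"] by (simp add: sums_iff)
  have "norm (\<Sum>n<N. (f \<bullet> u n) *\<^sub>R v n) \<le> norm f" for N
  proof -
    have "(norm (\<Sum>n<N. (f \<bullet> u n) *\<^sub>R v n))\<^sup>2 \<le> (norm f)\<^sup>2"
      using orthonormal_norm_sum[OF assms(2), of "{..<N}"] bessel_inequality[OF assms(1)] by simp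
    then show ?thesis
      by (rule power2_le_imp_le) simp
  qed
  then show "norm (seq_map u v f) \<le> norm f * 1"
    using seq_map_sums[OF assms, of f] unfolding sums_def
    by (intro Lim_bounded[OF tendsto_norm]) auto
qed

lemma seq_map_coefficient:
  assumes "orthonormal_seq u" "orthonormal_seq v"
  shows "seq_map u v f \<bullet> v n = f \<bullet> u n"
proof -
  have "(\<lambda>m. ((f \<bullet> u m) *\<^sub>R v m) \<bullet> v n) sums (seq_map u v f \<bullet> v n)"
    by (intro bounded_linear.sums[OF bounded_linear_inner_left] seq_map_sums assms)
  moreover have "(\<lambda>m. ((f \<bullet> u m) *\<^sub>R v m) \<bullet> v n) = (\<lambda>m. if m = n then f \<bullet> u m else 0)"
    using assms(2) by (auto simp: orthonormal_seq_def)
  ultimately show ?thesis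
    using sums_unique2[OF _ sums_single[of n "\<lambda>m. f \<bullet> u m"]] by auto
qed

lemma seq_map_complete:
  assumes "orthonormal_seq u" and complete: "\<And>f. (\<And>n. f \<bullet> u n = 0) \<Longrightarrow> f = 0"
  shows "seq_map u u f = f"
proof -
  have "(seq_map u u f - f) \<bullet> u n = 0" for n
    using seq_map_coefficient[OF assms(1) assms(1), of f n] by (simp add: inner_simps)
  then show ?thesis
    using complete[of "seq_map u u f - f"] by auto
qed

lemma seq_map_seq_map:
  assumes "orthonormal_seq u" "orthonormal_seq v"
  shows "seq_map v w (seq_map u v f) = seq_map u w f"
  unfolding seq_map_def[of v w] seq_map_def[of u w]
  by (simp add: seq_map_coefficient[OF assms])

lemma range_seq_map:
  assumes "orthonormal_seq u" "orthonormal_seq v" "closed K" "subspace K" "\<And>n. v n \<in> K"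
  shows "seq_map u v f \<in> K"
proof -
  have "(\<Sum>n<N. (f \<bullet> u n) *\<^sub>R v n) \<in> K" for N
    using assms(4,5) by (intro subspace_sum subspace_scale)
  then show ?thesis
    by (rule closed_sequentially[OF assms(3) _ seq_map_sums[OF assms(1,2), unfolded sums_def]])
qed

text \<open>
  A complex Hilbert space regarded as a real one: \<open>\<iota>\<close> is multiplication by the imaginary unit.
\<close>

locale complex_structure =
  fixes \<iota> :: "'h::{real_inner, banach} \<Rightarrow>\<^sub>L 'h"
  assumes iota_iota: "\<iota> (\<iota> f) = - f"
    and inner_iota_iota: "\<iota> f \<bullet> \<iota> g = f \<bullet> g"
begin

lemma inner_iota_left: "\<iota> f \<bullet> g = - (f \<bullet> \<iota> g)"
  using inner_iota_iota[of f "\<iota> g"] by (simp add: iota_iota)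

lemma inner_iota_self [simp]: "f \<bullet> \<iota> f = 0"
  using inner_iota_left[of f f] by (simp add: inner_commute)

text \<open>
  A complex orthonormal basis of \<open>K\<close>, each of whose vectors is followed by its multiple by the
  imaginary unit.
\<close>

definition adapted_basis :: "'h set \<Rightarrow> (nat \<Rightarrow> 'h) \<Rightarrow> bool" where
  "adapted_basis K u \<longleftrightarrow> orthonormal_seq u \<and> (\<forall>n. u n \<in> K) \<and> (\<forall>n. u (2 * n + 1) = \<iota> (u (2 * n))) \<and>
     (\<forall>f\<in>K. (\<forall>n. f \<bullet> u n = 0) \<longrightarrow> f = 0)"

lemma adapted_basisD:
  assumes "adapted_basis K u"
  shows "orthonormal_seq u" "u n \<in> K" "u (2 * n + 1) = \<iota> (u (2 * n))"
    "f \<in> K \<Longrightarrow> (\<And>n. f \<bullet> u n = 0) \<Longrightarrow> f = 0"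
  using assms by (auto simp: adapted_basis_def)

text \<open>
  Both sides lie in \<open>K\<close> and have the same coefficients with respect to the basis \<open>v\<close>, since \<open>\<iota>\<close>
  permutes both bases, up to sign, in the same way.
\<close>

lemma seq_map_iota:
  assumes bases: "adapted_basis K' u" "adapted_basis K v"
    and K: "closed K" "subspace K" "\<And>f. f \<in> K \<Longrightarrow> \<iota> f \<in> K"
  shows "seq_map u v (\<iota> f) = \<iota> (seq_map u v f)"
proof -
  note uv = bases[THEN adapted_basisD(1)]
  note u = adapted_basisD(3)[OF bases(1)]
  note v = adapted_basisD(3)[OF bases(2)]
  note coeff = seq_map_coefficient[OF uv]
  define d where "d = seq_map u v (\<iota> f) - \<iota> (seq_map u v f)"
  have "d \<in> K"
    unfolding d_def using range_seq_map[OF uv K(1,2) adapted_basisD(2)[OF bases(2)]] K(2,3) by (intro subspace_diff) auto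
  moreover have "d \<bullet> v n = 0" for n
  proof (cases "even n")
    case True
    then obtain k where "n = 2 * k" by blast
    then show ?thesis
      using u[of k] v[of k] coeff[of f "2 * k + 1"] by (simp add: d_def inner_diff_left coeff inner_iota_left)
  next
    case False
    then obtain k where "n = 2 * k + 1" using oddE by blast
    then show ?thesis
      using u[of k] v[of k] coeff[of "\<iota> f" "2 * k + 1"]
      by (simp add: d_def inner_diff_left coeff inner_iota_iota)
  qed
  ultimately have "d = 0"
    by (rule adapted_basisD(4)[OF bases(2)])
  then show ?thesis
    by (simp add: d_def)
qed

text \<open>
  Let \<open>N n\<close> be the set of elements of \<open>K\<close> annihilated by the first \<open>n\<close> functionals. The element of
  minimal norm in \<open>N n\<close> with \<open>l n = 1\<close> is orthogonal to \<open>N (Suc n)\<close>, so these elements are orthogonal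
  to one another. An element of \<open>K\<close> orthogonal to all of them lies in every \<open>N n\<close>, by induction, and
  is therefore zero.
\<close>

lemma triangular_orthonormal_basis:
  fixes l :: "nat \<Rightarrow> 'h \<Rightarrow> complex"
  assumes l: "\<And>n. bounded_linear (l n)" "\<And>n f. l n (\<iota> f) = \<i> * l n f"
    and separating: "\<And>f. (\<And>n. l n f = 0) \<Longrightarrow> f = 0"
    and K: "closed K" "subspace K" "\<And>f. f \<in> K \<Longrightarrow> \<iota> f \<in> K"
    and exact: "\<And>n. \<exists>f\<in>K. (\<forall>j<n. l j f = 0) \<and> l n f \<noteq> 0"
  obtains u where "adapted_basis K u"
proof -
  have l_lin: "l n (f + g) = l n f + l n g" "l n (f - g) = l n f - l n g" "l n (r *\<^sub>R f) = r *\<^sub>R l n f" for n f g r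
    using bounded_linear.linear[OF l(1)[of n]] by (simp_all add: linear_add linear_diff linear_cmul)
  have l_closed: "closed {f. l n f = z}" for n z
    using closed_Collect_eq[of "l n" "\<lambda>_. z"] l(1) linear_continuous_on by auto
  define N where "N n = {f \<in> K. \<forall>j<n. l j f = 0}" for n
  have N_add: "f + g \<in> N n" and N_diff: "f - g \<in> N n" if "f \<in> N n" "g \<in> N n" for f g n
    using that K by (auto simp: N_def l_lin subspace_add subspace_diff)
  have N_scale: "r *\<^sub>R f \<in> N n" and N_iota: "\<iota> f \<in> N n" if "f \<in> N n" for f r n
    using that K by (auto simp: N_def l_lin l(2) subspace_scale)
  have N_antimono: "f \<in> N m" if "f \<in> N n" "m \<le> n" for f m n
    using that by (auto simp: N_def)
  have N_Suc: "f \<in> N (Suc n)" if "f \<in> N n" "l n f = 0" for f n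
    using that by (auto simp: N_def less_Suc_eq)
  have "\<exists>x. x \<in> N n \<and> l n x = 1 \<and> (\<forall>h \<in> N (Suc n). x \<bullet> h = 0)" for n
  proof -
    define A where "A = {f \<in> N n. l n f = 1}"
    have "A = K \<inter> (\<Inter>j\<in>{..<n}. {f. l j f = 0}) \<inter> {f. l n f = 1}"
      by (auto simp: A_def N_def)
    then have "closed A"
      using K(1) l_closed by (auto intro!: closed_Int closed_INT)
    moreover have "convex A"
    proof (rule convexI)
      fix f g and s t :: real
      assume fg: "f \<in> A" "g \<in> A" and st: "s + t = 1"
      have "l n (s *\<^sub>R f + t *\<^sub>R g) = of_real (s + t)"
        using fg by (simp add: A_def l_lin scaleR_conv_of_real)
      then show "s *\<^sub>R f + t *\<^sub>R g \<in> A"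
        using fg unfolding st by (simp add: A_def N_add N_scale)
    qed
    moreover have "A \<noteq> {}"
    proof -
      obtain f where f: "f \<in> N n" "l n f \<noteq> 0"
        using exact[of n] by (auto simp: N_def)
      (* The complex multiple of f by z, written with real scalars, is normalised by l n = 1. *)
      define z where "z = inverse (l n f)"
      have "Re z *\<^sub>R f + Im z *\<^sub>R \<iota> f \<in> N n"
        using f(1) by (intro N_add N_scale N_iota)
      moreover have "l n (Re z *\<^sub>R f + Im z *\<^sub>R \<iota> f) = z * l n f"
        by (subst (3) complex_eq[of z]) (simp add: l_lin l(2) scaleR_conv_of_real algebra_simps)
      ultimately show ?thesis
        using f(2) by (auto simp: A_def z_def)
    qed
    ultimately obtain x where x: "x \<in> A" "\<And>y. y \<in> A \<Longrightarrow> norm x \<le> norm y"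
      using minimal_norm_element_exists by blast
    have "x \<bullet> h = 0" if h: "h \<in> N (Suc n)" for h
    proof (rule ccontr)
      assume nz: "x \<bullet> h \<noteq> 0"
      then have hh: "h \<bullet> h > 0" by auto
      define t where "t = (x \<bullet> h) / (h \<bullet> h)"
      have "h \<in> N n" "l n h = 0"
        using h N_antimono[of h "Suc n" n] by (auto simp: N_def)
      then have "x - t *\<^sub>R h \<in> A"
        using x(1) by (auto simp: A_def l_lin intro!: N_diff N_scale)
      then have "(norm x)\<^sup>2 \<le> (norm (x - t *\<^sub>R h))\<^sup>2"
        using x(2) by (intro power_mono) auto
      also have "\<dots> = (norm x)\<^sup>2 - 2 * t * (x \<bullet> h) + t * (t * (h \<bullet> h))"
        unfolding power2_norm_eq_inner by (simp add: inner_simps inner_commute)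
      also have "\<dots> = (norm x)\<^sup>2 - (x \<bullet> h)\<^sup>2 / (h \<bullet> h)"
        using hh by (simp add: t_def power2_eq_square)
      finally show False
        using nz hh by (simp add: field_simps)
    qed
    then show ?thesis
      using x(1) by (auto simp: A_def)
  qed
  then obtain x where x: "\<And>n. x n \<in> N n" "\<And>n. l n (x n) = 1"
      "\<And>n h. h \<in> N (Suc n) \<Longrightarrow> x n \<bullet> h = 0"
    by metis
  have x_nz: "x n \<noteq> 0" for n
    using x(2)[of n] bounded_linear.linear[OF l(1)[of n]] linear_0 by force
  have ix: "\<iota> (x n) \<bullet> h = 0" if "h \<in> N (Suc n)" for n h
    using x(3)[of "\<iota> h" n] N_iota[OF that] inner_iota_left by simp
  define e where "e n = (1 / norm (x n)) *\<^sub>R x n" for n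
  have e_N: "e n \<in> N n" for n
    unfolding e_def by (intro N_scale x)
  have e_norm: "e n \<bullet> e n = 1" for n
    using x_nz[of n] by (simp add: e_def dot_square_norm power2_eq_square)
  have e_perp: "e n \<bullet> h = 0" "\<iota> (e n) \<bullet> h = 0" if "h \<in> N (Suc n)" for n h
    using x(3)[OF that] ix[OF that] by (simp_all add: e_def blinfun.scaleR_right)
  have e_less: "e m \<bullet> e n = 0" "\<iota> (e m) \<bullet> e n = 0" "e m \<bullet> \<iota> (e n) = 0" "\<iota> (e m) \<bullet> \<iota> (e n) = 0"
    if "m < n" for m n
    using e_perp[OF N_antimono[OF e_N[of n] Suc_leI[OF that]]]
      e_perp[OF N_antimono[OF N_iota[OF e_N[of n]] Suc_leI[OF that]]] by auto
  have e_ne: "e m \<bullet> e n = 0" "\<iota> (e m) \<bullet> e n = 0" "e m \<bullet> \<iota> (e n) = 0" "\<iota> (e m) \<bullet> \<iota> (e n) = 0"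
    if "m \<noteq> n" for m n
    using e_less[of m n] e_less[of n m] that by (auto simp: inner_commute neq_iff)
  define u where "u k = (if even k then e (k div 2) else \<iota> (e (k div 2)))" for k
  have "adapted_basis K u"
    unfolding adapted_basis_def
  proof (intro conjI allI ballI impI)
    show "orthonormal_seq u"
      unfolding orthonormal_seq_def
    proof (intro allI)
      fix j k :: nat
      show "u j \<bullet> u k = (if j = k then 1 else 0)"
      proof (cases "j div 2 = k div 2")
        case True
        then have "j = k \<longleftrightarrow> even j = even k"
          by (metis bit_eq_rec)
        then show ?thesis
          using True e_norm inner_iota_left[of "e (k div 2)" "e (k div 2)"] by (auto simp: u_def inner_iota_iota)
      next
        case False
        then show ?thesis
          using e_ne[OF False] by (auto simp: u_def)
      qed
    qed
    show "u n \<in> K" for n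
      using e_N[of "n div 2"] K(3) by (auto simp: u_def N_def)
    show "u (2 * n + 1) = \<iota> (u (2 * n))" for n
      by (simp add: u_def)
  next
    fix f
    assume f: "f \<in> K" "\<forall>n. f \<bullet> u n = 0"
    have perp: "f \<bullet> x n = 0" "f \<bullet> \<iota> (x n) = 0" for n
      using f(2)[rule_format, of "2 * n"] f(2)[rule_format, of "2 * n + 1"] x_nz[of n]
      by (auto simp: u_def e_def blinfun.scaleR_right)
    have "f \<in> N n" for n
    proof (induction n)
      case 0
      then show ?case using f(1) by (simp add: N_def)
    next
      case (Suc n)
      define p q where "p = Re (l n f)" and "q = Im (l n f)"
      define h where "h = f - p *\<^sub>R x n - q *\<^sub>R \<iota> (x n)"
      have "h \<in> N n"
        unfolding h_def using Suc x(1) by (intro N_diff N_scale N_iota)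
      moreover have "l n h = 0"
        by (simp add: h_def l_lin l(2) x(2) p_def q_def complex_eq_iff)
      ultimately have "h \<in> N (Suc n)"
        by (rule N_Suc)
      then have "x n \<bullet> h = 0" "\<iota> (x n) \<bullet> h = 0"
        using x(3) ix by auto
      then have "p * (x n \<bullet> x n) = 0" "q * (x n \<bullet> x n) = 0"
        using perp[of n] inner_iota_left[of "x n" "x n"]
        by (simp_all add: h_def inner_simps inner_commute inner_iota_iota)
      then have "l n f = 0"
        using x_nz[of n] by (simp add: p_def q_def complex_eq_iff)
      then show ?case
        using Suc N_Suc by blast
    qed
    then show "f = 0"
      using separating[of f] by (auto simp: N_def)
  qed
  then show ?thesis
    by (rule that)
qed

end

section \<open>Caradus' criterion\<close>

text \<open>
  With \<open>V'\<close> a right inverse of \<open>U\<close> that satisfies \<open>L V' = 0\<close>, put \<open>J = \<Sum>\<^sub>k \<alpha>\<^sup>k V'\<^sup>k W T\<^sup>k\<close>. Applying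
  \<open>U\<close> removes the term \<open>k = 0\<close> and lowers the power of \<open>V'\<close> in the others, which gives \<open>U J = \<alpha> J T\<close>;
  applying \<open>L\<close> leaves only the term \<open>k = 0\<close>. A small \<open>\<alpha>\<close> makes the series converge.
\<close>

lemma caradus_intertwining:
  fixes \<iota> U V W L T :: "'h::banach \<Rightarrow>\<^sub>L 'h"
  assumes UV: "U o\<^sub>L V = id_blinfun" and UW: "U o\<^sub>L W = 0" and LW: "L o\<^sub>L W = id_blinfun"
    and iota: "V o\<^sub>L \<iota> = \<iota> o\<^sub>L V" "W o\<^sub>L \<iota> = \<iota> o\<^sub>L W" "L o\<^sub>L \<iota> = \<iota> o\<^sub>L L" "T o\<^sub>L \<iota> = \<iota> o\<^sub>L T"
  obtains \<alpha> :: real and J where "\<alpha> \<noteq> 0" "U o\<^sub>L J = \<alpha> *\<^sub>R (J o\<^sub>L T)" "L o\<^sub>L J = id_blinfun"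
    "J o\<^sub>L \<iota> = \<iota> o\<^sub>L J"
proof -
  note app = blinfun_eqI[where 'a='h and 'b='h]
  have UV_pt: "U (V f) = f" and UW_pt: "U (W f) = 0" and LW_pt: "L (W f) = f" for f
    using UV UW LW by (metis blinfun_apply_blinfun_compose id_blinfun.rep_eq id_apply blinfun.zero_left)+
  have V_iota: "V (\<iota> f) = \<iota> (V f)" and W_iota: "W (\<iota> f) = \<iota> (W f)"
    and L_iota: "L (\<iota> f) = \<iota> (L f)" and T_iota: "T (\<iota> f) = \<iota> (T f)" for f
    using iota by (metis blinfun_apply_blinfun_compose)+
  note pt = UV_pt UW_pt LW_pt V_iota W_iota L_iota T_iota
  (* Subtracting the kernel part W L V keeps U V' = 1 and achieves L V' = 0. *)
  define V' where "V' = V - (W o\<^sub>L L o\<^sub>L V)"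
  have V': "V' f = V f - W (L (V f))" for f
    by (simp add: V'_def blinfun.diff_left)
  define \<alpha> where "\<alpha> = 1 / (2 * (norm V' * norm T + 1))"
  have pos: "0 < norm V' * norm T + 1"
    by (simp add: add_nonneg_pos)
  then have \<alpha>: "\<alpha> > 0"
    by (simp add: \<alpha>_def)
  have small: "\<alpha> * (norm V' * norm T) \<le> 1 / 2"
    using pos by (simp add: \<alpha>_def field_simps)
  define Jk where "Jk = rec_nat W (\<lambda>_ A. \<alpha> *\<^sub>R (V' o\<^sub>L A o\<^sub>L T))"
  have Jk: "Jk 0 = W" "Jk (Suc k) = \<alpha> *\<^sub>R (V' o\<^sub>L Jk k o\<^sub>L T)" for k
    by (simp_all add: Jk_def)
  have norm_step: "norm (Jk (Suc k)) \<le> 1 / 2 * norm (Jk k)" for k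
  proof -
    have "norm (V' o\<^sub>L Jk k o\<^sub>L T) \<le> norm V' * norm (Jk k) * norm T"
      by (meson norm_blinfun_compose order_trans mult_right_mono norm_ge_zero)
    then have "norm (Jk (Suc k)) \<le> \<alpha> * (norm V' * norm (Jk k) * norm T)"
      using \<alpha> by (simp add: Jk)
    also have "\<dots> = (\<alpha> * (norm V' * norm T)) * norm (Jk k)"
      by simp
    also have "\<dots> \<le> 1 / 2 * norm (Jk k)"
      using small by (intro mult_right_mono) auto
    finally show ?thesis .
  qed
  have summ: "summable Jk"
    by (rule summable_ratio_test[of "1/2" 0]) (use norm_step in auto)
  define J where "J = (\<Sum>k. Jk k)"
  have J: "(\<lambda>k. Jk k f) sums J f" for f
    unfolding J_def
    by (intro bounded_linear.sums[OF blinfun.bounded_linear_left] summable_sums summ)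
  show ?thesis
  proof (rule that)
    show "\<alpha> \<noteq> 0" using \<alpha> by simp
    show "U o\<^sub>L J = \<alpha> *\<^sub>R (J o\<^sub>L T)"
    proof (rule app)
      fix f
      have "(\<lambda>k. U (Jk k f)) sums U (J f)"
        by (intro bounded_linear.sums[OF blinfun.bounded_linear_right] J)
      moreover have "U (Jk 0 f) = 0"
        by (simp add: Jk pt)
      ultimately have "(\<lambda>k. U (Jk (Suc k) f)) sums U (J f)"
        using sums_Suc_iff[of "\<lambda>k. U (Jk k f)" "U (J f)"] by simp
      moreover have "U (Jk (Suc k) f) = \<alpha> *\<^sub>R Jk k (T f)" for k
        by (simp add: Jk blinfun.scaleR_left blinfun.scaleR_right blinfun.diff_right V' pt)
      moreover have "(\<lambda>k. \<alpha> *\<^sub>R Jk k (T f)) sums (\<alpha> *\<^sub>R J (T f))"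
        by (intro bounded_linear.sums[OF bounded_linear_scaleR_right] J)
      ultimately show "(U o\<^sub>L J) f = (\<alpha> *\<^sub>R (J o\<^sub>L T)) f"
        using sums_unique2 by (simp add: blinfun.scaleR_left)
    qed
    show "L o\<^sub>L J = id_blinfun"
    proof (rule app)
      fix f
      have "(\<lambda>k. L (Jk k f)) sums L (J f)"
        by (intro bounded_linear.sums[OF blinfun.bounded_linear_right] J)
      moreover have "L (Jk k f) = (if k = 0 then f else 0)" for k
        by (cases k) (simp_all add: Jk pt blinfun.scaleR_left blinfun.scaleR_right blinfun.diff_right V')
      ultimately show "(L o\<^sub>L J) f = id_blinfun f"
        using sums_unique2[OF _ sums_single[of 0 "\<lambda>_. f"]] by simp
    qed
    have Jk_iota: "Jk k (\<iota> f) = \<iota> (Jk k f)" for k f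
      by (induction k arbitrary: f)
         (simp_all add: Jk pt V' blinfun.scaleR_left blinfun.scaleR_right blinfun.diff_right)
    show "J o\<^sub>L \<iota> = \<iota> o\<^sub>L J"
    proof (rule app)
      fix f
      have "(\<lambda>k. \<iota> (Jk k f)) sums \<iota> (J f)"
        by (intro bounded_linear.sums[OF blinfun.bounded_linear_right] J)
      then show "(J o\<^sub>L \<iota>) f = (\<iota> o\<^sub>L J) f"
        using J[of "\<iota> f"] sums_unique2 by (simp add: Jk_iota)
    qed
  qed
qed

section \<open>Square means on compact intervals\<close>

definition l2_norm_on :: "real \<Rightarrow> real \<Rightarrow> (real \<Rightarrow> complex) \<Rightarrow> real" where
  "l2_norm_on a b \<phi> = sqrt (integral {a..b} (\<lambda>t. (cmod (\<phi> t))\<^sup>2))"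

lemma l2_norm_on_nonneg [simp]: "0 \<le> l2_norm_on a b \<phi>"
  unfolding l2_norm_on_def
  by (cases "(\<lambda>t. (cmod (\<phi> t))\<^sup>2) integrable_on {a..b}")
     (auto intro: integral_nonneg simp: not_integrable_integral)

lemma l2_norm_on_square:
  "continuous_on {a..b} \<phi> \<Longrightarrow> (l2_norm_on a b \<phi>)\<^sup>2 = integral {a..b} (\<lambda>t. (cmod (\<phi> t))\<^sup>2)"
  unfolding l2_norm_on_def
  by (intro real_sqrt_pow2 integral_nonneg integrable_continuous_real continuous_intros) auto

lemma cauchy_schwarz_integral:
  fixes u v :: "real \<Rightarrow> real"
  assumes "continuous_on {a..b} u" "continuous_on {a..b} v"
  shows "(integral {a..b} (\<lambda>t. u t * v t))\<^sup>2
    \<le> integral {a..b} (\<lambda>t. (u t)\<^sup>2) * integral {a..b} (\<lambda>t. (v t)\<^sup>2)"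
proof -
  define P Q B where "P = integral {a..b} (\<lambda>t. (u t)\<^sup>2)" and "Q = integral {a..b} (\<lambda>t. (v t)\<^sup>2)"
    and "B = integral {a..b} (\<lambda>t. u t * v t)"
  have int: "(\<lambda>t. (u t)\<^sup>2) integrable_on {a..b}" "(\<lambda>t. (v t)\<^sup>2) integrable_on {a..b}"
    "(\<lambda>t. u t * v t) integrable_on {a..b}"
    by (intro integrable_continuous_real continuous_intros assms)+
  have quad: "0 \<le> P - 2 * s * B + s\<^sup>2 * Q" for s
  proof -
    have "((\<lambda>t. (u t)\<^sup>2 - 2 * s * (u t * v t) + s\<^sup>2 * (v t)\<^sup>2) has_integral P - 2 * s * B + s\<^sup>2 * Q) {a..b}"
      unfolding P_def Q_def B_def
      by (intro has_integral_add has_integral_diff has_integral_mult_right integrable_integral int)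
    moreover have "(u t)\<^sup>2 - 2 * s * (u t * v t) + s\<^sup>2 * (v t)\<^sup>2 = (u t - s * v t)\<^sup>2" for t
      by (simp add: power2_eq_square algebra_simps)
    ultimately show ?thesis
      using has_integral_nonneg[of _ "P - 2 * s * B + s\<^sup>2 * Q" "{a..b}"] by force
  qed
  have "0 \<le> Q"
    unfolding Q_def by (intro integral_nonneg int) auto
  have "B\<^sup>2 \<le> P * Q"
  proof (cases "Q = 0")
    case True
    have "B = 0"
    proof (rule ccontr)
      assume "B \<noteq> 0"
      then show False
        using quad[of "(P + 1) / (2 * B)"] True by simp
    qed
    then show ?thesis using True by simp
  next
    case False
    then have "Q > 0" using \<open>0 \<le> Q\<close> by simp
    then show ?thesis
      using quad[of "B / Q"] by (simp add: power2_eq_square field_simps)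
  qed
  then show ?thesis
    by (simp add: P_def Q_def B_def)
qed

lemma l2_norm_on_cauchy_schwarz:
  assumes "continuous_on {a..b} \<phi>" "continuous_on {a..b} \<theta>"
  shows "cmod (integral {a..b} (\<lambda>t. \<phi> t * cnj (\<theta> t))) \<le> l2_norm_on a b \<phi> * l2_norm_on a b \<theta>"
proof -
  have "cmod (integral {a..b} (\<lambda>t. \<phi> t * cnj (\<theta> t)))
    \<le> integral {a..b} (\<lambda>t. cmod (\<phi> t) * cmod (\<theta> t))"
    by (intro integral_norm_bound_integral integrable_continuous_real continuous_intros assms)
       (simp add: norm_mult)
  also have "\<dots> \<le> sqrt (integral {a..b} (\<lambda>t. (cmod (\<phi> t))\<^sup>2) * integral {a..b} (\<lambda>t. (cmod (\<theta> t))\<^sup>2))"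
    by (intro real_le_rsqrt cauchy_schwarz_integral continuous_intros assms)
  finally show ?thesis
    by (simp add: l2_norm_on_def real_sqrt_mult)
qed

lemma l2_norm_on_triangle:
  assumes "continuous_on {a..b} \<phi>" "continuous_on {a..b} \<theta>"
  shows "l2_norm_on a b (\<lambda>t. \<phi> t + \<theta> t) \<le> l2_norm_on a b \<phi> + l2_norm_on a b \<theta>"
proof -
  define p q where "p = l2_norm_on a b \<phi>" and "q = l2_norm_on a b \<theta>"
  have int: "(\<lambda>t. (cmod (\<phi> t))\<^sup>2) integrable_on {a..b}" "(\<lambda>t. (cmod (\<theta> t))\<^sup>2) integrable_on {a..b}"
    "(\<lambda>t. cmod (\<phi> t) * cmod (\<theta> t)) integrable_on {a..b}"
    by (intro integrable_continuous_real continuous_intros assms)+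
  have cross: "integral {a..b} (\<lambda>t. cmod (\<phi> t) * cmod (\<theta> t)) \<le> p * q"
  proof -
    have "(integral {a..b} (\<lambda>t. cmod (\<phi> t) * cmod (\<theta> t)))\<^sup>2 \<le> (p * q)\<^sup>2"
      using cauchy_schwarz_integral[of a b "\<lambda>t. cmod (\<phi> t)" "\<lambda>t. cmod (\<theta> t)"] assms
      by (simp add: p_def q_def power_mult_distrib l2_norm_on_square continuous_on_norm)
    then show ?thesis
      by (rule power2_le_imp_le) (simp add: p_def q_def)
  qed
  have "(l2_norm_on a b (\<lambda>t. \<phi> t + \<theta> t))\<^sup>2
    \<le> integral {a..b} (\<lambda>t. (cmod (\<phi> t))\<^sup>2 + 2 * (cmod (\<phi> t) * cmod (\<theta> t)) + (cmod (\<theta> t))\<^sup>2)"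
    unfolding l2_norm_on_square[OF continuous_on_add[OF assms]]
  proof (intro integral_le integrable_continuous_real continuous_intros assms)
    fix t
    have "(cmod (\<phi> t + \<theta> t))\<^sup>2 \<le> (cmod (\<phi> t) + cmod (\<theta> t))\<^sup>2"
      by (intro power_mono norm_triangle_ineq) auto
    then show "(cmod (\<phi> t + \<theta> t))\<^sup>2 \<le> (cmod (\<phi> t))\<^sup>2 + 2 * (cmod (\<phi> t) * cmod (\<theta> t)) + (cmod (\<theta> t))\<^sup>2"
      by (simp add: power2_sum)
  qed
  also have "\<dots> = p\<^sup>2 + 2 * integral {a..b} (\<lambda>t. cmod (\<phi> t) * cmod (\<theta> t)) + q\<^sup>2"
    using int by (simp add: p_def q_def l2_norm_on_square assms integral_add integrable_add)
  also have "\<dots> \<le> (p + q)\<^sup>2"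
    using cross by (simp add: power2_sum)
  finally show ?thesis
    unfolding p_def q_def by (rule power2_le_imp_le) simp
qed

lemma l2_norm_on_scale: "l2_norm_on a b (\<lambda>t. c * \<phi> t) = cmod c * l2_norm_on a b \<phi>"
  unfolding l2_norm_on_def by (simp add: norm_mult power_mult_distrib real_sqrt_mult)

lemma l2_norm_on_mono:
  assumes "continuous_on {a..b} \<phi>" "continuous_on {a..b} \<theta>" "\<And>t. t \<in> {a..b} \<Longrightarrow> cmod (\<phi> t) \<le> cmod (\<theta> t)"
  shows "l2_norm_on a b \<phi> \<le> l2_norm_on a b \<theta>"
  unfolding l2_norm_on_def
  by (intro real_sqrt_le_mono integral_le integrable_continuous_real continuous_intros assms power_mono)
     (use assms in auto)

lemma l2_norm_on_interval_mono:
  assumes "continuous_on {c..d} \<phi>" "{a..b} \<subseteq> {c..d}"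
  shows "l2_norm_on a b \<phi> \<le> l2_norm_on c d \<phi>"
  unfolding l2_norm_on_def
  by (intro real_sqrt_le_mono integral_subset_le integrable_continuous_real continuous_intros assms
      continuous_on_subset[OF assms]) auto

lemma l2_norm_on_affine:
  assumes "\<sigma> > 0" "continuous_on {\<sigma> * a + y..\<sigma> * b + y} \<phi>"
  shows "l2_norm_on a b (\<lambda>t. \<phi> (\<sigma> * t + y)) = l2_norm_on (\<sigma> * a + y) (\<sigma> * b + y) \<phi> / sqrt \<sigma>"
proof -
  have "((\<lambda>t. (cmod (\<phi> t))\<^sup>2) has_integral (l2_norm_on (\<sigma> * a + y) (\<sigma> * b + y) \<phi>)\<^sup>2)
      (cbox (\<sigma> * a + y) (\<sigma> * b + y))"
    unfolding l2_norm_on_square[OF assms(2)] interval_cbox[symmetric]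
    by (intro integrable_integral integrable_continuous_real continuous_intros assms)
  from has_integral_affinity'[OF this assms(1), of y]
  have "((\<lambda>t. (cmod (\<phi> (\<sigma> * t + y)))\<^sup>2) has_integral (l2_norm_on (\<sigma> * a + y) (\<sigma> * b + y) \<phi>)\<^sup>2 / \<sigma>) {a..b}"
    using assms(1) by (simp add: field_simps)
  then have "integral {a..b} (\<lambda>t. (cmod (\<phi> (\<sigma> * t + y)))\<^sup>2) = (l2_norm_on (\<sigma> * a + y) (\<sigma> * b + y) \<phi>)\<^sup>2 / \<sigma>"
    by (rule integral_unique)
  then show ?thesis
    unfolding l2_norm_on_def[of a b] by (simp add: real_sqrt_divide)
qed

section \<open>The Hardy norm as a supremum of seminorms\<close>

lemma mem_half_plane [simp]: "w \<in> right_half_plane \<longleftrightarrow> 0 < Re w"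
  by (simp add: right_half_plane_def)

lemma open_half_plane: "open right_half_plane"
  unfolding right_half_plane_def by (rule open_halfspace_Re_gt)

lemma convex_half_plane: "convex right_half_plane"
  unfolding right_half_plane_def by (rule convex_halfspace_Re_gt)

text \<open>
  Bounds on the integral over a line are thereby bounds on integrals of continuous functions over
  compact intervals, for which uniform limits and the triangle inequality are available without
  integrability considerations.
\<close>

lemma nn_integral_le_iff_intervals:
  fixes h :: "real \<Rightarrow> real"
  assumes cont: "continuous_on UNIV h" and nonneg: "\<And>t. 0 \<le> h t" and "0 \<le> K"
  shows "(\<integral>\<^sup>+ t. ennreal (h t) \<partial>lborel) \<le> ennreal K \<longleftrightarrow> (\<forall>R. integral {-R..R} h \<le> K)"
proof -
  have cut: "(\<integral>\<^sup>+ t. ennreal (indicator {-R..R} t * h t) \<partial>lborel) = ennreal (integral {-R..R} h)" for R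
    by (intro nn_integral_has_integral_lebesgue integrable_integral integrable_continuous_real
        continuous_on_subset[OF cont] nonneg) auto
  have nonneg_int: "0 \<le> integral {-R..R} h" for R
    by (intro integral_nonneg integrable_continuous_real continuous_on_subset[OF cont] nonneg) auto
  have [measurable]: "h \<in> borel_measurable borel"
    using cont by (rule borel_measurable_continuous_onI)
  show ?thesis
  proof
    assume le: "(\<integral>\<^sup>+ t. ennreal (h t) \<partial>lborel) \<le> ennreal K"
    show "\<forall>R. integral {-R..R} h \<le> K"
    proof
      fix R
      have "ennreal (integral {-R..R} h) \<le> (\<integral>\<^sup>+ t. ennreal (h t) \<partial>lborel)"
        unfolding cut[symmetric] using nonneg
        by (intro nn_integral_mono ennreal_leI) (auto simp: indicator_def)
      then show "integral {-R..R} h \<le> K"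
        using le \<open>0 \<le> K\<close> by (meson ennreal_le_iff order_trans)
    qed
  next
    assume le: "\<forall>R. integral {-R..R} h \<le> K"
    have "(\<integral>\<^sup>+ t. ennreal (h t) \<partial>lborel)
        = (\<integral>\<^sup>+ t. (SUP n::nat. ennreal (indicator {-real n..real n} t * h t)) \<partial>lborel)"
    proof (rule nn_integral_cong, rule antisym)
      fix t
      obtain n :: nat where "\<bar>t\<bar> \<le> real n"
        using real_arch_simple by blast
      then show "ennreal (h t) \<le> (SUP n::nat. ennreal (indicator {-real n..real n} t * h t))"
        by (intro SUP_upper2[of n]) (auto simp: indicator_def abs_le_iff)
      show "(SUP n::nat. ennreal (indicator {-real n..real n} t * h t)) \<le> ennreal (h t)"
        using nonneg by (intro SUP_least ennreal_leI) (auto simp: indicator_def)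
    qed
    also have "\<dots> = (SUP n::nat. \<integral>\<^sup>+ t. ennreal (indicator {-real n..real n} t * h t) \<partial>lborel)"
    proof (rule nn_integral_monotone_convergence_SUP)
      show "incseq (\<lambda>(n::nat) t. ennreal (indicator {-real n..real n} t * h t))"
        using nonneg by (intro incseq_SucI le_funI ennreal_leI) (auto simp: indicator_def)
    qed measurable
    also have "\<dots> \<le> ennreal K"
      unfolding cut using le by (intro SUP_least ennreal_leI) auto
    finally show "(\<integral>\<^sup>+ t. ennreal (h t) \<partial>lborel) \<le> ennreal K" .
  qed
qed

lemma continuous_on_line:
  assumes "continuous_on right_half_plane f" "x > 0"
  shows "continuous_on A (\<lambda>t. f (Complex x t))"
  using assms
  by (intro continuous_on_compose2[OF assms(1)]) (auto simp: Complex_eq intro!: continuous_intros)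

lemma hardy_norm_sq_le_iff:
  assumes "continuous_on right_half_plane f" "0 \<le> K"
  shows "hardy_norm_sq f \<le> ennreal (K\<^sup>2) \<longleftrightarrow> (\<forall>x>0. \<forall>R. l2_norm_on (-R) R (\<lambda>t. f (Complex x t)) \<le> K)"
proof -
  have "hardy_norm_sq f \<le> ennreal (K\<^sup>2) \<longleftrightarrow>
      (\<forall>x>0. (\<integral>\<^sup>+ t. ennreal ((cmod (f (Complex x t)))\<^sup>2) \<partial>lborel) \<le> ennreal (K\<^sup>2))"
    unfolding hardy_norm_sq_def by (auto simp: SUP_le_iff)
  also have "\<dots> \<longleftrightarrow> (\<forall>x>0. \<forall>R. integral {-R..R} (\<lambda>t. (cmod (f (Complex x t)))\<^sup>2) \<le> K\<^sup>2)"
    by (intro all_cong1 imp_cong refl nn_integral_le_iff_intervals continuous_intros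
        continuous_on_line assms) auto
  also have "\<dots> \<longleftrightarrow> (\<forall>x>0. \<forall>R. l2_norm_on (-R) R (\<lambda>t. f (Complex x t)) \<le> K)"
    by (intro all_cong1 imp_cong refl)
       (simp add: l2_norm_on_square[symmetric] continuous_on_line assms abs_le_square_iff[symmetric])
  finally show ?thesis .
qed

lemma hardy2_norm_nonneg [simp]: "0 \<le> hardy2_norm f"
  by (simp add: hardy2_norm_def)

lemma hardy2D:
  assumes "f \<in> hardy2"
  shows "f holomorphic_on right_half_plane" "continuous_on right_half_plane f"
    "Re w \<le> 0 \<Longrightarrow> f w = 0"
  using assms by (auto simp: hardy2_def intro: holomorphic_on_imp_continuous_on)

lemma hardy2_norm_le_iff:
  assumes "f \<in> hardy2" "0 \<le> K"
  shows "hardy2_norm f \<le> K \<longleftrightarrow> (\<forall>x>0. \<forall>R. l2_norm_on (-R) R (\<lambda>t. f (Complex x t)) \<le> K)"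
proof -
  have "hardy_norm_sq f < \<infinity>"
    using assms(1) by (simp add: hardy2_def)
  then have "hardy_norm_sq f = ennreal ((hardy2_norm f)\<^sup>2)"
    by (simp add: hardy2_norm_def less_top)
  then have "hardy2_norm f \<le> K \<longleftrightarrow> hardy_norm_sq f \<le> ennreal (K\<^sup>2)"
    using assms(2) by (simp add: abs_le_square_iff[symmetric])
  then show ?thesis
    by (simp add: hardy_norm_sq_le_iff[OF hardy2D(2)[OF assms(1)] assms(2)])
qed

lemma hardy2I:
  assumes "f holomorphic_on right_half_plane" "\<And>w. Re w \<le> 0 \<Longrightarrow> f w = 0" "0 \<le> K"
    and "\<And>x R. 0 < x \<Longrightarrow> l2_norm_on (-R) R (\<lambda>t. f (Complex x t)) \<le> K"
  shows "f \<in> hardy2" "hardy2_norm f \<le> K"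
proof -
  have "hardy_norm_sq f \<le> ennreal (K\<^sup>2)"
    using assms by (subst hardy_norm_sq_le_iff) (auto intro: holomorphic_on_imp_continuous_on)
  then have "hardy_norm_sq f < \<infinity>"
    by (rule order_le_less_trans) simp
  then show mem: "f \<in> hardy2"
    using assms(1,2) by (auto simp: hardy2_def)
  show "hardy2_norm f \<le> K"
    using assms by (simp add: hardy2_norm_le_iff[OF mem])
qed

lemma hardy2_segment:
  assumes "f \<in> hardy2" "x > 0"
  shows "l2_norm_on a b (\<lambda>t. f (Complex x t)) \<le> hardy2_norm f"
proof -
  define R where "R = max \<bar>a\<bar> \<bar>b\<bar>"
  have "l2_norm_on a b (\<lambda>t. f (Complex x t)) \<le> l2_norm_on (-R) R (\<lambda>t. f (Complex x t))"
    by (intro l2_norm_on_interval_mono continuous_on_line hardy2D assms) (auto simp: R_def)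
  also have "\<dots> \<le> hardy2_norm f"
    using hardy2_norm_le_iff[OF assms(1), of "hardy2_norm f"] assms(2) by simp
  finally show ?thesis .
qed

lemma hardy2_segment_affine:
  assumes "f \<in> hardy2" "x > 0" "\<sigma> > 0"
  shows "l2_norm_on a b (\<lambda>t. f (Complex x (\<sigma> * t + y))) \<le> hardy2_norm f / sqrt \<sigma>"
proof -
  have "l2_norm_on a b (\<lambda>t. f (Complex x (\<sigma> * t + y)))
      = l2_norm_on (\<sigma> * a + y) (\<sigma> * b + y) (\<lambda>t. f (Complex x t)) / sqrt \<sigma>"
    by (rule l2_norm_on_affine[of \<sigma> a y b "\<lambda>t. f (Complex x t)"]) (intro assms continuous_on_line hardy2D)+
  then show ?thesis
    using hardy2_segment[OF assms(1,2)] assms(3) by (simp add: divide_right_mono)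
qed

section \<open>Estimates by duality\<close>

text \<open>
  The Cauchy estimate on the discs of radius \<open>s Re w\<close>, as \<open>s\<close> tends to 1.
\<close>

lemma half_plane_deriv_bound:
  assumes g: "g holomorphic_on right_half_plane" "\<And>w. 0 < Re w \<Longrightarrow> cmod (g w) \<le> B" and w: "0 < Re w"
  shows "cmod (deriv g w) \<le> B / Re w"
proof -
  have "s * (cmod (deriv g w) * Re w) \<le> B" if s: "0 < s" "s < 1" for s
  proof -
    have sub: "cball w (s * Re w) \<subseteq> right_half_plane"
    proof
      fix v
      assume "v \<in> cball w (s * Re w)"
      then have "Re w - Re v \<le> s * Re w"
        using abs_Re_le_cmod[of "w - v"] by (simp add: dist_norm)
      moreover have "s * Re w < 1 * Re w"
        using s w by (intro mult_strict_right_mono) auto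
      ultimately show "v \<in> right_half_plane" by simp
    qed
    have "cmod ((deriv ^^ 1) g w) \<le> fact 1 * B / (s * Re w) ^ 1"
    proof (rule Cauchy_inequality)
      show "g holomorphic_on ball w (s * Re w)"
        using g(1) sub ball_subset_cball holomorphic_on_subset by blast
      show "continuous_on (cball w (s * Re w)) g"
        using g(1) sub holomorphic_on_imp_continuous_on continuous_on_subset by blast
      show "0 < s * Re w"
        using s w by simp
      fix v
      assume "cmod (w - v) = s * Re w"
      then have "v \<in> cball w (s * Re w)"
        by (simp add: dist_norm)
      then show "cmod (g v) \<le> B"
        using g(2) sub by auto
    qed
    then show ?thesis
      using s w by (simp add: field_simps)
  qed
  then have "cmod (deriv g w) * Re w \<le> B"
    by (rule field_le_mult_one_interval)
  then show ?thesis
    using w by (simp add: field_simps)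
qed

lemma half_plane_increment_bound:
  assumes g: "g holomorphic_on right_half_plane" "\<And>w. 0 < Re w \<Longrightarrow> cmod (g w) \<le> B"
    and w: "0 < Re w" and c: "0 \<le> Re c"
  shows "cmod (g (w + c) - g w) \<le> B / Re w * cmod c"
proof -
  have "0 \<le> B"
    using order_trans[OF norm_ge_zero g(2)[OF w]] .
  have "cmod (g (w + c) - g w) \<le> B / Re w * cmod (w + c - w)"
  proof (rule field_differentiable_bound[where S = "{v. Re w \<le> Re v}" and f' = "deriv g"])
    fix v
    assume v: "v \<in> {v. Re w \<le> Re v}"
    then have "0 < Re v" using w by simp
    then show "(g has_field_derivative deriv g v) (at v within {v. Re w \<le> Re v})"
      using g(1) open_half_plane by (intro DERIV_subset[OF holomorphic_derivI]) auto
    have "cmod (deriv g v) \<le> B / Re v"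
      by (rule half_plane_deriv_bound[OF g \<open>0 < Re v\<close>])
    also have "\<dots> \<le> B / Re w"
      using v w \<open>0 \<le> B\<close> by (intro divide_left_mono) auto
    finally show "cmod (deriv g v) \<le> B / Re w" .
  qed (use c convex_halfspace_Re_ge[of "Re w"] in auto)
  then show ?thesis by simp
qed

text \<open>
  The pairing of \<open>f\<close>, on a segment that moves with \<open>w\<close>, with a fixed function \<open>\<phi>\<close>. It is analytic in
  \<open>w\<close> and bounded on the whole half-plane by a multiple of the Hardy norm of \<open>f\<close>
  (\<open>dual_fn_norm_bound\<close>), so scalar function theory yields estimates in mean square.
\<close>

definition dual_fn :: "(complex \<Rightarrow> complex) \<Rightarrow> real \<Rightarrow> real \<Rightarrow> (real \<Rightarrow> complex) \<Rightarrow> complex \<Rightarrow> complex" where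
  "dual_fn f a b \<phi> w = integral {a..b} (\<lambda>t. f (w + \<i> * of_real t) * cnj (\<phi> t))"

lemma dual_fn_has_derivative:
  assumes f: "f holomorphic_on right_half_plane" and \<phi>: "continuous_on {a..b} \<phi>" and w: "0 < Re w"
  shows "(dual_fn f a b \<phi> has_field_derivative
      integral {a..b} (\<lambda>t. deriv f (w + \<i> * of_real t) * cnj (\<phi> t))) (at w)"
proof -
  have contf: "continuous_on right_half_plane f" "continuous_on right_half_plane (deriv f)"
    using f open_half_plane by (auto intro: holomorphic_on_imp_continuous_on holomorphic_deriv)
  have \<phi>': "continuous_on (right_half_plane \<times> {a..b}) (\<lambda>p. cnj (\<phi> (snd p)))"
    by (intro continuous_on_cnj continuous_on_compose2[OF \<phi>] continuous_intros) auto
  have "((\<lambda>w. integral (cbox a b) (\<lambda>t. f (w + \<i> * of_real t) * cnj (\<phi> t))) has_field_derivative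
      integral (cbox a b) (\<lambda>t. deriv f (w + \<i> * of_real t) * cnj (\<phi> t))) (at w within right_half_plane)"
  proof (rule leibniz_rule_field_derivative)
    fix v t
    assume v: "v \<in> right_half_plane"
    have "(f has_field_derivative deriv f (v + \<i> * of_real t)) (at (v + \<i> * of_real t))"
      using v by (intro holomorphic_derivI[OF f open_half_plane]) simp
    moreover have "((\<lambda>v. v + \<i> * of_real t) has_field_derivative 1) (at v within right_half_plane)"
      by (auto intro!: derivative_eq_intros)
    ultimately have "((\<lambda>v. f (v + \<i> * of_real t)) has_field_derivative deriv f (v + \<i> * of_real t)) (at v within right_half_plane)"
      using DERIV_chain2[where f = f and g = "\<lambda>v. v + \<i> * of_real t" and x = v and s = right_half_plane]
      by fastforce
    then show "((\<lambda>v. f (v + \<i> * of_real t) * cnj (\<phi> t)) has_field_derivative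
        deriv f (v + \<i> * of_real t) * cnj (\<phi> t)) (at v within right_half_plane)"
      by (rule DERIV_cmult_right)
  next
    fix v
    assume v: "v \<in> right_half_plane"
    show "(\<lambda>t. f (v + \<i> * of_real t) * cnj (\<phi> t)) integrable_on cbox a b"
      unfolding interval_cbox[symmetric] using v
      by (intro integrable_continuous_real continuous_intros \<phi> continuous_on_compose2[OF contf(1)]) auto
  next
    show "continuous_on (right_half_plane \<times> cbox a b) (\<lambda>(v, t). deriv f (v + \<i> * of_real t) * cnj (\<phi> t))"
      unfolding split_beta interval_cbox[symmetric]
      by (intro continuous_on_mult \<phi>' continuous_on_compose2[OF contf(2)] continuous_intros) auto
  qed (use w convex_half_plane in auto)
  then have "(dual_fn f a b \<phi> has_field_derivative
      integral {a..b} (\<lambda>t. deriv f (w + \<i> * of_real t) * cnj (\<phi> t))) (at w within right_half_plane)"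
    unfolding dual_fn_def interval_cbox .
  then show ?thesis
    using at_within_open[OF _ open_half_plane, of w] w by simp
qed

lemma dual_fn_holomorphic:
  assumes "f holomorphic_on right_half_plane" "continuous_on {a..b} \<phi>"
  shows "dual_fn f a b \<phi> holomorphic_on right_half_plane"
  unfolding holomorphic_on_open[OF open_half_plane]
  using dual_fn_has_derivative[OF assms] by (meson mem_half_plane)

lemma dual_fn_bound:
  assumes f: "f \<in> hardy2" and \<phi>: "continuous_on {a..b} \<phi>" and w: "0 < Re w"
  shows "cmod (dual_fn f a b \<phi> w)
    \<le> l2_norm_on (a + Im w) (b + Im w) (\<lambda>t. f (Complex (Re w) t)) * l2_norm_on a b \<phi>"
proof -
  have eq: "w + \<i> * of_real t = Complex (Re w) (1 * t + Im w)" for t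
    by (simp add: complex_eq_iff)
  have "cmod (dual_fn f a b \<phi> w) \<le> l2_norm_on a b (\<lambda>t. f (w + \<i> * of_real t)) * l2_norm_on a b \<phi>"
    unfolding dual_fn_def using w
    by (intro l2_norm_on_cauchy_schwarz \<phi> continuous_on_compose2[OF hardy2D(2)[OF f]] continuous_intros) auto
  also have "l2_norm_on a b (\<lambda>t. f (w + \<i> * of_real t)) = l2_norm_on (a + Im w) (b + Im w) (\<lambda>t. f (Complex (Re w) t))"
    unfolding eq
    using l2_norm_on_affine[of 1 a "Im w" b "\<lambda>t. f (Complex (Re w) t)"]
      continuous_on_line[OF hardy2D(2)[OF f] w] by simp
  finally show ?thesis .
qed

lemma dual_fn_norm_bound:
  assumes "f \<in> hardy2" "continuous_on {a..b} \<phi>" "0 < Re w"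
  shows "cmod (dual_fn f a b \<phi> w) \<le> hardy2_norm f * l2_norm_on a b \<phi>"
  using dual_fn_bound[OF assms] hardy2_segment[OF assms(1,3)]
  by (meson l2_norm_on_nonneg mult_right_mono order_trans)

lemma le_of_mult_self_le: "0 \<le> p \<Longrightarrow> 0 \<le> q \<Longrightarrow> p * p \<le> q * p \<Longrightarrow> p \<le> (q::real)"
  by (cases "p = 0") auto

text \<open>
  If \<open>\<phi>\<close> is the increment of \<open>f\<close> itself, then the increment of \<open>dual_fn\<close> is the squared norm of \<open>\<phi>\<close>,
  and the increment of a bounded analytic function is small far from the imaginary axis.
\<close>

lemma hardy2_translation_estimate:
  assumes f: "f \<in> hardy2" and x: "0 < x" and c: "0 \<le> Re c"
  shows "l2_norm_on a b (\<lambda>t. f (Complex x t + c) - f (Complex x t)) \<le> hardy2_norm f / x * cmod c"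
proof -
  define \<phi> where "\<phi> t = f (Complex x t + c) - f (Complex x t)" for t
  define p where "p = l2_norm_on a b \<phi>"
  have cont: "continuous_on {a..b} (\<lambda>t. f (Complex x t + c))" "continuous_on {a..b} (\<lambda>t. f (Complex x t))"
    by (rule continuous_on_compose2[OF hardy2D(2)[OF f]];
        use x c in \<open>auto simp: Complex_eq intro!: continuous_intros\<close>)+
  then have \<phi>: "continuous_on {a..b} \<phi>"
    unfolding \<phi>_def by (intro continuous_intros)
  have "dual_fn f a b \<phi> (of_real x + c) - dual_fn f a b \<phi> (of_real x)
      = integral {a..b} (\<lambda>t. f (Complex x t + c) * cnj (\<phi> t) - f (Complex x t) * cnj (\<phi> t))"
  proof -
    have "dual_fn f a b \<phi> (of_real x + c) = integral {a..b} (\<lambda>t. f (Complex x t + c) * cnj (\<phi> t))"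
      "dual_fn f a b \<phi> (of_real x) = integral {a..b} (\<lambda>t. f (Complex x t) * cnj (\<phi> t))"
      by (simp_all add: dual_fn_def Complex_eq add_ac)
    then show ?thesis
      by (simp only:, intro integral_diff[symmetric] integrable_continuous_real continuous_on_mult
          continuous_on_cnj cont \<phi>)
  qed
  also have "\<dots> = integral {a..b} (\<lambda>t. of_real ((cmod (\<phi> t))\<^sup>2))"
    by (intro integral_cong) (simp only: \<phi>_def complex_norm_square left_diff_distrib)
  also have "\<dots> = of_real (p\<^sup>2)"
    unfolding p_def l2_norm_on_square[OF \<phi>]
    by (intro integral_unique has_integral_of_real integrable_integral integrable_continuous_real continuous_intros \<phi>)
  finally have "p\<^sup>2 = cmod (dual_fn f a b \<phi> (of_real x + c) - dual_fn f a b \<phi> (of_real x))"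
    by (simp add: norm_power)
  also have "\<dots> \<le> hardy2_norm f * p / Re (of_real x) * cmod c"
    unfolding p_def using x c
    by (intro half_plane_increment_bound dual_fn_holomorphic dual_fn_norm_bound hardy2D(1) f \<phi>) auto
  finally have "p * p \<le> (hardy2_norm f / x * cmod c) * p"
    by (simp add: power2_eq_square mult_ac)
  then have "p \<le> hardy2_norm f / x * cmod c"
    by (rule le_of_mult_self_le[rotated 2]) (use x in \<open>simp_all add: p_def\<close>)
  then show ?thesis
    by (simp add: p_def \<phi>_def[abs_def])
qed

text \<open>
  The mean of \<open>f\<close> over the segment of length \<open>Re w\<close> above \<open>w\<close> is bounded by the Cauchy-Schwarz
  inequality. The oscillation of \<open>f\<close> on that segment is bounded as well: up to the factor \<open>-\<i>\<close>,
  \<open>f (w + \<i> t) - f w\<close> is the derivative of the integral of \<open>f\<close> over the segment of length \<open>t\<close>, which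
  is a bounded analytic function of \<open>w\<close>.
\<close>

lemma hardy2_pointwise_bound:
  assumes f: "f \<in> hardy2" and w: "0 < Re w"
  shows "cmod (f w) \<le> 2 * hardy2_norm f / sqrt (Re w)"
proof -
  define \<rho> N where "\<rho> = Re w" and "N = hardy2_norm f"
  have \<rho>: "\<rho> > 0" and N: "0 \<le> N"
    using w by (simp_all add: \<rho>_def N_def)
  have one: "l2_norm_on 0 t (\<lambda>_. 1) = sqrt t" if "0 \<le> t" for t
    using that by (simp add: l2_norm_on_def)
  have shift: "cmod (f (w + \<i> * of_real t) - f w) \<le> N * sqrt \<rho> / \<rho>" if t: "0 \<le> t" "t \<le> \<rho>" for t
  proof -
    have "((\<lambda>s. deriv f (w + \<i> * of_real s)) has_integral
        - \<i> * f (w + \<i> * of_real t) - - \<i> * f (w + \<i> * of_real 0)) {0..t}"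
    proof (rule fundamental_theorem_of_calculus[OF t(1)])
      fix s
      have "(f has_field_derivative deriv f (w + \<i> * of_real s)) (at (w + \<i> * of_real s))"
        using w by (intro holomorphic_derivI[OF hardy2D(1)[OF f] open_half_plane]) simp
      then have "(f has_field_derivative deriv f (w + \<i> * of_real s))
          (at (w + \<i> * of_real s) within (\<lambda>s. w + \<i> * of_real s) ` {0..t})"
        by (rule has_field_derivative_at_within)
      moreover have "((\<lambda>s. w + \<i> * of_real s) has_vector_derivative \<i>) (at s within {0..t})"
        unfolding has_vector_derivative_def
        by (auto intro!: derivative_eq_intros simp: scaleR_conv_of_real mult.commute)
      ultimately have "((\<lambda>s. f (w + \<i> * of_real s)) has_vector_derivative \<i> * deriv f (w + \<i> * of_real s)) (at s within {0..t})"
        using field_vector_diff_chain_within[where f = "\<lambda>s. w + \<i> * of_real s" and g = f] by (simp add: o_def)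
      then have "((\<lambda>s. - \<i> * f (w + \<i> * of_real s)) has_vector_derivative - \<i> * (\<i> * deriv f (w + \<i> * of_real s)))
          (at s within {0..t})"
        by (rule has_vector_derivative_mult_right)
      then show "((\<lambda>s. - \<i> * f (w + \<i> * of_real s)) has_vector_derivative deriv f (w + \<i> * of_real s))
          (at s within {0..t})"
        by (simp flip: mult.assoc)
    qed
    then have "integral {0..t} (\<lambda>s. deriv f (w + \<i> * of_real s) * cnj 1) = - \<i> * (f (w + \<i> * of_real t) - f w)"
      by (simp add: integral_unique algebra_simps)
    then have "deriv (dual_fn f 0 t (\<lambda>_. 1)) w = - \<i> * (f (w + \<i> * of_real t) - f w)"
      using dual_fn_has_derivative[OF hardy2D(1)[OF f], of 0 t "\<lambda>_. 1" w] w
      by (simp add: DERIV_imp_deriv)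
    moreover have "cmod (deriv (dual_fn f 0 t (\<lambda>_. 1)) w) \<le> N * sqrt t / \<rho>"
      unfolding \<rho>_def N_def one[OF t(1), symmetric]
      by (intro half_plane_deriv_bound dual_fn_holomorphic dual_fn_norm_bound hardy2D(1) f w continuous_on_const)
    ultimately have "cmod (f (w + \<i> * of_real t) - f w) \<le> N * sqrt t / \<rho>"
      by (simp add: norm_mult)
    also have "\<dots> \<le> N * sqrt \<rho> / \<rho>"
      using t \<rho> N by (intro divide_right_mono mult_left_mono) auto
    finally show ?thesis .
  qed
  have cont: "continuous_on {0..\<rho>} (\<lambda>t. f (w + \<i> * of_real t))"
    using w by (intro continuous_on_compose2[OF hardy2D(2)[OF f]] continuous_intros) auto
  have "of_real \<rho> * f w = dual_fn f 0 \<rho> (\<lambda>_. 1) w - integral {0..\<rho>} (\<lambda>t. f (w + \<i> * of_real t) - f w)"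
    using \<rho> by (simp add: dual_fn_def integral_diff integrable_continuous_real cont scaleR_conv_of_real)
  then have "\<rho> * cmod (f w) = cmod (dual_fn f 0 \<rho> (\<lambda>_. 1) w - integral {0..\<rho>} (\<lambda>t. f (w + \<i> * of_real t) - f w))"
    using \<rho> by (metis norm_mult norm_of_real abs_of_pos)
  also have "\<dots> \<le> cmod (dual_fn f 0 \<rho> (\<lambda>_. 1) w) + cmod (integral {0..\<rho>} (\<lambda>t. f (w + \<i> * of_real t) - f w))"
    by (rule norm_triangle_ineq4)
  also have "\<dots> \<le> N * sqrt \<rho> + (N * sqrt \<rho> / \<rho>) * (\<rho> - 0)"
  proof (rule add_mono)
    show "cmod (dual_fn f 0 \<rho> (\<lambda>_. 1) w) \<le> N * sqrt \<rho>"
      using dual_fn_norm_bound[OF f, of 0 \<rho> "\<lambda>_. 1" w] w \<rho> by (simp add: one N_def)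
    show "cmod (integral {0..\<rho>} (\<lambda>t. f (w + \<i> * of_real t) - f w)) \<le> (N * sqrt \<rho> / \<rho>) * (\<rho> - 0)"
      using \<rho> shift by (intro integral_bound continuous_intros cont) auto
  qed
  also have "\<dots> = \<rho> * (2 * N / sqrt \<rho>)"
    using \<rho> by (simp add: real_div_sqrt field_simps flip: power2_eq_square)
  finally have "cmod (f w) \<le> 2 * N / sqrt \<rho>"
    using \<rho> by (rule mult_left_le_imp_le)
  then show ?thesis
    by (simp add: \<rho>_def N_def)
qed

text \<open>
  The argument of Phragmen and Lindelof: division by \<open>1 + \<epsilon> (w - x)\<close>, which has modulus at least 1 and
  tends to infinity, makes the function small on large half-circles; then \<open>\<epsilon>\<close> tends to 0.
\<close>

lemma half_plane_maximum_principle: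
  assumes g: "g holomorphic_on right_half_plane" "\<And>w. 0 < Re w \<Longrightarrow> cmod (g w) \<le> B"
    and x: "0 < x" and line: "\<And>w. Re w = x \<Longrightarrow> cmod (g w) \<le> m" and w: "x \<le> Re w"
  shows "cmod (g w) \<le> m"
proof (rule field_le_epsilon)
  fix d :: real
  assume "d > 0"
  define m' where "m' = m + d"
  have "0 \<le> m"
    using order_trans[OF norm_ge_zero line[of "of_real x"]] by simp
  then have m': "m' > 0"
    using \<open>d > 0\<close> by (simp add: m'_def)
  have "0 \<le> B"
    using order_trans[OF norm_ge_zero g(2)[of 1]] by simp
  have step: "cmod (g w) \<le> m' * cmod (1 + of_real \<epsilon> * (w - of_real x))" if \<epsilon>: "\<epsilon> > 0" for \<epsilon>
  proof -
    define r where "r = max (cmod (w - of_real x) + 1) (B / (\<epsilon> * m'))"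
    define S where "S = {v. x < Re v} \<inter> ball (of_real x) r"
    define h where "h v = g v / (1 + of_real \<epsilon> * (v - of_real x))" for v
    have denom1: "1 \<le> cmod (1 + of_real \<epsilon> * (v - of_real x))"
      and denom2: "\<epsilon> * cmod (v - of_real x) \<le> cmod (1 + of_real \<epsilon> * (v - of_real x))" if "x \<le> Re v" for v
    proof -
      have nn: "0 \<le> \<epsilon> * (Re v - x)"
        using \<epsilon> that by simp
      show "1 \<le> cmod (1 + of_real \<epsilon> * (v - of_real x))"
        using complex_Re_le_cmod[of "1 + of_real \<epsilon> * (v - of_real x)"] nn by simp
      have "cmod (of_real \<epsilon> * (v - of_real x)) \<le> cmod (1 + of_real \<epsilon> * (v - of_real x))"
        using nn by (simp add: cmod_def power2_eq_square algebra_simps)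
      then show "\<epsilon> * cmod (v - of_real x) \<le> cmod (1 + of_real \<epsilon> * (v - of_real x))"
        using \<epsilon> by (simp add: norm_mult)
    qed
    have denom_nz: "1 + of_real \<epsilon> * (v - of_real x) \<noteq> 0" if "x \<le> Re v" for v
      using denom1[OF that] by auto
    have r: "cmod (w - of_real x) < r" "B / (\<epsilon> * m') \<le> r" "0 < r"
      unfolding r_def using norm_ge_zero[of "w - of_real x"] by linarith+
    have "open S"
      unfolding S_def by (intro open_Int open_halfspace_Re_gt open_ball)
    have closure: "closure S \<subseteq> {v. x \<le> Re v} \<inter> cball (of_real x) r"
      unfolding S_def by (intro closure_minimal closed_Int closed_halfspace_Re_ge closed_cball) auto
    have hol: "h holomorphic_on {v. x \<le> Re v}"
      unfolding h_def using denom_nz x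
      by (intro holomorphic_intros holomorphic_on_subset[OF g(1)]) auto
    show ?thesis
    proof (cases "Re w = x")
      case True
      then have "cmod (g w) \<le> m' * 1"
        using line[of w] \<open>d > 0\<close> by (simp add: m'_def)
      also have "\<dots> \<le> m' * cmod (1 + of_real \<epsilon> * (w - of_real x))"
        using denom1[OF w] m' by (intro mult_left_mono) auto
      finally show ?thesis .
    next
      case False
      have "cmod (h w) \<le> m'"
      proof (rule maximum_modulus_frontier[of h S])
        show "h holomorphic_on interior S"
          by (rule holomorphic_on_subset[OF hol]) (use interior_subset[of S] in \<open>auto simp: S_def\<close>)
        show "continuous_on (closure S) h"
          using holomorphic_on_imp_continuous_on[OF hol] closure continuous_on_subset by blast
        show "bounded S"
          unfolding S_def by (simp add: bounded_Int)
        show "w \<in> S"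
          using w False r by (simp add: S_def dist_norm norm_minus_commute)
        fix v
        assume v: "v \<in> frontier S"
        then have vc: "x \<le> Re v" "cmod (v - of_real x) \<le> r"
          using closure by (auto simp: frontier_def dist_norm norm_minus_commute)
        have "v \<notin> S"
          using v \<open>open S\<close> by (simp add: frontier_def interior_open)
        then consider "Re v = x" | "cmod (v - of_real x) = r"
          using vc by (force simp: S_def dist_norm norm_minus_commute)
        then show "cmod (h v) \<le> m'"
        proof cases
          case 1
          have "cmod (g v) \<le> m' * 1"
            using line[OF 1] \<open>d > 0\<close> by (simp add: m'_def)
          also have "\<dots> \<le> m' * cmod (1 + of_real \<epsilon> * (v - of_real x))"
            using denom1[OF vc(1)] m' by (intro mult_left_mono) auto
          finally show ?thesis
            using denom_nz[OF vc(1)] by (simp add: h_def norm_divide divide_le_eq)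
        next
          case 2
          have "cmod (g v) \<le> B"
            using g(2)[of v] vc x by simp
          also have "B \<le> m' * (\<epsilon> * r)"
            using r(2) \<epsilon> m' by (simp add: field_simps)
          also have "\<dots> \<le> m' * cmod (1 + of_real \<epsilon> * (v - of_real x))"
            using denom2[OF vc(1)] 2 m' by (intro mult_left_mono) auto
          finally show ?thesis
            using denom_nz[OF vc(1)] by (simp add: h_def norm_divide divide_le_eq)
        qed
      qed
      then show ?thesis
        using denom_nz[OF w] by (simp add: h_def norm_divide divide_le_eq)
    qed
  qed
  have "((\<lambda>\<epsilon>. m' * cmod (1 + of_real \<epsilon> * (w - of_real x))) \<longlongrightarrow> m' * cmod (1 + of_real 0 * (w - of_real x))) (at_right 0)"
    by (intro tendsto_intros)
  then have "cmod (g w) \<le> m' * cmod (1 + of_real 0 * (w - of_real x))"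
    by (rule tendsto_lowerbound) (use step in \<open>auto simp: eventually_at_filter\<close>)
  then show "cmod (g w) \<le> m + d"
    by (simp add: m'_def)
qed

text \<open>
  Pair \<open>f\<close> with its own restriction to the line through \<open>x'\<close>: the pairing equals the square mean
  there, and the maximum principle bounds it by its values on the line through \<open>x\<close>.
\<close>

lemma hardy2_line_mean_antimono:
  assumes f: "f \<in> hardy2" and x: "0 < x" "x \<le> x'"
    and K: "\<And>a b. l2_norm_on a b (\<lambda>t. f (Complex x t)) \<le> K"
  shows "l2_norm_on a b (\<lambda>t. f (Complex x' t)) \<le> K"
proof -
  define \<phi> where "\<phi> t = f (Complex x' t)" for t
  define p where "p = l2_norm_on a b \<phi>"
  have \<phi>: "continuous_on {a..b} \<phi>"
    unfolding \<phi>_def using x by (intro continuous_on_line hardy2D(2) f) auto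
  have "dual_fn f a b \<phi> (of_real x') = integral {a..b} (\<lambda>t. of_real ((cmod (\<phi> t))\<^sup>2))"
    unfolding dual_fn_def
    by (intro integral_cong) (simp only: \<phi>_def complex_norm_square Complex_eq)
  also have "\<dots> = of_real (p\<^sup>2)"
    unfolding p_def l2_norm_on_square[OF \<phi>]
    by (intro integral_unique has_integral_of_real integrable_integral integrable_continuous_real continuous_intros \<phi>)
  finally have "p\<^sup>2 = cmod (dual_fn f a b \<phi> (of_real x'))"
    by (simp add: norm_power)
  also have "\<dots> \<le> K * p"
  proof (rule half_plane_maximum_principle[where g = "dual_fn f a b \<phi>" and x = x and B = "hardy2_norm f * l2_norm_on a b \<phi>"])
    show "dual_fn f a b \<phi> holomorphic_on right_half_plane"
      by (intro dual_fn_holomorphic hardy2D(1) f \<phi>)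
    show "cmod (dual_fn f a b \<phi> w) \<le> hardy2_norm f * l2_norm_on a b \<phi>" if "0 < Re w" for w
      using that by (intro dual_fn_norm_bound f \<phi>)
    show "cmod (dual_fn f a b \<phi> w) \<le> K * p" if "Re w = x" for w
    proof -
      have "cmod (dual_fn f a b \<phi> w) \<le> l2_norm_on (a + Im w) (b + Im w) (\<lambda>t. f (Complex x t)) * p"
        using dual_fn_bound[OF f \<phi>, of w] that x by (simp add: p_def)
      also have "\<dots> \<le> K * p"
        using K by (intro mult_right_mono) (auto simp: p_def)
      finally show ?thesis .
    qed
  qed (use x in auto)
  finally have "p * p \<le> K * p"
    by (simp add: power2_eq_square)
  moreover have "0 \<le> K"
    using K[of 0 0] l2_norm_on_nonneg order_trans by blast
  ultimately have "p \<le> K"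
    by (intro le_of_mult_self_le[of p K]) (simp_all add: p_def)
  then show ?thesis
    by (simp add: p_def \<phi>_def[abs_def])
qed

section \<open>The Hardy space as a Hilbert space\<close>

lemma holomorphic_zero_extension:
  assumes "f holomorphic_on right_half_plane"
  shows "(\<lambda>w. if 0 < Re w then f w else 0) holomorphic_on right_half_plane"
  by (rule holomorphic_transform[OF assms]) simp

lemma continuous_on_line_hardy2: "f \<in> hardy2 \<Longrightarrow> x > 0 \<Longrightarrow> continuous_on A (\<lambda>t. f (Complex x t))"
  by (intro continuous_on_line hardy2D(2))

lemma hardy2_add:
  assumes "f \<in> hardy2" "g \<in> hardy2"
  shows "f + g \<in> hardy2" "hardy2_norm (f + g) \<le> hardy2_norm f + hardy2_norm g"
proof -
  have le: "l2_norm_on (-R) R (\<lambda>t. (f + g) (Complex x t)) \<le> hardy2_norm f + hardy2_norm g" if "0 < x" for x R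
  proof -
    have "l2_norm_on (-R) R (\<lambda>t. (f + g) (Complex x t))
        \<le> l2_norm_on (-R) R (\<lambda>t. f (Complex x t)) + l2_norm_on (-R) R (\<lambda>t. g (Complex x t))"
      unfolding plus_fun_apply using that by (intro l2_norm_on_triangle continuous_on_line_hardy2 assms)
    also have "\<dots> \<le> hardy2_norm f + hardy2_norm g"
      using that by (intro add_mono hardy2_segment assms)
    finally show ?thesis .
  qed
  have hol: "f + g holomorphic_on right_half_plane"
    unfolding plus_fun_def by (intro holomorphic_intros hardy2D assms)
  show "f + g \<in> hardy2" "hardy2_norm (f + g) \<le> hardy2_norm f + hardy2_norm g"
    by (rule hardy2I[OF hol _ _ le]; simp add: hardy2D assms)+
qed

lemma hardy2_scale:
  assumes "f \<in> hardy2"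
  shows "fun_scale c f \<in> hardy2" "hardy2_norm (fun_scale c f) \<le> cmod c * hardy2_norm f"
proof -
  have le: "l2_norm_on (-R) R (\<lambda>t. fun_scale c f (Complex x t)) \<le> cmod c * hardy2_norm f" if "0 < x" for x R
    unfolding fun_scale_def l2_norm_on_scale using that by (intro mult_left_mono hardy2_segment assms) auto
  have hol: "fun_scale c f holomorphic_on right_half_plane"
    unfolding fun_scale_def by (intro holomorphic_intros hardy2D assms)
  show "fun_scale c f \<in> hardy2" "hardy2_norm (fun_scale c f) \<le> cmod c * hardy2_norm f"
    by (rule hardy2I[OF hol _ _ le]; simp add: hardy2D assms fun_scale_def)+
qed

lemma fun_scale_simps:
  "fun_scale c (fun_scale d f) = fun_scale (c * d) f" "fun_scale 1 f = f" "fun_scale (-1) f = - f"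
  "fun_scale 0 f = 0" "fun_scale c 0 = 0"
  by (auto simp: fun_scale_def fun_eq_iff)

lemma hardy2_norm_scale:
  assumes "f \<in> hardy2"
  shows "hardy2_norm (fun_scale c f) = cmod c * hardy2_norm f"
proof (cases "c = 0")
  case True
  then show ?thesis
    using hardy2_scale(2)[OF assms, of c] by (intro order_antisym) simp_all
next
  case False
  have "hardy2_norm (fun_scale (inverse c) (fun_scale c f)) \<le> cmod (inverse c) * hardy2_norm (fun_scale c f)"
    by (intro hardy2_scale assms)
  then have "cmod c * hardy2_norm f \<le> hardy2_norm (fun_scale c f)"
    using False by (simp add: fun_scale_simps norm_inverse inverse_eq_divide norm_divide field_simps)
  then show ?thesis
    using hardy2_scale(2)[OF assms, of c] by simp
qed

lemma hardy2_zero: "0 \<in> hardy2"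
  by (rule hardy2I(1)[of _ 0]) (auto simp: l2_norm_on_def zero_fun_def)

lemma hardy2_uminus: "f \<in> hardy2 \<Longrightarrow> - f \<in> hardy2"
  using hardy2_scale(1)[of f "-1"] by (simp add: fun_scale_simps)

lemma hardy2_diff: "f \<in> hardy2 \<Longrightarrow> g \<in> hardy2 \<Longrightarrow> f - g \<in> hardy2"
  using hardy2_add(1)[of f "- g"] hardy2_uminus[of g] by simp

lemma hardy2_eq_0:
  assumes "f \<in> hardy2" "hardy2_norm f = 0"
  shows "f = 0"
proof
  fix w
  show "f w = 0 w"
    using hardy2_pointwise_bound[OF assms(1), of w] hardy2D(3)[OF assms(1), of w] assms(2)
    by (cases "0 < Re w") auto
qed

text \<open>
  The segments exhaust a line as \<open>n\<close> grows, and the lines approach the imaginary axis as \<open>k\<close> grows.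
\<close>

definition line_energy :: "(complex \<Rightarrow> complex) \<Rightarrow> nat \<Rightarrow> nat \<Rightarrow> real" where
  "line_energy f k n = (l2_norm_on (- real n) (real n) (\<lambda>t. f (Complex (1 / Suc k) t)))\<^sup>2"

text \<open>
  By monotonicity in both directions, the supremum that defines the Hardy norm is an iterated limit of
  square means. Limits, unlike suprema, are additive, and this is what turns the norm into a Hilbert
  space norm.
\<close>

lemma line_energy_limits:
  assumes f: "f \<in> hardy2"
  obtains E where "\<And>k. line_energy f k \<longlonglongrightarrow> E k" "E \<longlonglongrightarrow> (hardy2_norm f)\<^sup>2"
proof -
  have cont: "continuous_on A (\<lambda>t. f (Complex (1 / Suc k) t))" for A k
    by (intro continuous_on_line_hardy2 f) simp
  have bound: "line_energy f k n \<le> (hardy2_norm f)\<^sup>2" for k n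
    unfolding line_energy_def by (intro power_mono hardy2_segment f) auto
  have inc: "incseq (line_energy f k)" for k
    unfolding line_energy_def
    by (intro incseq_SucI power_mono l2_norm_on_interval_mono cont) auto
  have "\<exists>L. line_energy f k \<longlonglongrightarrow> L \<and> (\<forall>n. line_energy f k n \<le> L)" for k
    by (rule incseq_convergent[OF inc[of k], of "(hardy2_norm f)\<^sup>2"]) (use bound in auto)
  then obtain E where E: "\<And>k. line_energy f k \<longlonglongrightarrow> E k" "\<And>k n. line_energy f k n \<le> E k"
    by metis
  have E_nonneg: "0 \<le> E k" for k
    using E(2)[of k 0] by (auto simp: line_energy_def intro: order_trans[OF zero_le_power2])
  have E_le: "E k \<le> (hardy2_norm f)\<^sup>2" for k
    by (rule Lim_bounded[OF E(1), of 0]) (use bound in auto)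
  have line_le: "l2_norm_on a b (\<lambda>t. f (Complex (1 / Suc k) t)) \<le> sqrt (E k)" for a b k
  proof -
    obtain n :: nat where n: "max \<bar>a\<bar> \<bar>b\<bar> \<le> real n"
      using real_arch_simple by blast
    have "l2_norm_on a b (\<lambda>t. f (Complex (1 / Suc k) t))
        \<le> l2_norm_on (- real n) (real n) (\<lambda>t. f (Complex (1 / Suc k) t))"
      using n by (intro l2_norm_on_interval_mono cont) auto
    also have "\<dots> \<le> sqrt (E k)"
      using E(2)[of k n] by (intro real_le_rsqrt) (simp add: line_energy_def)
    finally show ?thesis .
  qed
  have "incseq E"
  proof (rule incseq_SucI)
    fix k
    show "E k \<le> E (Suc k)"
    proof (rule Lim_bounded[OF E(1)], intro allI impI)
      fix n
      have "l2_norm_on (- real n) (real n) (\<lambda>t. f (Complex (1 / Suc k) t)) \<le> sqrt (E (Suc k))"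
        by (rule hardy2_line_mean_antimono[OF f _ _ line_le]) (auto simp: field_simps)
      then have "line_energy f k n \<le> (sqrt (E (Suc k)))\<^sup>2"
        unfolding line_energy_def by (intro power_mono) auto
      then show "line_energy f k n \<le> E (Suc k)"
        using E_nonneg by simp
    qed
  qed
  then obtain L where L: "E \<longlonglongrightarrow> L" "\<And>k. E k \<le> L"
    using incseq_convergent[of E "(hardy2_norm f)\<^sup>2"] E_le by auto
  have "0 \<le> L"
    using L(2)[of 0] E_nonneg[of 0] by linarith
  have "hardy2_norm f \<le> sqrt L"
  proof (subst hardy2_norm_le_iff[OF f], use \<open>0 \<le> L\<close> in simp, intro allI impI)
    fix x R :: real
    assume "0 < x"
    then obtain k where k: "1 / Suc k < x"
      using reals_Archimedean by (auto simp: inverse_eq_divide)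
    have "l2_norm_on (- R) R (\<lambda>t. f (Complex x t)) \<le> sqrt (E k)"
      by (rule hardy2_line_mean_antimono[OF f _ _ line_le]) (use k in auto)
    also have "\<dots> \<le> sqrt L"
      using L(2) by simp
    finally show "l2_norm_on (- R) R (\<lambda>t. f (Complex x t)) \<le> sqrt L" .
  qed
  then have "(hardy2_norm f)\<^sup>2 \<le> L"
    using \<open>0 \<le> L\<close> power_mono[of "hardy2_norm f" "sqrt L" 2] by simp
  moreover have "L \<le> (hardy2_norm f)\<^sup>2"
    by (rule Lim_bounded[OF L(1), of 0]) (use E_le in auto)
  ultimately have "L = (hardy2_norm f)\<^sup>2"
    by simp
  then show ?thesis
    using that E(1) L(1) by blast
qed

text \<open>
  The real part of the inner product, by polarization.
\<close>

definition hardy2_inner :: "(complex \<Rightarrow> complex) \<Rightarrow> (complex \<Rightarrow> complex) \<Rightarrow> real" where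
  "hardy2_inner f g = ((hardy2_norm (f + g))\<^sup>2 - (hardy2_norm (f - g))\<^sup>2) / 4"

definition line_inner :: "(complex \<Rightarrow> complex) \<Rightarrow> (complex \<Rightarrow> complex) \<Rightarrow> nat \<Rightarrow> nat \<Rightarrow> real" where
  "line_inner f g k n = integral {- real n..real n} (\<lambda>t. f (Complex (1 / Suc k) t) \<bullet> g (Complex (1 / Suc k) t))"

lemma line_inner_integrable:
  "f \<in> hardy2 \<Longrightarrow> g \<in> hardy2 \<Longrightarrow>
    (\<lambda>t. f (Complex (1 / Suc k) t) \<bullet> g (Complex (1 / Suc k) t)) integrable_on {- real n..real n}"
  by (intro integrable_continuous_real continuous_intros continuous_on_line_hardy2) auto

lemma line_inner_add:
  assumes "f \<in> hardy2" "g \<in> hardy2" "h \<in> hardy2"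
  shows "line_inner (f + g) h k n = line_inner f h k n + line_inner g h k n"
  unfolding line_inner_def using line_inner_integrable assms
  by (simp add: inner_add_left integral_add)

lemma line_inner_scale: "line_inner (fun_scale (of_real r) f) h k n = r * line_inner f h k n"
  unfolding line_inner_def fun_scale_def by (simp flip: scaleR_conv_of_real)

text \<open>
  Polarization holds on every segment and passes to the limit. Bilinearity of the inner product is
  inherited from the integrals on segments.
\<close>

lemma line_inner_limits:
  assumes f: "f \<in> hardy2" and g: "g \<in> hardy2"
  obtains J where "\<And>k. line_inner f g k \<longlonglongrightarrow> J k" "J \<longlonglongrightarrow> hardy2_inner f g"
proof -
  obtain E where E: "\<And>k. line_energy (f + g) k \<longlonglongrightarrow> E k" "E \<longlonglongrightarrow> (hardy2_norm (f + g))\<^sup>2"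
    using line_energy_limits[OF hardy2_add(1)[OF f g]] by metis
  obtain F where F: "\<And>k. line_energy (f - g) k \<longlonglongrightarrow> F k" "F \<longlonglongrightarrow> (hardy2_norm (f - g))\<^sup>2"
    using line_energy_limits[OF hardy2_diff[OF f g]] by metis
  have "line_inner f g k n = (line_energy (f + g) k n - line_energy (f - g) k n) / 4" for k n
  proof -
    define u v where "u t = f (Complex (1 / Suc k) t)" and "v t = g (Complex (1 / Suc k) t)" for t
    have cont: "continuous_on {- real n..real n} u" "continuous_on {- real n..real n} v"
      unfolding u_def v_def by (intro continuous_on_line_hardy2 f g; simp)+
    have "line_energy (f + g) k n - line_energy (f - g) k n
        = integral {- real n..real n} (\<lambda>t. (cmod (u t + v t))\<^sup>2) - integral {- real n..real n} (\<lambda>t. (cmod (u t - v t))\<^sup>2)"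
      unfolding line_energy_def plus_fun_apply minus_apply u_def[symmetric] v_def[symmetric]
      by (simp only: l2_norm_on_square continuous_on_add[OF cont] continuous_on_diff[OF cont])
    also have "\<dots> = integral {- real n..real n} (\<lambda>t. (cmod (u t + v t))\<^sup>2 - (cmod (u t - v t))\<^sup>2)"
      by (intro integral_diff[symmetric] integrable_continuous_real continuous_intros cont)
    also have "\<dots> = integral {- real n..real n} (\<lambda>t. 4 * (u t \<bullet> v t))"
      by (simp add: power2_norm_eq_inner inner_simps inner_commute)
    also have "\<dots> = 4 * line_inner f g k n"
      by (simp add: line_inner_def u_def v_def)
    finally show ?thesis by simp
  qed
  then have "line_inner f g k = (\<lambda>n. (line_energy (f + g) k n - line_energy (f - g) k n) / 4)" for k
    by (rule ext)
  then have "line_inner f g k \<longlonglongrightarrow> (E k - F k) / 4" for k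
    by (simp only:) (intro tendsto_intros E F, simp)
  moreover have "(\<lambda>k. (E k - F k) / 4) \<longlonglongrightarrow> hardy2_inner f g"
    unfolding hardy2_inner_def by (intro tendsto_intros E F) auto
  ultimately show ?thesis
    by (rule that)
qed

lemma hardy2_inner_add:
  assumes "f \<in> hardy2" "g \<in> hardy2" "h \<in> hardy2"
  shows "hardy2_inner (f + g) h = hardy2_inner f h + hardy2_inner g h"
proof -
  obtain A where A: "\<And>k. line_inner f h k \<longlonglongrightarrow> A k" "A \<longlonglongrightarrow> hardy2_inner f h"
    using line_inner_limits[OF assms(1,3)] by metis
  obtain B where B: "\<And>k. line_inner g h k \<longlonglongrightarrow> B k" "B \<longlonglongrightarrow> hardy2_inner g h"
    using line_inner_limits[OF assms(2,3)] by metis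
  obtain C where C: "\<And>k. line_inner (f + g) h k \<longlonglongrightarrow> C k" "C \<longlonglongrightarrow> hardy2_inner (f + g) h"
    using line_inner_limits[OF hardy2_add(1)[OF assms(1,2)] assms(3)] by metis
  have "C k = A k + B k" for k
    using LIMSEQ_unique[OF C(1)[of k]] tendsto_add[OF A(1)[of k] B(1)[of k]]
    by (simp add: line_inner_add[OF assms, abs_def])
  then have "C \<longlonglongrightarrow> hardy2_inner f h + hardy2_inner g h"
    using tendsto_add[OF A(2) B(2)] by presburger
  then show ?thesis
    using C(2) LIMSEQ_unique by blast
qed

lemma hardy2_inner_scale:
  assumes "f \<in> hardy2" "h \<in> hardy2"
  shows "hardy2_inner (fun_scale (of_real r) f) h = r * hardy2_inner f h"
proof -
  obtain A where A: "\<And>k. line_inner f h k \<longlonglongrightarrow> A k" "A \<longlonglongrightarrow> hardy2_inner f h"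
    using line_inner_limits[OF assms] by metis
  obtain C where C: "\<And>k. line_inner (fun_scale (of_real r) f) h k \<longlonglongrightarrow> C k"
      "C \<longlonglongrightarrow> hardy2_inner (fun_scale (of_real r) f) h"
    using line_inner_limits[OF hardy2_scale(1)[OF assms(1)] assms(2)] by metis
  have "C k = r * A k" for k
    using LIMSEQ_unique[OF C(1)[of k]] tendsto_mult_left[OF A(1)[of k], of r]
    by (simp add: line_inner_scale[abs_def])
  then have "C \<longlonglongrightarrow> r * hardy2_inner f h"
    using tendsto_mult_left[OF A(2), of r] by presburger
  then show ?thesis
    using C(2) LIMSEQ_unique by blast
qed

lemma hardy2_inner_self: "f \<in> hardy2 \<Longrightarrow> hardy2_inner f f = (hardy2_norm f)\<^sup>2"
  using hardy2_norm_scale[of f 2] hardy2_norm_scale[OF hardy2_zero, of 0]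
  by (simp add: hardy2_inner_def fun_scale_def power_mult_distrib zero_fun_def plus_fun_def flip: mult_2)

text \<open>
  As a type, the space takes part in the calculus of bounded linear maps, where the operator series
  below are sums of absolutely convergent series in a Banach space.
\<close>

typedef hardy = hardy2
  morphisms hardy_fun Hardy
  using hardy2_zero by blast

setup_lifting type_definition_hardy

instantiation hardy :: real_vector
begin

lift_definition zero_hardy :: hardy is 0
  by (rule hardy2_zero)

lift_definition plus_hardy :: "hardy \<Rightarrow> hardy \<Rightarrow> hardy" is "(+)"
  by (rule hardy2_add)

lift_definition uminus_hardy :: "hardy \<Rightarrow> hardy" is uminus
  by (rule hardy2_uminus)

lift_definition minus_hardy :: "hardy \<Rightarrow> hardy \<Rightarrow> hardy" is "(-)"
  by (rule hardy2_diff)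

lift_definition scaleR_hardy :: "real \<Rightarrow> hardy \<Rightarrow> hardy" is "\<lambda>r. fun_scale (of_real r)"
  by (rule hardy2_scale)

instance
  by standard (transfer; simp add: fun_scale_def fun_eq_iff algebra_simps)+

end

lift_definition scaleC :: "complex \<Rightarrow> hardy \<Rightarrow> hardy" is fun_scale
  by (rule hardy2_scale)

instantiation hardy :: real_normed_vector
begin

lift_definition norm_hardy :: "hardy \<Rightarrow> real" is hardy2_norm .

definition dist_hardy :: "hardy \<Rightarrow> hardy \<Rightarrow> real" where
  "dist_hardy f g = norm (f - g)"

definition sgn_hardy :: "hardy \<Rightarrow> hardy" where
  "sgn_hardy f = f /\<^sub>R norm f"

definition uniformity_hardy :: "(hardy \<times> hardy) filter" where
  "uniformity_hardy = (INF e\<in>{0<..}. principal {(f, g). dist f g < e})"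

definition open_hardy :: "hardy set \<Rightarrow> bool" where
  "open_hardy S \<longleftrightarrow> (\<forall>x\<in>S. \<forall>\<^sub>F (x', y) in uniformity. x' = x \<longrightarrow> y \<in> S)"

instance
proof
  fix f g :: hardy and r :: real
  show "norm f = 0 \<longleftrightarrow> f = 0"
    by transfer (metis hardy2_eq_0 hardy2_norm_scale hardy2_zero fun_scale_simps(5) mult_zero_left norm_zero)
  show "norm (f + g) \<le> norm f + norm g"
    by transfer (rule hardy2_add)
  show "norm (r *\<^sub>R f) = \<bar>r\<bar> * norm f"
    by transfer (simp add: hardy2_norm_scale)
qed (simp_all only: dist_hardy_def sgn_hardy_def uniformity_hardy_def open_hardy_def)

end

instantiation hardy :: real_inner
begin

lift_definition inner_hardy :: "hardy \<Rightarrow> hardy \<Rightarrow> real" is hardy2_inner .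

instance
proof
  fix f g h :: hardy and r :: real
  show "f \<bullet> g = g \<bullet> f"
  proof transfer
    fix f g
    assume "f \<in> hardy2" "g \<in> hardy2"
    then show "hardy2_inner f g = hardy2_inner g f"
      using hardy2_norm_scale[OF hardy2_diff, of f g "-1"] unfolding fun_scale_simps
      by (simp add: hardy2_inner_def add.commute)
  qed
  show "(f + g) \<bullet> h = f \<bullet> h + g \<bullet> h"
    by transfer (rule hardy2_inner_add)
  show "(r *\<^sub>R f) \<bullet> g = r * (f \<bullet> g)"
    by transfer (rule hardy2_inner_scale)
  have self: "f \<bullet> f = (norm f)\<^sup>2"
    by transfer (rule hardy2_inner_self)
  show "0 \<le> f \<bullet> f" "f \<bullet> f = 0 \<longleftrightarrow> f = 0" "norm f = sqrt (f \<bullet> f)"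
    by (simp_all add: self)
qed

end

lemma hardy_eqI:
  assumes "\<And>w. 0 < Re w \<Longrightarrow> hardy_fun f w = hardy_fun g w"
  shows "f = g"
proof -
  have "hardy_fun f w = hardy_fun g w" for w
    using assms[of w] hardy2D(3)[OF hardy_fun, of w f] hardy2D(3)[OF hardy_fun, of w g]
    by (cases "0 < Re w") auto
  then show ?thesis
    by (simp add: hardy_fun_inject[symmetric] fun_eq_iff)
qed

lemma hardy_fun_simps [simp]:
  "hardy_fun 0 w = 0" "hardy_fun (f + g) w = hardy_fun f w + hardy_fun g w"
  "hardy_fun (f - g) w = hardy_fun f w - hardy_fun g w" "hardy_fun (- f) w = - hardy_fun f w"
  "hardy_fun (r *\<^sub>R f) w = of_real r * hardy_fun f w" "hardy_fun (scaleC c f) w = c * hardy_fun f w"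
  by (simp_all add: zero_hardy.rep_eq plus_hardy.rep_eq minus_hardy.rep_eq uminus_hardy.rep_eq
      scaleR_hardy.rep_eq scaleC.rep_eq fun_scale_def)

lemma hardy_norm_eq: "norm f = hardy2_norm (hardy_fun f)"
  by (rule norm_hardy.rep_eq)

lemma norm_scaleC: "norm (scaleC c f) = cmod c * norm f"
  by transfer (rule hardy2_norm_scale)

lemma hardy_point_bound: "0 < Re w \<Longrightarrow> cmod (hardy_fun f w) \<le> 2 * norm f / sqrt (Re w)"
  by (simp add: hardy_norm_eq hardy2_pointwise_bound hardy_fun)

lemma bounded_linear_hardy_eval:
  assumes "0 < Re w"
  shows "bounded_linear (\<lambda>f. hardy_fun f w)"
  by (rule bounded_linear_intro[of _ "2 / sqrt (Re w)"])
     (use hardy_point_bound[OF assms] in \<open>simp_all add: scaleR_conv_of_real mult.commute\<close>)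

lemma hardy_fun_holomorphic: "hardy_fun f holomorphic_on right_half_plane"
  by (rule hardy2D(1)[OF hardy_fun])

text \<open>
  A Cauchy sequence converges uniformly on each half-plane \<open>x \<le> Re w\<close> with \<open>x > 0\<close>, by the pointwise
  bound. So the limit is analytic, and on each segment the norm of the difference from the limit is
  controlled by the Cauchy property.
\<close>

instance hardy :: banach
proof
  fix X :: "nat \<Rightarrow> hardy"
  assume "Cauchy X"
  then have Cauchy: "\<exists>M. \<forall>m\<ge>M. \<forall>n\<ge>M. norm (X m - X n) < e" if "0 < e" for e
    using that by (simp add: Cauchy_iff)
  have point: "cmod (hardy_fun (X m) w - hardy_fun (X n) w) \<le> 2 * norm (X m - X n) / sqrt (Re w)"
    if "0 < Re w" for m n w
    using hardy_point_bound[OF that, of "X m - X n"] by simp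
  have "convergent (\<lambda>n. hardy_fun (X n) w)" if "0 < Re w" for w
    using bounded_linear.Cauchy[OF bounded_linear_hardy_eval[OF that] \<open>Cauchy X\<close>]
    by (simp add: Cauchy_convergent_iff)
  then obtain f where f: "\<And>w. 0 < Re w \<Longrightarrow> (\<lambda>n. hardy_fun (X n) w) \<longlonglongrightarrow> f w"
    unfolding convergent_def by metis
  define g where "g w = (if 0 < Re w then f w else 0)" for w
  have g: "(\<lambda>n. hardy_fun (X n) w) \<longlonglongrightarrow> g w" if "0 < Re w" for w
    using f[OF that] that by (simp add: g_def)
  have unif: "\<exists>M. \<forall>n\<ge>M. \<forall>w. x \<le> Re w \<longrightarrow> cmod (hardy_fun (X n) w - g w) \<le> e"
    if "0 < e" "0 < x" for e x
  proof -
    have "0 < e * sqrt x / 2"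
      using that by simp
    then obtain M where M: "\<And>m n. m \<ge> M \<Longrightarrow> n \<ge> M \<Longrightarrow> norm (X m - X n) < e * sqrt x / 2"
      using Cauchy by blast
    have "cmod (hardy_fun (X n) w - g w) \<le> e" if n: "n \<ge> M" and w: "x \<le> Re w" for n w
    proof (rule Lim_bounded[where M = M])
      show "(\<lambda>m. cmod (hardy_fun (X n) w - hardy_fun (X m) w)) \<longlonglongrightarrow> cmod (hardy_fun (X n) w - g w)"
        using w \<open>0 < x\<close> by (intro tendsto_intros g) auto
      show "\<forall>m\<ge>M. cmod (hardy_fun (X n) w - hardy_fun (X m) w) \<le> e"
      proof (intro allI impI)
        fix m
        assume "m \<ge> M"
        have "cmod (hardy_fun (X n) w - hardy_fun (X m) w) \<le> 2 * norm (X n - X m) / sqrt (Re w)"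
          using point w \<open>0 < x\<close> by auto
        also have "\<dots> \<le> e * sqrt x / sqrt x"
          using M[OF n \<open>m \<ge> M\<close>] w \<open>0 < x\<close> \<open>0 < e\<close> by (intro frac_le) auto
        finally show "cmod (hardy_fun (X n) w - hardy_fun (X m) w) \<le> e"
          using \<open>0 < x\<close> by simp
      qed
    qed
    then show ?thesis by blast
  qed
  have hol: "g holomorphic_on right_half_plane"
  proof (rule holomorphic_uniform_sequence[OF open_half_plane])
    show "hardy_fun (X n) holomorphic_on right_half_plane" for n
      by (rule hardy_fun_holomorphic)
    fix w
    assume w: "w \<in> right_half_plane"
    have re: "Re w / 2 \<le> Re v" if "v \<in> cball w (Re w / 2)" for v
      using that abs_Re_le_cmod[of "w - v"] by (simp add: dist_norm)
    have "uniform_limit (cball w (Re w / 2)) (\<lambda>n. hardy_fun (X n)) g sequentially"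
    proof (rule uniform_limitI)
      fix e :: real
      assume "0 < e"
      then obtain M where "\<And>n v. n \<ge> M \<Longrightarrow> Re w / 2 \<le> Re v \<Longrightarrow> cmod (hardy_fun (X n) v - g v) \<le> e / 2"
        using unif[of "e / 2" "Re w / 2"] w by auto
      then show "\<forall>\<^sub>F n in sequentially. \<forall>v\<in>cball w (Re w / 2). dist (hardy_fun (X n) v) (g v) < e"
        using re \<open>0 < e\<close> by (force simp: eventually_sequentially dist_norm)
    qed
    moreover have "cball w (Re w / 2) \<subseteq> right_half_plane"
      using re w by force
    ultimately show "\<exists>d>0. cball w d \<subseteq> right_half_plane \<and> uniform_limit (cball w d) (\<lambda>n. hardy_fun (X n)) g sequentially"
      using w by (intro exI[of _ "Re w / 2"]) auto
  qed
  have approx: "hardy_fun (X n) - g \<in> hardy2" "hardy2_norm (hardy_fun (X n) - g) \<le> e"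
    if e: "0 < e" and M: "\<And>m n. m \<ge> M \<Longrightarrow> n \<ge> M \<Longrightarrow> norm (X m - X n) < e" and n: "n \<ge> M" for e M n
  proof -
    have le: "l2_norm_on (-R) R (\<lambda>t. (hardy_fun (X n) - g) (Complex x t)) \<le> e" if x: "0 < x" for x R
    proof (rule field_le_epsilon)
      fix d :: real
      assume "0 < d"
      define q where "q = d / (sqrt (2 * \<bar>R\<bar>) + 1)"
      have q: "0 < q" "q * sqrt (2 * \<bar>R\<bar>) \<le> d"
        using \<open>0 < d\<close> by (auto simp: q_def add_nonneg_pos pos_divide_le_eq intro!: divide_pos_pos)
      obtain M' where M': "\<And>m w. m \<ge> M' \<Longrightarrow> x \<le> Re w \<Longrightarrow> cmod (hardy_fun (X m) w - g w) \<le> q"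
        using unif[OF q(1) x] by auto
      define m where "m = max M M'"
      have cont: "continuous_on A (\<lambda>t. g (Complex x t))" "continuous_on A (\<lambda>t. hardy_fun (X j) (Complex x t))" for A j
        using continuous_on_line[OF holomorphic_on_imp_continuous_on[OF hol] x]
          continuous_on_line_hardy2[OF hardy_fun x] by auto
      have "l2_norm_on (-R) R (\<lambda>t. (hardy_fun (X n) - g) (Complex x t))
          = l2_norm_on (-R) R (\<lambda>t. hardy_fun (X n - X m) (Complex x t) + (hardy_fun (X m) (Complex x t) - g (Complex x t)))"
        by simp
      also have "\<dots> \<le> l2_norm_on (-R) R (\<lambda>t. hardy_fun (X n - X m) (Complex x t))
          + l2_norm_on (-R) R (\<lambda>t. hardy_fun (X m) (Complex x t) - g (Complex x t))"
        by (intro l2_norm_on_triangle continuous_on_diff cont continuous_on_line_hardy2 hardy_fun x)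
      also have "\<dots> \<le> e + d"
      proof (rule add_mono)
        show "l2_norm_on (-R) R (\<lambda>t. hardy_fun (X n - X m) (Complex x t)) \<le> e"
          using hardy2_segment[OF hardy_fun x, of "-R" R "X n - X m"] M[OF n, of m]
          by (simp add: hardy_norm_eq m_def)
        have "l2_norm_on (-R) R (\<lambda>t. hardy_fun (X m) (Complex x t) - g (Complex x t)) \<le> l2_norm_on (-R) R (\<lambda>t. of_real q)"
          using M'[of m] q(1) by (intro l2_norm_on_mono continuous_on_diff cont continuous_on_const) (auto simp: m_def)
        also have "\<dots> \<le> q * sqrt (2 * \<bar>R\<bar>)"
          using q(1) by (cases "0 \<le> R") (auto simp: l2_norm_on_def real_sqrt_mult)
        finally show "l2_norm_on (-R) R (\<lambda>t. hardy_fun (X m) (Complex x t) - g (Complex x t)) \<le> d"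
          using q(2) by simp
      qed
      finally show "l2_norm_on (-R) R (\<lambda>t. (hardy_fun (X n) - g) (Complex x t)) \<le> e + d" .
    qed
    have "hardy_fun (X n) - g holomorphic_on right_half_plane"
      unfolding fun_diff_def by (intro holomorphic_on_diff hol hardy_fun_holomorphic)
    then show "hardy_fun (X n) - g \<in> hardy2" "hardy2_norm (hardy_fun (X n) - g) \<le> e"
      by (rule hardy2I[OF _ _ _ le]; use e hardy2D(3)[OF hardy_fun] in \<open>simp add: g_def\<close>)+
  qed
  have "g \<in> hardy2"
  proof -
    obtain M where "\<And>m n. m \<ge> M \<Longrightarrow> n \<ge> M \<Longrightarrow> norm (X m - X n) < 1"
      using Cauchy[of 1] by auto
    then have "hardy_fun (X M) - (hardy_fun (X M) - g) \<in> hardy2"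
      by (intro hardy2_diff hardy_fun approx[of 1 M]) auto
    then show ?thesis by simp
  qed
  have "X \<longlonglongrightarrow> Hardy g"
  proof (rule LIMSEQ_I)
    fix e :: real
    assume "0 < e"
    obtain M where M: "\<And>m n. m \<ge> M \<Longrightarrow> n \<ge> M \<Longrightarrow> norm (X m - X n) < e / 2"
      using Cauchy[of "e / 2"] \<open>0 < e\<close> by auto
    have "norm (X n - Hardy g) < e" if "n \<ge> M" for n
    proof -
      have "hardy_fun (X n - Hardy g) = hardy_fun (X n) - g"
        using \<open>g \<in> hardy2\<close> by (simp add: fun_eq_iff Hardy_inverse)
      then show ?thesis
        using approx(2)[OF _ M that] \<open>0 < e\<close> by (simp add: hardy_norm_eq)
    qed
    then show "\<exists>M. \<forall>n\<ge>M. norm (X n - Hardy g) < e" by blast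
  qed
  then show "convergent X"
    by (rule convergentI)
qed

section \<open>Complex structure and affine composition operators\<close>

lemma scaleC_simps:
  "scaleC c (f + g) = scaleC c f + scaleC c g" "scaleC (c * d) f = scaleC c (scaleC d f)"
  "scaleC (c + d) f = scaleC c f + scaleC d f" "scaleC (of_real r) f = r *\<^sub>R f"
  "scaleC c (r *\<^sub>R f) = r *\<^sub>R scaleC c f"
  by (auto intro!: hardy_eqI simp: algebra_simps)

lift_definition hardy_i :: "hardy \<Rightarrow>\<^sub>L hardy" is "scaleC \<i>"
  by (rule bounded_linear_intro[of _ 1]) (simp_all add: scaleC_simps norm_scaleC)

lemma scaleC_eq: "scaleC c f = Re c *\<^sub>R f + Im c *\<^sub>R hardy_i f"
  by (rule hardy_eqI) (simp add: hardy_i.rep_eq complex_eq_iff)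

interpretation hardy: complex_structure hardy_i
proof
  fix f g :: hardy
  show ii: "hardy_i (hardy_i f) = - f" for f
    by (rule hardy_eqI) (simp add: hardy_i.rep_eq flip: mult.assoc)
  have iso: "norm (hardy_i f) = norm f" for f
    by (simp add: hardy_i.rep_eq norm_scaleC)
  have "hardy_i f \<bullet> hardy_i g = ((norm (hardy_i (f + g)))\<^sup>2 - (norm (hardy_i (f - g)))\<^sup>2) / 4"
    by (simp add: power2_norm_eq_inner blinfun.add_right blinfun.diff_right inner_simps inner_commute)
  also have "\<dots> = f \<bullet> g"
    unfolding iso by (simp add: power2_norm_eq_inner inner_simps inner_commute)
  finally show "hardy_i f \<bullet> hardy_i g = f \<bullet> g" .
qed

lemma hardy2_affine:
  assumes f: "f \<in> hardy2" and \<sigma>: "\<sigma> > 0" and \<tau>: "0 \<le> Re \<tau>"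
  shows "composition_operator (\<lambda>w. of_real \<sigma> * w + \<tau>) f \<in> hardy2"
    "hardy2_norm (composition_operator (\<lambda>w. of_real \<sigma> * w + \<tau>) f) \<le> hardy2_norm f / sqrt \<sigma>"
proof -
  let ?g = "composition_operator (\<lambda>w. of_real \<sigma> * w + \<tau>) f"
  have le: "l2_norm_on (-R) R (\<lambda>t. ?g (Complex x t)) \<le> hardy2_norm f / sqrt \<sigma>" if x: "0 < x" for x R
  proof -
    have "of_real \<sigma> * Complex x t + \<tau> = Complex (\<sigma> * x + Re \<tau>) (\<sigma> * t + Im \<tau>)" for t
      by (simp add: complex_eq_iff)
    then have "?g (Complex x t) = f (Complex (\<sigma> * x + Re \<tau>) (\<sigma> * t + Im \<tau>))" for t
      using x by (simp add: composition_operator_def)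
    moreover have "\<sigma> * x + Re \<tau> > 0"
      using \<sigma> \<tau> x by (simp add: add_pos_nonneg)
    ultimately show ?thesis
      using hardy2_segment_affine[OF f _ \<sigma>] by simp
  qed
  have "?g holomorphic_on right_half_plane"
    unfolding composition_operator_def mem_half_plane
  proof (intro holomorphic_zero_extension holomorphic_on_compose_gen[OF _ hardy2D(1)[OF f], unfolded o_def] holomorphic_intros)
    show "(\<lambda>w. of_real \<sigma> * w + \<tau>) ` right_half_plane \<subseteq> right_half_plane"
      using \<sigma> \<tau> by (auto simp: add_pos_nonneg)
  qed
  then show "?g \<in> hardy2" "hardy2_norm ?g \<le> hardy2_norm f / sqrt \<sigma>"
    by (rule hardy2I[OF _ _ _ le]; use \<sigma> in \<open>simp add: composition_operator_def\<close>)+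
qed

definition affine_op :: "real \<Rightarrow> complex \<Rightarrow> hardy \<Rightarrow>\<^sub>L hardy" where
  "affine_op \<sigma> \<tau> = Blinfun (\<lambda>f. Hardy (composition_operator (\<lambda>w. of_real \<sigma> * w + \<tau>) (hardy_fun f)))"

context
  fixes \<sigma> :: real and \<tau> :: complex
  assumes \<sigma>: "\<sigma> > 0" and \<tau>: "0 \<le> Re \<tau>"
begin

lemma hardy_fun_Hardy_affine:
  "hardy_fun (Hardy (composition_operator (\<lambda>w. of_real \<sigma> * w + \<tau>) (hardy_fun f)))
    = composition_operator (\<lambda>w. of_real \<sigma> * w + \<tau>) (hardy_fun f)"
  by (intro Hardy_inverse hardy2_affine hardy_fun \<sigma> \<tau>)

lemma affine_op_raw:
  "blinfun_apply (affine_op \<sigma> \<tau>) = (\<lambda>f. Hardy (composition_operator (\<lambda>w. of_real \<sigma> * w + \<tau>) (hardy_fun f)))"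
  unfolding affine_op_def
proof (rule bounded_linear_Blinfun_apply, rule bounded_linear_intro[of _ "1 / sqrt \<sigma>"])
  fix f
  show "norm (Hardy (composition_operator (\<lambda>w. of_real \<sigma> * w + \<tau>) (hardy_fun f))) \<le> norm f * (1 / sqrt \<sigma>)"
    using hardy2_affine(2)[OF hardy_fun \<sigma> \<tau>, of f] by (simp add: hardy_norm_eq hardy_fun_Hardy_affine)
qed (rule hardy_eqI, simp only: hardy_fun_simps hardy_fun_Hardy_affine, simp add: composition_operator_def)+

lemma hardy_fun_affine_op':
  "hardy_fun (affine_op \<sigma> \<tau> f) = composition_operator (\<lambda>w. of_real \<sigma> * w + \<tau>) (hardy_fun f)"
  by (simp add: affine_op_raw hardy_fun_Hardy_affine)

lemma hardy_fun_affine_op: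
  "0 < Re w \<Longrightarrow> hardy_fun (affine_op \<sigma> \<tau> f) w = hardy_fun f (of_real \<sigma> * w + \<tau>)"
  by (simp add: hardy_fun_affine_op' composition_operator_def)

lemma norm_affine_op_le: "norm (affine_op \<sigma> \<tau> f) \<le> norm f / sqrt \<sigma>"
  using hardy2_affine(2)[OF hardy_fun \<sigma> \<tau>] by (simp add: hardy_norm_eq hardy_fun_affine_op')

lemma affine_op_scaleC: "affine_op \<sigma> \<tau> (scaleC c f) = scaleC c (affine_op \<sigma> \<tau> f)"
  by (rule hardy_eqI) (simp add: hardy_fun_affine_op)

end

lemma half_plane_affine: "\<sigma> > 0 \<Longrightarrow> 0 \<le> Re \<tau> \<Longrightarrow> 0 < Re w \<Longrightarrow> 0 < Re (of_real \<sigma> * w + \<tau>)"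
  by (simp add: add_pos_nonneg)

lemma affine_op_affine_op:
  assumes "\<sigma> > 0" "0 \<le> Re \<tau>" "\<sigma>' > 0" "0 \<le> Re \<tau>'"
  shows "affine_op \<sigma> \<tau> (affine_op \<sigma>' \<tau>' f) = affine_op (\<sigma>' * \<sigma>) (of_real \<sigma>' * \<tau> + \<tau>') f"
  using assms half_plane_affine[of \<sigma> \<tau>]
  by (intro hardy_eqI) (simp add: hardy_fun_affine_op add_pos_nonneg algebra_simps)

lemma affine_op_id [simp]: "affine_op 1 0 f = f"
  by (rule hardy_eqI) (simp add: hardy_fun_affine_op)

text \<open>
  When \<open>\<tau>\<close> is imaginary, the inverse affine map preserves the half-plane too, so the norm bound
  applies in both directions.
\<close>

lemma norm_affine_op_eq:
  assumes "\<sigma> > 0" "Re \<tau> = 0"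
  shows "norm (affine_op \<sigma> \<tau> f) = norm f / sqrt \<sigma>"
proof (rule antisym)
  have "affine_op (1 / \<sigma>) (- \<tau> / of_real \<sigma>) (affine_op \<sigma> \<tau> f) = f"
    using assms by (simp add: affine_op_affine_op)
  then have "norm f \<le> norm (affine_op \<sigma> \<tau> f) / sqrt (1 / \<sigma>)"
    using norm_affine_op_le[of "1 / \<sigma>" "- \<tau> / of_real \<sigma>" "affine_op \<sigma> \<tau> f"] assms by simp
  then show "norm f / sqrt \<sigma> \<le> norm (affine_op \<sigma> \<tau> f)"
    using assms(1) by (simp add: real_sqrt_divide field_simps)
qed (use assms norm_affine_op_le in auto)

lemma hardy2_mult_bounded:
  assumes f: "f \<in> hardy2" and m: "m holomorphic_on right_half_plane" "\<And>w. 0 < Re w \<Longrightarrow> cmod (m w) \<le> B"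
  shows "(\<lambda>w. m w * f w) \<in> hardy2"
proof -
  have "0 \<le> B"
    using order_trans[OF norm_ge_zero m(2)[of 1]] by simp
  show ?thesis
  proof (rule hardy2I(1))
    show "(\<lambda>w. m w * f w) holomorphic_on right_half_plane"
      by (intro holomorphic_intros m hardy2D f)
    show "0 \<le> B * hardy2_norm f"
      using \<open>0 \<le> B\<close> by simp
    fix x R :: real
    assume x: "0 < x"
    have "l2_norm_on (-R) R (\<lambda>t. m (Complex x t) * f (Complex x t))
        \<le> l2_norm_on (-R) R (\<lambda>t. of_real B * f (Complex x t))"
      using m(2) x \<open>0 \<le> B\<close>
      by (intro l2_norm_on_mono continuous_intros continuous_on_line_hardy2 continuous_on_line
          holomorphic_on_imp_continuous_on m f) (auto simp: norm_mult intro!: mult_right_mono)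
    also have "\<dots> \<le> B * hardy2_norm f"
      unfolding l2_norm_on_scale using \<open>0 \<le> B\<close> x by (simp add: mult_left_mono hardy2_segment f)
    finally show "l2_norm_on (-R) R (\<lambda>t. m (Complex x t) * f (Complex x t)) \<le> B * hardy2_norm f" .
  qed (simp add: hardy2D(3)[OF f])
qed

section \<open>Universality from a right inverse\<close>

text \<open>
  For real linear maps, commuting with the imaginary unit is complex linearity.
\<close>

definition c_linear :: "(hardy \<Rightarrow>\<^sub>L hardy) \<Rightarrow> bool" where
  "c_linear A \<longleftrightarrow> A o\<^sub>L hardy_i = hardy_i o\<^sub>L A"

lemma c_linear_iff: "c_linear A \<longleftrightarrow> (\<forall>f. A (hardy_i f) = hardy_i (A f))"
  unfolding c_linear_def by (metis blinfun_apply_blinfun_compose blinfun_eqI)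

lemma c_linear_scaleC: "c_linear A \<Longrightarrow> A (scaleC c f) = scaleC c (A f)"
  by (simp add: scaleC_eq c_linear_iff blinfun.add_right blinfun.scaleR_right)

lemma bounded_operator_of_blinfun:
  assumes "c_linear A" "V \<subseteq> hardy2" "\<And>f. f \<in> V \<Longrightarrow> hardy_fun (A (Hardy f)) \<in> W"
  shows "bounded_operator hardy2_norm V W (\<lambda>f. hardy_fun (A (Hardy f)))"
proof -
  have "Hardy (f + g) = Hardy f + Hardy g" if "f \<in> V" "g \<in> V" for f g
    using that assms(2) by (intro hardy_fun_inject[THEN iffD1])
      (simp add: plus_hardy.rep_eq Hardy_inverse subset_eq hardy2_add)
  moreover have "Hardy (fun_scale c f) = scaleC c (Hardy f)" if "f \<in> V" for f c
    using that assms(2) by (intro hardy_fun_inject[THEN iffD1])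
      (simp add: scaleC.rep_eq Hardy_inverse subset_eq hardy2_scale)
  moreover have "\<forall>f\<in>V. hardy2_norm (hardy_fun (A (Hardy f))) \<le> norm A * hardy2_norm f"
  proof
    fix f
    assume "f \<in> V"
    then show "hardy2_norm (hardy_fun (A (Hardy f))) \<le> norm A * hardy2_norm f"
      using norm_blinfun[of A "Hardy f"] assms(2) by (simp add: hardy_norm_eq Hardy_inverse subset_eq)
  qed
  then have "\<exists>K. \<forall>f\<in>V. hardy2_norm (hardy_fun (A (Hardy f))) \<le> K * hardy2_norm f" ..
  ultimately show ?thesis
    unfolding bounded_operator_def using assms(1,3)
    by (auto simp: blinfun.add_right c_linear_scaleC plus_hardy.rep_eq scaleC.rep_eq)
qed

lemma blinfun_of_bounded_operator:
  assumes "bounded_operator hardy2_norm hardy2 hardy2 T"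
  obtains A where "c_linear A" "\<And>f. hardy_fun (A f) = T (hardy_fun f)"
proof -
  obtain K where T: "\<And>f. f \<in> hardy2 \<Longrightarrow> T f \<in> hardy2"
      "\<And>f g. f \<in> hardy2 \<Longrightarrow> g \<in> hardy2 \<Longrightarrow> T (f + g) = T f + T g"
      "\<And>c f. f \<in> hardy2 \<Longrightarrow> T (fun_scale c f) = fun_scale c (T f)"
      "\<And>f. f \<in> hardy2 \<Longrightarrow> hardy2_norm (T f) \<le> K * hardy2_norm f"
    using assms unfolding bounded_operator_def by blast
  define A where "A f = Hardy (T (hardy_fun f))" for f
  have A: "hardy_fun (A f) = T (hardy_fun f)" for f
    unfolding A_def by (intro Hardy_inverse T hardy_fun)
  have "bounded_linear A"
  proof (rule bounded_linear_intro[of _ K])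
    show "A (f + g) = A f + A g" for f g
      by (intro hardy_fun_inject[THEN iffD1]) (simp add: A plus_hardy.rep_eq T hardy_fun)
    show "A (r *\<^sub>R f) = r *\<^sub>R A f" for r f
      by (intro hardy_fun_inject[THEN iffD1]) (simp add: A scaleR_hardy.rep_eq T hardy_fun)
    show "norm (A f) \<le> norm f * K" for f
      using T(4)[OF hardy_fun, of f] by (simp add: hardy_norm_eq A mult.commute)
  qed
  then have "blinfun_apply (Blinfun A) = A"
    by (rule bounded_linear_Blinfun_apply)
  moreover have "A (hardy_i f) = hardy_i (A f)" for f
    by (intro hardy_fun_inject[THEN iffD1]) (simp add: A hardy_i.rep_eq scaleC.rep_eq T hardy_fun)
  ultimately show ?thesis
    using that[of "Blinfun A"] A by (simp add: c_linear_iff)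
qed

text \<open>
  The intertwiner \<open>J\<close> of \<open>caradus_intertwining\<close> has the left inverse \<open>L\<close>. So its range \<open>M\<close> is closed,
  and \<open>L\<close> restricted to \<open>M\<close> is the required similarity.
\<close>

theorem universal_of_right_inverse:
  assumes UV: "U o\<^sub>L V = id_blinfun" and UW: "U o\<^sub>L W = 0" and LW: "L o\<^sub>L W = id_blinfun"
    and lin: "c_linear U" "c_linear V" "c_linear W" "c_linear L"
    and Op: "\<And>f. f \<in> hardy2 \<Longrightarrow> Op f = hardy_fun (U (Hardy f))"
  shows "universal_operator hardy2_norm hardy2 Op"
  unfolding universal_operator_def
proof (intro conjI allI impI)
  have "bounded_operator hardy2_norm hardy2 hardy2 (\<lambda>f. hardy_fun (U (Hardy f)))"
    by (intro bounded_operator_of_blinfun lin hardy_fun) simp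
  then show "bounded_operator hardy2_norm hardy2 hardy2 Op"
    by (simp add: bounded_operator_def Op hardy2_add hardy2_scale)
next
  fix T
  assume "bounded_operator hardy2_norm hardy2 hardy2 T"
  then obtain A where A: "c_linear A" "\<And>f. hardy_fun (A f) = T (hardy_fun f)"
    using blinfun_of_bounded_operator by blast
  obtain \<alpha> :: real and J where J: "\<alpha> \<noteq> 0" "U o\<^sub>L J = \<alpha> *\<^sub>R (J o\<^sub>L A)" "L o\<^sub>L J = id_blinfun" "c_linear J"
    using caradus_intertwining[OF UV UW LW, of hardy_i A] lin A(1) unfolding c_linear_def by metis
  have UJ: "U (J f) = \<alpha> *\<^sub>R J (A f)" and LJ: "L (J f) = f" for f
    using arg_cong[OF J(2), of "\<lambda>B. blinfun_apply B f"] arg_cong[OF J(3), of "\<lambda>B. blinfun_apply B f"]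
    by (simp_all add: blinfun.scaleR_left)
  define M where "M = range (\<lambda>f. hardy_fun (J f))"
  have MI: "hardy_fun (J f) \<in> M" for f
    by (simp add: M_def)
  have M_hardy2: "M \<subseteq> hardy2"
    using hardy_fun by (auto simp: M_def)
  have M_closed: "f \<in> M" if s: "\<And>n. s n \<in> M" and f: "f \<in> hardy2" and lim: "(\<lambda>n. hardy2_norm (s n - f)) \<longlonglongrightarrow> 0" for s f
  proof -
    obtain x where x: "\<And>n. s n = hardy_fun (J (x n))"
      using s unfolding M_def image_iff by metis
    have "hardy_fun (J (x n) - Hardy f) = s n - f" for n
      by (simp add: x minus_hardy.rep_eq Hardy_inverse f)
    then have "(\<lambda>n. norm (J (x n) - Hardy f)) \<longlonglongrightarrow> 0"
      using lim by (simp add: hardy_norm_eq)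
    then have conv: "(\<lambda>n. J (x n)) \<longlonglongrightarrow> Hardy f"
      by (rule LIM_zero_cancel[OF tendsto_norm_zero_cancel])
    then have "(\<lambda>n. L (J (x n))) \<longlonglongrightarrow> L (Hardy f)"
      by (intro blinfun.tendsto tendsto_const)
    then have "(\<lambda>n. J (x n)) \<longlonglongrightarrow> J (L (Hardy f))"
      unfolding LJ by (intro blinfun.tendsto tendsto_const)
    then have "Hardy f = J (L (Hardy f))"
      by (rule LIMSEQ_unique[OF conv])
    then show ?thesis
      using MI f by (metis Hardy_inverse)
  qed
  have "cfun.subspace M"
    unfolding cfun.subspace_def
  proof (intro conjI ballI allI)
    show "0 \<in> M"
      using MI[of 0] by (simp add: zero_hardy.rep_eq)
    fix f g c
    assume "f \<in> M"
    then obtain x where x: "f = hardy_fun (J x)"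
      by (auto simp: M_def)
    then show "fun_scale c f \<in> M"
      using MI[of "scaleC c x"] by (simp add: c_linear_scaleC J scaleC.rep_eq)
    assume "g \<in> M"
    then obtain y where "g = hardy_fun (J y)"
      by (auto simp: M_def)
    then show "f + g \<in> M"
      using x MI[of "x + y"] by (simp add: blinfun.add_right plus_hardy.rep_eq)
  qed
  then have closed: "closed_subspace hardy2_norm hardy2 M"
    unfolding closed_subspace_def using M_hardy2 M_closed by blast
  have invariant: "Op ` M \<subseteq> M"
  proof
    fix g
    assume "g \<in> Op ` M"
    then obtain x where "g = hardy_fun (U (J x))"
      by (auto simp: M_def Op hardy_fun hardy_fun_inverse)
    then show "g \<in> M"
      using MI[of "\<alpha> *\<^sub>R A x"] by (simp add: UJ blinfun.scaleR_right)
  qed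
  have "similar_operators hardy2_norm M Op hardy2 (\<lambda>f. fun_scale (of_real \<alpha>) (T f))"
    unfolding similar_operators_def
  proof (intro exI conjI)
    show "bounded_operator hardy2_norm M hardy2 (\<lambda>f. hardy_fun (L (Hardy f)))"
      by (intro bounded_operator_of_blinfun lin M_hardy2 hardy_fun)
    show "bounded_operator hardy2_norm hardy2 M (\<lambda>f. hardy_fun (J (Hardy f)))"
      by (intro bounded_operator_of_blinfun J MI) simp
    show "\<forall>f\<in>M. hardy_fun (J (Hardy (hardy_fun (L (Hardy f))))) = f"
      by (auto simp: M_def hardy_fun_inverse LJ)
    show "\<forall>g\<in>hardy2. hardy_fun (L (Hardy (hardy_fun (J (Hardy g))))) = g"
      by (auto simp: hardy_fun_inverse LJ Hardy_inverse)
    show "\<forall>f\<in>M. hardy_fun (L (Hardy (Op f))) = fun_scale (of_real \<alpha>) (T (hardy_fun (L (Hardy f))))"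
    proof
      fix g
      assume "g \<in> M"
      then obtain x where g: "g = hardy_fun (J x)"
        by (auto simp: M_def)
      have "hardy_fun (L (Hardy (Op g))) = hardy_fun (\<alpha> *\<^sub>R A x)"
        by (simp add: g Op hardy_fun hardy_fun_inverse UJ blinfun.scaleR_right LJ)
      also have "\<dots> = fun_scale (of_real \<alpha>) (T (hardy_fun (L (Hardy g))))"
        by (simp add: scaleR_hardy.rep_eq A(2) g hardy_fun_inverse LJ)
      finally show "hardy_fun (L (Hardy (Op g))) = fun_scale (of_real \<alpha>) (T (hardy_fun (L (Hardy g))))" .
    qed
  qed
  then show "\<exists>\<alpha> M. \<alpha> \<noteq> 0 \<and> closed_subspace hardy2_norm hardy2 M \<and> Op ` M \<subseteq> M \<and>
      similar_operators hardy2_norm M Op hardy2 (\<lambda>f. fun_scale \<alpha> (T f))"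
    using closed invariant J(1) by (intro exI[of _ "of_real \<alpha>"] exI[of _ M]) auto
qed

section \<open>Test functions and copies of the Hardy space\<close>

lemma arctan_kernel_integral_le:
  fixes \<gamma> \<beta> :: real
  assumes "\<gamma> > 0"
  shows "(\<lambda>t. 1 / (\<gamma>\<^sup>2 + (t + \<beta>)\<^sup>2)) integrable_on {a..b}"
    "integral {a..b} (\<lambda>t. 1 / (\<gamma>\<^sup>2 + (t + \<beta>)\<^sup>2)) \<le> pi / \<gamma>"
proof -
  have pos: "\<gamma>\<^sup>2 + (t + \<beta>)\<^sup>2 \<noteq> 0" for t
    using assms by (simp add: sum_power2_eq_zero_iff)
  show "(\<lambda>t. 1 / (\<gamma>\<^sup>2 + (t + \<beta>)\<^sup>2)) integrable_on {a..b}"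
    using pos by (intro integrable_continuous_real continuous_intros) auto
  show "integral {a..b} (\<lambda>t. 1 / (\<gamma>\<^sup>2 + (t + \<beta>)\<^sup>2)) \<le> pi / \<gamma>"
  proof (cases "a \<le> b")
    case True
    have "((\<lambda>t. 1 / (\<gamma>\<^sup>2 + (t + \<beta>)\<^sup>2)) has_integral arctan ((b + \<beta>) / \<gamma>) / \<gamma> - arctan ((a + \<beta>) / \<gamma>) / \<gamma>) {a..b}"
    proof (rule fundamental_theorem_of_calculus[OF True])
      fix t
      have "((\<lambda>t. arctan ((t + \<beta>) / \<gamma>) / \<gamma>) has_real_derivative inverse (1 + ((t + \<beta>) / \<gamma>)\<^sup>2) * (1 / \<gamma>) / \<gamma>) (at t within {a..b})"
        using assms by (auto intro!: derivative_eq_intros)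
      moreover have "inverse (1 + ((t + \<beta>) / \<gamma>)\<^sup>2) * (1 / \<gamma>) / \<gamma> = 1 / (\<gamma>\<^sup>2 + (t + \<beta>)\<^sup>2)"
      proof -
        have "1 + ((t + \<beta>) / \<gamma>)\<^sup>2 = (\<gamma>\<^sup>2 + (t + \<beta>)\<^sup>2) / \<gamma>\<^sup>2"
          unfolding power_divide using assms by (simp add: field_simps)
        then show ?thesis
          using assms by (simp add: power2_eq_square)
      qed
      ultimately show "((\<lambda>t. arctan ((t + \<beta>) / \<gamma>) / \<gamma>) has_vector_derivative 1 / (\<gamma>\<^sup>2 + (t + \<beta>)\<^sup>2)) (at t within {a..b})"
        by (simp add: has_real_derivative_iff_has_vector_derivative)
    qed
    then have "integral {a..b} (\<lambda>t. 1 / (\<gamma>\<^sup>2 + (t + \<beta>)\<^sup>2)) = (arctan ((b + \<beta>) / \<gamma>) - arctan ((a + \<beta>) / \<gamma>)) / \<gamma>"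
      by (simp add: integral_unique diff_divide_distrib)
    also have "\<dots> \<le> pi / \<gamma>"
      using arctan_bounded[of "(b + \<beta>) / \<gamma>"] arctan_bounded[of "(a + \<beta>) / \<gamma>"] assms
      by (intro divide_right_mono) linarith+
    finally show ?thesis .
  qed (use assms in simp)
qed

text \<open>
  On every vertical line to the right of the imaginary axis the square of the modulus is dominated by
  the Poisson-type kernel of the preceding lemma.
\<close>

lemma cauchy_kernel_hardy2:
  assumes c: "0 < Re c"
  shows "(\<lambda>w. if 0 < Re w then 1 / (w + c) else 0) \<in> hardy2"
proof (rule hardy2I(1))
  have nz: "w + c \<noteq> 0" if "0 < Re w" for w
    using that c by (metis add_pos_pos less_irrefl plus_complex.sel(1) zero_complex.sel(1))
  show "(\<lambda>w. if 0 < Re w then 1 / (w + c) else 0) holomorphic_on right_half_plane"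
    using nz by (intro holomorphic_zero_extension holomorphic_intros) auto
  show "0 \<le> sqrt (pi / Re c)"
    using c by simp
  fix x R :: real
  assume x: "0 < x"
  have "integral {-R..R} (\<lambda>t. (cmod (1 / (Complex x t + c)))\<^sup>2) \<le> integral {-R..R} (\<lambda>t. 1 / ((Re c)\<^sup>2 + (t + Im c)\<^sup>2))"
  proof (rule integral_le[OF _ arctan_kernel_integral_le(1)[OF c]])
    have "continuous_on {-R..R} (\<lambda>t. 1 / (Complex x t + c))"
      using nz x by (intro continuous_intros) (auto simp: Complex_eq intro!: continuous_intros)
    then show "(\<lambda>t. (cmod (1 / (Complex x t + c)))\<^sup>2) integrable_on {-R..R}"
      by (intro integrable_continuous_real continuous_on_power continuous_on_norm)
    fix t
    have "(cmod (1 / (Complex x t + c)))\<^sup>2 = 1 / ((x + Re c)\<^sup>2 + (t + Im c)\<^sup>2)"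
      by (simp add: norm_divide power_divide cmod_power2)
    also have "\<dots> \<le> 1 / ((Re c)\<^sup>2 + (t + Im c)\<^sup>2)"
      using x c by (intro divide_left_mono add_right_mono power_mono) (auto intro!: mult_pos_pos add_pos_nonneg)
    finally show "(cmod (1 / (Complex x t + c)))\<^sup>2 \<le> 1 / ((Re c)\<^sup>2 + (t + Im c)\<^sup>2)" .
  qed
  also have "\<dots> \<le> pi / Re c"
    by (rule arctan_kernel_integral_le(2)[OF c])
  finally show "l2_norm_on (- R) R (\<lambda>t. if 0 < Re (Complex x t) then 1 / (Complex x t + c) else 0) \<le> sqrt (pi / Re c)"
    using x by (simp add: l2_norm_on_def)
qed auto

text \<open>
  Products of this kind vanish wherever \<open>q\<close> takes one of the values \<open>z j\<close>; they stay in the Hardy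
  space because each factor is bounded.
\<close>

lemma product_test_function:
  assumes q: "q holomorphic_on right_half_plane" "\<And>w. 0 < Re w \<Longrightarrow> cmod (q w) \<le> B" and c: "0 < Re c"
  shows "\<exists>f. \<forall>w. 0 < Re w \<longrightarrow> hardy_fun f w = (\<Prod>j<n::nat. q w - z j) / (w + c)"
proof (induction n)
  case 0
  then show ?case
    using Hardy_inverse[OF cauchy_kernel_hardy2[OF c]] by (intro exI[of _ "Hardy (\<lambda>w. if 0 < Re w then 1 / (w + c) else 0)"]) simp
next
  case (Suc n)
  then obtain f where f: "\<And>w. 0 < Re w \<Longrightarrow> hardy_fun f w = (\<Prod>j<n. q w - z j) / (w + c)"
    by blast
  have "(\<lambda>w. (q w - z n) * hardy_fun f w) \<in> hardy2"
  proof (rule hardy2_mult_bounded[OF hardy_fun])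
    show "(\<lambda>w. q w - z n) holomorphic_on right_half_plane"
      by (intro holomorphic_intros q)
    show "cmod (q w - z n) \<le> B + cmod (z n)" if "0 < Re w" for w
      using norm_triangle_ineq4[of "q w" "z n"] q(2)[OF that] by linarith
  qed
  then show ?case
    by (intro exI[of _ "Hardy (\<lambda>w. (q w - z n) * hardy_fun f w)"]) (simp add: Hardy_inverse f)
qed

text \<open>
  The points at which functions are evaluated. They accumulate at 1, so evaluation at all of them
  separates points. Their real parts agree, so that two of them, shifted by a constant to the right,
  are real multiples of each other only if equal; this is what distinguishes them under functions that
  are invariant under a dilation.
\<close>

definition node :: "nat \<Rightarrow> complex" where
  "node n = Complex 1 (1 / Suc n)"

lemma Re_node [simp]: "Re (node n) = 1"
  by (simp add: node_def)

lemma node_eq_iff [simp]: "node m = node n \<longleftrightarrow> m = n"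
  by (simp add: node_def)

lemma hardy_eq_0_if_accumulating_zeros:
  assumes p: "p \<longlonglongrightarrow> z" "\<And>n. p n \<noteq> z" "\<And>n. 0 < Re (p n)" and z: "0 < Re z"
    and zeros: "\<And>n::nat. hardy_fun f (p n) = 0"
  shows "f = 0"
proof (rule hardy_eqI)
  fix w :: complex
  assume w: "0 < Re w"
  have "z islimpt range p"
    unfolding islimpt_sequential using p(1,2) by (intro exI[of _ p]) auto
  then have "hardy_fun f w = 0"
    by (rule analytic_continuation[OF hardy_fun_holomorphic open_half_plane convex_connected[OF convex_half_plane],
          rotated 2]) (use w zeros p(3) z in auto)
  then show "hardy_fun f w = hardy_fun 0 w" by simp
qed

lemma hardy_eq_0_if_nodes:
  assumes "\<And>n. hardy_fun f (node n) = 0"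
  shows "f = 0"
proof (rule hardy_eq_0_if_accumulating_zeros[of node "Complex 1 0"])
  show "node \<longlonglongrightarrow> Complex 1 0"
    unfolding node_def Complex_eq
    using LIMSEQ_inverse_real_of_nat by (intro tendsto_intros) (auto simp: inverse_eq_divide)
  show "node n \<noteq> Complex 1 0" for n
    by (simp add: node_def)
qed (use assms in auto)

text \<open>
  Among the nodes, the products in the hypothesis on \<open>K\<close> vanish at exactly the first \<open>n\<close> nodes, as the
  triangular construction demands.
\<close>

lemma hardy_node_basis:
  assumes q: "q holomorphic_on right_half_plane" "\<And>w. 0 < Re w \<Longrightarrow> cmod (q w) \<le> B"
    and inj: "\<And>m n. q (node m) = q (node n) \<Longrightarrow> m = n" and c: "0 < Re c"
    and K: "closed K" "subspace K" "\<And>f. f \<in> K \<Longrightarrow> hardy_i f \<in> K"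
    and mem: "\<And>f n. (\<And>w. 0 < Re w \<Longrightarrow> hardy_fun f w = (\<Prod>j<n. q w - q (node j)) / (w + c)) \<Longrightarrow> f \<in> K"
  obtains u where "hardy.adapted_basis K u"
proof -
  have eval: "bounded_linear (\<lambda>f. hardy_fun f (node n))" for n
    by (rule bounded_linear_hardy_eval) simp
  have eval_i: "hardy_fun (hardy_i f) (node n) = \<i> * hardy_fun f (node n)" for n f
    by (simp add: hardy_i.rep_eq)
  have "\<exists>f\<in>K. (\<forall>j<n. hardy_fun f (node j) = 0) \<and> hardy_fun f (node n) \<noteq> 0" for n
  proof -
    obtain f where f: "\<And>w. 0 < Re w \<Longrightarrow> hardy_fun f w = (\<Prod>j<n. q w - q (node j)) / (w + c)"
      using product_test_function[OF q c, where n = n and z = "\<lambda>j. q (node j)"] by metis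
    have "node n + c \<noteq> 0"
      using c by (auto simp: complex_eq_iff)
    then have "hardy_fun f (node n) \<noteq> 0"
      using inj by (auto simp: f)
    moreover have "hardy_fun f (node j) = 0" if "j < n" for j
      using that by (auto simp: f)
    ultimately show ?thesis
      using mem[OF f] by blast
  qed
  then show ?thesis
    using hardy.triangular_orthonormal_basis[of "\<lambda>n f. hardy_fun f (node n)" K,
        OF eval eval_i hardy_eq_0_if_nodes K] that by blast
qed

text \<open>
  Match an adapted basis of \<open>K\<close> with one of the whole space; for the latter the function \<open>1 / (w + 1)\<close>
  can serve as \<open>q\<close>.
\<close>

lemma isometry_into_subspace:
  assumes "q holomorphic_on right_half_plane" "\<And>w. 0 < Re w \<Longrightarrow> cmod (q w) \<le> B"
    and "\<And>m n. q (node m) = q (node n) \<Longrightarrow> m = n" and "0 < Re c"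
    and K: "closed K" "subspace K" "\<And>f. f \<in> K \<Longrightarrow> hardy_i f \<in> K"
    and "\<And>f n. (\<And>w. 0 < Re w \<Longrightarrow> hardy_fun f w = (\<Prod>j<n. q w - q (node j)) / (w + c)) \<Longrightarrow> f \<in> K"
  obtains W L where "\<forall>f. blinfun_apply W f \<in> K" "L o\<^sub>L W = id_blinfun" "c_linear W" "c_linear L"
proof -
  obtain v where v: "hardy.adapted_basis K v"
    by (rule hardy_node_basis[OF assms])
  have nz: "w + 1 \<noteq> 0" if "0 < Re w" for w :: complex
    using that by (auto simp: complex_eq_iff)
  obtain u where u: "hardy.adapted_basis UNIV u"
  (* The constants are the bound of q and the shift in the denominator. *)
  proof (rule hardy_node_basis[of "\<lambda>w. 1 / (w + 1)" 1 1 UNIV])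
    show "(\<lambda>w. 1 / (w + 1)) holomorphic_on right_half_plane"
      using nz by (intro holomorphic_intros) auto
    show "cmod (1 / (w + 1)) \<le> 1" if "0 < Re w" for w
      using that nz[OF that] complex_Re_le_cmod[of "w + 1"] by (simp add: norm_divide divide_le_eq)
    show "m = n" if "1 / (node m + 1) = 1 / (node n + 1)" for m n
      using that nz[of "node m"] nz[of "node n"] by (simp add: field_simps)
  qed auto
  note orth = u[THEN hardy.adapted_basisD(1)] v[THEN hardy.adapted_basisD(1)]
  define W L where "W = Blinfun (seq_map u v)" and "L = Blinfun (seq_map v u)"
  have W: "blinfun_apply W = seq_map u v" and L: "blinfun_apply L = seq_map v u"
    unfolding W_def L_def by (intro bounded_linear_Blinfun_apply bounded_linear_seq_map orth)+
  show ?thesis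
  proof
    show "\<forall>f. blinfun_apply W f \<in> K"
      unfolding W by (intro allI range_seq_map orth K hardy.adapted_basisD(2)[OF v])
    have "seq_map u u f = f" for f
      by (rule seq_map_complete[OF orth(1)]) (rule hardy.adapted_basisD(4)[OF u UNIV_I])
    then show "L o\<^sub>L W = id_blinfun"
      by (intro blinfun_eqI) (simp add: W L seq_map_seq_map orth)
    show "c_linear W"
      unfolding c_linear_iff W by (intro allI hardy.seq_map_iota[OF u v] K)
    show "c_linear L"
      unfolding c_linear_iff L by (intro allI hardy.seq_map_iota[OF v u]) auto
  qed
qed

section \<open>A right inverse for expanding symbols\<close>

lemma c_linear_affine_op: "\<sigma> > 0 \<Longrightarrow> 0 \<le> Re \<tau> \<Longrightarrow> c_linear (affine_op \<sigma> \<tau>)"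
  using affine_op_scaleC[of \<sigma> \<tau> \<i>] by (simp add: c_linear_iff hardy_i.rep_eq)

lemma c_linear_id: "c_linear id_blinfun"
  by (simp add: c_linear_iff)

lemma c_linear_diff: "c_linear A \<Longrightarrow> c_linear B \<Longrightarrow> c_linear (A - B)"
  by (simp add: c_linear_iff blinfun.diff_left blinfun.diff_right)

lemma c_linear_scaleR: "c_linear A \<Longrightarrow> c_linear (r *\<^sub>R A)"
  by (simp add: c_linear_iff blinfun.scaleR_left blinfun.scaleR_right)

lemma c_linear_suminf:
  assumes "summable A" "\<And>n. c_linear (A n)"
  shows "c_linear (\<Sum>n. A n)"
  unfolding c_linear_iff
proof
  fix f
  have A: "(\<lambda>n. A n f) sums (\<Sum>n. A n) f" for f
    by (intro bounded_linear.sums[OF blinfun.bounded_linear_left] summable_sums assms)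
  have "(\<lambda>n. hardy_i (A n f)) sums hardy_i ((\<Sum>n. A n) f)"
    by (intro bounded_linear.sums[OF blinfun.bounded_linear_right] A)
  then show "(\<Sum>n. A n) (hardy_i f) = hardy_i ((\<Sum>n. A n) f)"
    using A[of "hardy_i f"] assms(2) sums_unique2 by (simp add: c_linear_iff)
qed

text \<open>
  The dilation contributes the factor \<open>1 / sqrt \<sigma>\<close>, and the translation estimate the factor
  \<open>1 / Re \<tau>\<close>, because \<open>w\<close> is sent to the right of the line \<open>Re w = Re \<tau>\<close>.
\<close>

lemma norm_affine_op_translation_le:
  assumes \<sigma>: "\<sigma> > 0" and \<tau>: "0 < Re \<tau>" and c: "0 \<le> Re c"
  shows "norm (affine_op \<sigma> \<tau> - affine_op \<sigma> (\<tau> + c)) \<le> cmod c / (Re \<tau> * sqrt \<sigma>)"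
proof (rule norm_blinfun_bound)
  show "0 \<le> cmod c / (Re \<tau> * sqrt \<sigma>)"
    using \<sigma> \<tau> by simp
  fix f
  define g where "g = (affine_op \<sigma> (\<tau> + c) - affine_op \<sigma> \<tau>) f"
  have "hardy2_norm (hardy_fun g) \<le> cmod c / (Re \<tau> * sqrt \<sigma>) * norm f"
  proof (subst hardy2_norm_le_iff[OF hardy_fun]; (intro allI impI)?)
    show "0 \<le> cmod c / (Re \<tau> * sqrt \<sigma>) * norm f"
      using \<sigma> \<tau> by simp
    fix x R :: real
    assume x: "0 < x"
    define X where "X = \<sigma> * x + Re \<tau>"
    have X: "0 < X" "Re \<tau> \<le> X"
      using \<sigma> \<tau> x by (simp_all add: X_def add_pos_pos)
    define d where "d s = hardy_fun f (Complex X s + c) - hardy_fun f (Complex X s)" for s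
    have g_eq: "hardy_fun g (Complex x t) = d (\<sigma> * t + Im \<tau>)" for t
    proof -
      have eqs: "of_real \<sigma> * Complex x t + \<tau> = Complex X (\<sigma> * t + Im \<tau>)"
        "of_real \<sigma> * Complex x t + (\<tau> + c) = Complex X (\<sigma> * t + Im \<tau>) + c"
        by (simp_all add: complex_eq_iff X_def)
      have "hardy_fun g (Complex x t) = hardy_fun f (of_real \<sigma> * Complex x t + (\<tau> + c)) - hardy_fun f (of_real \<sigma> * Complex x t + \<tau>)"
        using \<sigma> \<tau> c x by (simp add: g_def blinfun.diff_left hardy_fun_affine_op)
      then show ?thesis
        unfolding eqs d_def .
    qed
    have "continuous_on A d" for A
      unfolding d_def using X c
      by (intro continuous_on_diff continuous_on_compose2[OF hardy2D(2)[OF hardy_fun]])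
         (auto simp: Complex_eq intro!: continuous_intros)
    then have "l2_norm_on (-R) R (\<lambda>t. hardy_fun g (Complex x t)) = l2_norm_on (\<sigma> * (-R) + Im \<tau>) (\<sigma> * R + Im \<tau>) d / sqrt \<sigma>"
      unfolding g_eq using l2_norm_on_affine[OF \<sigma>, of "-R" "Im \<tau>" R d] by simp
    also have "\<dots> \<le> (norm f / X * cmod c) / sqrt \<sigma>"
      unfolding d_def hardy_norm_eq using \<sigma> X c
      by (intro divide_right_mono hardy2_translation_estimate hardy_fun) auto
    also have "\<dots> \<le> (norm f / Re \<tau> * cmod c) / sqrt \<sigma>"
      using \<sigma> \<tau> X by (intro divide_right_mono mult_right_mono divide_left_mono) auto
    finally show "l2_norm_on (-R) R (\<lambda>t. hardy_fun g (Complex x t)) \<le> cmod c / (Re \<tau> * sqrt \<sigma>) * norm f"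
      by (simp add: mult.commute)
  qed
  moreover have "(affine_op \<sigma> \<tau> - affine_op \<sigma> (\<tau> + c)) f = - g"
    by (simp add: g_def blinfun.diff_left)
  ultimately show "norm ((affine_op \<sigma> \<tau> - affine_op \<sigma> (\<tau> + c)) f) \<le> cmod c / (Re \<tau> * sqrt \<sigma>) * norm f"
    by (simp add: hardy_norm_eq[symmetric])
qed

lemma norm_affine_op: "\<sigma> > 0 \<Longrightarrow> 0 \<le> Re \<tau> \<Longrightarrow> norm (affine_op \<sigma> \<tau>) \<le> 1 / sqrt \<sigma>"
  using norm_affine_op_le[of \<sigma> \<tau>] by (intro norm_blinfun_bound) auto

text \<open>
  The eigenvalue parameter \<open>1 / a\<close> lies strictly between \<open>a powr (-3/2)\<close> and \<open>a powr (-1/2)\<close> for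
  \<open>a > 1\<close>; this is the range in which both series for the right inverse converge.
\<close>

definition shifted_op :: "real \<Rightarrow> complex \<Rightarrow> hardy \<Rightarrow>\<^sub>L hardy" where
  "shifted_op a b = affine_op a b - (1 / a) *\<^sub>R id_blinfun"

context
  fixes a :: real and b :: complex
  assumes a: "1 < a" and b: "0 < Re b"
begin

text \<open>
  The negative of the fixed point of the symbol \<open>w \<mapsto> a w + b\<close>. In the coordinate \<open>w + neg_fix\<close> the
  symbol is the dilation by \<open>a\<close>.
\<close>

definition neg_fix :: complex where
  "neg_fix = b / of_real (a - 1)"

lemma Re_neg_fix: "0 < Re neg_fix"
  using a b by (simp add: neg_fix_def Re_divide_of_real)

lemma add_neg_fix: "b + neg_fix = of_real a * neg_fix"
proof -
  have "of_real a - 1 \<noteq> (0::complex)"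
    using a by (metis of_real_1 of_real_diff of_real_eq_0_iff diff_eq_eq add_0 less_irrefl)
  then have "neg_fix * (of_real a - 1) = b"
    by (simp add: neg_fix_def)
  then show ?thesis
    by (simp add: algebra_simps)
qed

lemma symbol_add_neg_fix: "of_real a * w + b + neg_fix = of_real a * (w + neg_fix)"
  by (simp add: add.assoc distrib_left add_neg_fix)

text \<open>
  Let \<open>C\<close> be the composition operator, \<open>c = neg_fix\<close> and \<open>\<tau> f = f (. + c)\<close>. Below,
  \<open>X k = a\<^sup>k C\<^sup>k (1 - \<tau>)\<close> and \<open>Y k = a\<^sup>-\<^sup>k C\<^sup>-\<^sup>k \<tau>\<close>, where negative powers of \<open>C\<close> make sense after the
  translation \<open>\<tau>\<close>. Since \<open>C - 1/a\<close> maps \<open>X k\<close> and \<open>Y k\<close> to multiples of consecutive differences, the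
  sums telescope to \<open>X 0 + Y 0 = (1 - \<tau>) + \<tau> = 1\<close>. Up to constants, both series are dominated by the
  geometric series with ratio \<open>1 / sqrt a\<close>.
\<close>

lemma shifted_op_right_inverse:
  obtains V where "shifted_op a b o\<^sub>L V = id_blinfun" "c_linear V"
proof -
  define D where "D k = affine_op (a ^ k) (of_real (a ^ k) * neg_fix - neg_fix) - affine_op (a ^ k) (of_real (a ^ k) * neg_fix)" for k
  define X where "X k = a ^ k *\<^sub>R D k" for k
  define Y where "Y k = (1 / a ^ k) *\<^sub>R affine_op (1 / a ^ k) (neg_fix / of_real (a ^ k))" for k
  define q where "q = 1 / sqrt a"
  have q: "0 < q" "q < 1"
    using a by (simp_all add: q_def)
  have sqrt_pow: "sqrt (a ^ k) = (1 / q) ^ k" for k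
    by (simp add: q_def real_sqrt_power)
  have ak: "0 < a ^ k" "1 \<le> a ^ k" for k
    using a by (simp_all add: one_le_power)
  have re1: "0 \<le> Re (of_real (a ^ k) * neg_fix - neg_fix)" for k
  proof -
    have "1 * Re neg_fix \<le> a ^ k * Re neg_fix"
      using ak(2)[of k] Re_neg_fix by (intro mult_right_mono) auto
    then show ?thesis by simp
  qed
  have re2: "0 \<le> Re (of_real (a ^ k) * neg_fix)" for k
    using ak(1)[of k] Re_neg_fix by simp
  have re3: "0 \<le> Re (neg_fix / of_real (a ^ k))" for k
    unfolding Re_divide_of_real using ak(1)[of k] Re_neg_fix by simp
  (* The translation estimate is applied for k >= 1 only: for k = 0 the translation a^k c - c is zero. *)
  have normX: "norm (X k) \<le> cmod neg_fix / ((1 - 1 / a) * Re neg_fix) * q ^ k" if "k \<ge> 1" for k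
  proof -
    have "a \<le> a ^ k"
      using a that power_increasing[of 1 k a] by simp
    then have "a ^ k * (1 - 1 / a) \<le> a ^ k - 1"
      using a by (simp add: field_simps)
    then have le: "a ^ k * (1 - 1 / a) * Re neg_fix \<le> Re (of_real (a ^ k) * neg_fix - neg_fix)"
      using mult_right_mono[of "a ^ k * (1 - 1 / a)" "a ^ k - 1" "Re neg_fix"] Re_neg_fix by (simp add: algebra_simps)
    have pos: "0 < a ^ k * (1 - 1 / a) * Re neg_fix"
      using a ak(1)[of k] Re_neg_fix by simp
    have pos': "0 < Re (of_real (a ^ k) * neg_fix - neg_fix)"
      using le pos by linarith
    have s: "0 < sqrt (a ^ k)"
      using ak(1) by simp
    have "norm (X k) = a ^ k * norm (D k)"
      using ak(1)[of k] by (simp add: X_def)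
    also have "norm (D k) \<le> cmod neg_fix / (Re (of_real (a ^ k) * neg_fix - neg_fix) * sqrt (a ^ k))"
      using norm_affine_op_translation_le[OF ak(1)[of k] pos', of neg_fix] Re_neg_fix by (simp add: D_def)
    also have "\<dots> \<le> cmod neg_fix / (a ^ k * (1 - 1 / a) * Re neg_fix * sqrt (a ^ k))"
      using s by (intro divide_left_mono mult_right_mono mult_pos_pos pos pos' le) auto
    also have "a ^ k * \<dots> = cmod neg_fix / ((1 - 1 / a) * Re neg_fix) * q ^ k"
    proof -
      have gen: "A * (N / (A * d * r * (1 / p))) = N / (d * r) * p" if "A \<noteq> 0" "p \<noteq> 0" for A N d r p :: real
        using that by (cases "d = 0 \<or> r = 0") (auto simp: field_simps)
      show ?thesis
        unfolding sqrt_pow power_one_over using a q(1) by (intro gen) auto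
    qed
    finally show ?thesis
      using ak(1)[of k] by (simp add: mult_left_mono)
  qed
  have normY: "norm (Y k) \<le> q ^ k" for k
  proof -
    have "norm (Y k) = (1 / a ^ k) * norm (affine_op (1 / a ^ k) (neg_fix / of_real (a ^ k)))"
      using ak(1)[of k] by (simp add: Y_def)
    also have "\<dots> \<le> (1 / a ^ k) * (1 / sqrt (1 / a ^ k))"
      using ak(1)[of k] re3 by (intro mult_left_mono norm_affine_op) auto
    also have "\<dots> = 1 / sqrt (a ^ k)"
      using ak(1)[of k] by (simp add: real_sqrt_divide sqrt_divide_self_eq inverse_eq_divide)
    also have "\<dots> = q ^ k"
      by (simp add: sqrt_pow power_divide)
    finally show ?thesis .
  qed
  have geom: "summable (\<lambda>k. C * q ^ k)" for C
    using q by (intro summable_mult summable_geometric) auto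
  have sX: "summable X"
    by (rule summable_comparison_test[OF _ geom]) (use normX in blast)
  have sY: "summable Y"
    by (rule summable_comparison_test[OF _ geom[of 1]]) (use normY in auto)
  have shift_aff: "affine_op a b (affine_op \<sigma> \<tau> f) = affine_op (\<sigma> * a) (of_real (\<sigma> * a) * neg_fix - of_real \<sigma> * neg_fix + \<tau>) f"
    if "0 < \<sigma>" "0 \<le> Re \<tau>" for \<sigma> \<tau> f
  proof -
    have "of_real \<sigma> * b = of_real \<sigma> * (b + neg_fix) - of_real \<sigma> * neg_fix"
      by (simp add: algebra_simps)
    then have "of_real \<sigma> * b = of_real (\<sigma> * a) * neg_fix - of_real \<sigma> * neg_fix"
      by (simp add: add_neg_fix)
    then show ?thesis
      using affine_op_affine_op[of a b \<sigma> \<tau> f] that a b by simp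
  qed
  have UX: "shifted_op a b o\<^sub>L X k = (1 / a) *\<^sub>R (X (Suc k) - X k)" for k
  proof (rule blinfun_eqI)
    fix f
    have "affine_op a b (D k f) = D (Suc k) f"
      unfolding D_def blinfun.diff_left blinfun.diff_right
      using ak(1)[of k] re1 re2 by (simp add: shift_aff mult.commute)
    then show "(shifted_op a b o\<^sub>L X k) f = ((1 / a) *\<^sub>R (X (Suc k) - X k)) f"
      using a by (simp add: shifted_op_def X_def blinfun.diff_left blinfun.scaleR_left blinfun.scaleR_right algebra_simps)
  qed
  have UY: "shifted_op a b o\<^sub>L Y (Suc k) = - (1 / a) *\<^sub>R (Y (Suc k) - Y k)" for k
  proof (rule blinfun_eqI)
    fix f
    have "affine_op a b (affine_op (1 / a ^ Suc k) (neg_fix / of_real (a ^ Suc k)) f) = affine_op (1 / a ^ k) (neg_fix / of_real (a ^ k)) f"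
    proof -
      have "1 / a ^ Suc k * a = 1 / a ^ k"
        using a by simp
      moreover have "of_real (1 / a ^ k) * neg_fix - of_real (1 / a ^ Suc k) * neg_fix + neg_fix / of_real (a ^ Suc k) = neg_fix / of_real (a ^ k)"
        by simp
      ultimately show ?thesis
        using shift_aff[of "1 / a ^ Suc k" "neg_fix / of_real (a ^ Suc k)" f] ak(1)[of "Suc k"] re3[of "Suc k"]
        by (simp del: power_Suc)
    qed
    then show "(shifted_op a b o\<^sub>L Y (Suc k)) f = (- (1 / a) *\<^sub>R (Y (Suc k) - Y k)) f"
      using a by (simp add: shifted_op_def Y_def blinfun.diff_left blinfun.minus_left blinfun.scaleR_left blinfun.scaleR_right algebra_simps)
  qed
  define V where "V = a *\<^sub>R ((\<Sum>k. Y (Suc k)) - (\<Sum>k. X k))"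
  note comp = bounded_bilinear.bounded_linear_right[OF bounded_bilinear_blinfun_compose, of "shifted_op a b"]
  have "(\<lambda>k. (1 / a) *\<^sub>R (X (Suc k) - X k)) sums (shifted_op a b o\<^sub>L (\<Sum>k. X k))"
    using bounded_linear.sums[OF comp summable_sums[OF sX]] by (simp add: UX)
  moreover have "(\<lambda>k. (1 / a) *\<^sub>R (X (Suc k) - X k)) sums ((1 / a) *\<^sub>R (0 - X 0))"
    by (intro bounded_linear.sums[OF bounded_linear_scaleR_right] telescope_sums summable_LIMSEQ_zero sX)
  ultimately have sumX: "shifted_op a b o\<^sub>L (\<Sum>k. X k) = - (1 / a) *\<^sub>R X 0"
    using sums_unique2 by fastforce
  have "(\<lambda>k. - (1 / a) *\<^sub>R (Y (Suc k) - Y k)) sums (shifted_op a b o\<^sub>L (\<Sum>k. Y (Suc k)))"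
    using bounded_linear.sums[OF comp summable_sums[OF summable_Suc_iff[THEN iffD2, OF sY]]] by (simp add: UY)
  moreover have "(\<lambda>k. - (1 / a) *\<^sub>R (Y (Suc k) - Y k)) sums (- (1 / a) *\<^sub>R (0 - Y 0))"
    by (intro bounded_linear.sums[OF bounded_linear_scaleR_right] telescope_sums summable_LIMSEQ_zero sY)
  ultimately have sumY: "shifted_op a b o\<^sub>L (\<Sum>k. Y (Suc k)) = (1 / a) *\<^sub>R Y 0"
    using sums_unique2 by fastforce
  have "shifted_op a b o\<^sub>L V = a *\<^sub>R ((shifted_op a b o\<^sub>L (\<Sum>k. Y (Suc k))) - (shifted_op a b o\<^sub>L (\<Sum>k. X k)))"
    by (rule blinfun_eqI)
       (simp add: V_def blinfun.scaleR_left blinfun.scaleR_right blinfun.diff_left blinfun.diff_right)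
  also have "\<dots> = Y 0 + X 0"
    using a by (simp add: sumX sumY scaleR_right_distrib)
  also have "\<dots> = id_blinfun"
    by (rule blinfun_eqI) (simp add: X_def Y_def D_def blinfun.add_left blinfun.diff_left)
  finally have UV: "shifted_op a b o\<^sub>L V = id_blinfun" .
  have "c_linear (X k)" "c_linear (Y k)" for k
    unfolding X_def Y_def D_def using ak(1)[of k] re1 re2 re3
    by (auto intro!: c_linear_scaleR c_linear_diff c_linear_affine_op)
  then have "c_linear V"
    unfolding V_def using sX sY by (intro c_linear_scaleR c_linear_diff c_linear_suminf) (auto simp: summable_Suc_iff)
  then show ?thesis
    using UV that by blast
qed

lemma c_linear_shifted_op: "c_linear (shifted_op a b)"
  unfolding shifted_op_def using a b
  by (intro c_linear_diff c_linear_scaleR c_linear_affine_op c_linear_id) auto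

text \<open>
  The function \<open>q w = (w + c) powr (\<i> \<kappa>)\<close>, where \<open>c = neg_fix\<close> and \<open>\<kappa> ln a = 2 \<pi>\<close>, is bounded on the
  half-plane because the argument of \<open>w + c\<close> is, and invariant under the symbol because \<open>w + c\<close> is
  multiplied by \<open>a\<close>. Hence \<open>1 / (w + c)\<close> times any polynomial in \<open>q\<close> is an eigenfunction for \<open>1 / a\<close>.
\<close>

lemma shifted_op_kernel_isometry:
  obtains W L where "shifted_op a b o\<^sub>L W = 0" "L o\<^sub>L W = id_blinfun" "c_linear W" "c_linear L"
proof -
  define \<kappa> where "\<kappa> = 2 * pi / ln a"
  define q where "q w = exp (\<i> * of_real \<kappa> * Ln (w + neg_fix))" for w
  define K where "K = {f. shifted_op a b f = 0}"
  have \<kappa>: "0 < \<kappa>" "\<kappa> * ln a = 2 * pi"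
    using a by (simp_all add: \<kappa>_def)
  have re: "0 < Re (w + neg_fix)" if "0 < Re w" for w
    using that Re_neg_fix by simp
  have nz: "w + neg_fix \<noteq> 0" if "0 < Re w" for w
    using re[OF that] by force
  have hol: "q holomorphic_on right_half_plane"
    unfolding q_def using Re_neg_fix by (intro holomorphic_intros) (auto simp: complex_nonpos_Reals_iff)
  have bound: "cmod (q w) \<le> exp (\<kappa> * pi)" if "0 < Re w" for w
  proof -
    have "\<kappa> * (- Im (Ln (w + neg_fix))) \<le> \<kappa> * pi"
      using mpi_less_Im_Ln[OF nz[OF that]] \<kappa>(1) by (intro mult_left_mono) linarith+
    then show ?thesis
      by (simp add: q_def)
  qed
  have inj: "m = n" if eq: "q (node m) = q (node n)" for m n
  proof -
    have nzm: "node k + neg_fix \<noteq> 0" for k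
      by (rule nz) simp
    obtain j :: int where j: "\<i> * of_real \<kappa> * Ln (node m + neg_fix) = \<i> * of_real \<kappa> * Ln (node n + neg_fix) + (of_int (2 * j) * pi) * \<i>"
      using eq unfolding q_def exp_eq by blast
    have "of_real \<kappa> * Ln (node m + neg_fix) = of_real \<kappa> * Ln (node n + neg_fix) + of_int (2 * j) * pi"
    proof -
      have "\<i> * (of_real \<kappa> * Ln (node m + neg_fix)) = \<i> * (of_real \<kappa> * Ln (node n + neg_fix) + of_int (2 * j) * pi)"
        using j by (simp add: algebra_simps)
      then show ?thesis by simp
    qed
    then have "Ln (node m + neg_fix) = Ln (node n + neg_fix) + of_real (real_of_int (2 * j) * pi / \<kappa>)"
      using \<kappa>(1) by (simp add: field_simps)
    then have "exp (Ln (node m + neg_fix)) = exp (Ln (node n + neg_fix)) * of_real (exp (real_of_int (2 * j) * pi / \<kappa>))"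
      by (simp only: exp_add exp_of_real)
    (* Equal values of q force the shifted nodes to be positive multiples of each other. *)
    then obtain r :: real where r: "node m + neg_fix = (node n + neg_fix) * of_real r"
      using nzm by (metis exp_Ln)
    then have "Re (node m + neg_fix) = Re (node n + neg_fix) * r"
      by simp
    then have "r = 1"
      using Re_neg_fix by simp
    then show ?thesis
      using r by simp
  qed
  have q_inv: "q (of_real a * w + b) = q w" if w: "0 < Re w" for w
  proof -
    have "Ln (of_real a * w + b + neg_fix) = of_real (ln a) + Ln (w + neg_fix)"
      unfolding symbol_add_neg_fix using a nz[OF w] Ln_times_of_real[of a "w + neg_fix"] by (simp add: Ln_of_real)
    then have "q (of_real a * w + b) = exp (\<i> * of_real (\<kappa> * ln a)) * q w"
      by (simp add: q_def distrib_left exp_add mult.assoc)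
    then show ?thesis
      using exp_two_pi_i by (simp add: \<kappa>(2) mult.commute)
  qed
  obtain W L where WL: "\<forall>f. blinfun_apply W f \<in> K" "L o\<^sub>L W = id_blinfun" "c_linear W" "c_linear L"
  proof (rule isometry_into_subspace[OF hol bound inj Re_neg_fix, of K])
    show "closed K"
      unfolding K_def by (intro closed_Collect_eq continuous_intros)
    show "subspace K"
      by (auto simp: K_def subspace_def blinfun.add_right blinfun.scaleR_right)
    show "hardy_i f \<in> K" if "f \<in> K" for f
      using that c_linear_shifted_op by (simp add: K_def c_linear_iff)
    show "f \<in> K" if f: "\<And>w. 0 < Re w \<Longrightarrow> hardy_fun f w = (\<Prod>j<n. q w - q (node j)) / (w + neg_fix)" for f n
      unfolding K_def mem_Collect_eq
    proof (rule hardy_eqI)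
      fix w :: complex
      assume w: "0 < Re w"
      have w': "0 < Re (of_real a * w + b)"
        using half_plane_affine[of a b w] a b w by simp
      show "hardy_fun (shifted_op a b f) w = hardy_fun 0 w"
        using w f[OF w] f[OF w'] a b
        by (simp add: shifted_op_def blinfun.diff_left blinfun.scaleR_left hardy_fun_affine_op q_inv[OF w] symbol_add_neg_fix)
    qed
  qed (assumption | rule that)+
  have "shifted_op a b o\<^sub>L W = 0"
    using WL(1) by (intro blinfun_eqI) (simp add: K_def)
  then show ?thesis
    using WL that by blast
qed

theorem universal_expanding:
  "universal_operator hardy2_norm hardy2
     (\<lambda>f. composition_operator (\<lambda>w. of_real a * w + b) f - fun_scale (of_real (1 / a)) f)"
proof -
  obtain V where V: "shifted_op a b o\<^sub>L V = id_blinfun" "c_linear V"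
    using shifted_op_right_inverse .
  obtain W L where WL: "shifted_op a b o\<^sub>L W = 0" "L o\<^sub>L W = id_blinfun" "c_linear W" "c_linear L"
    using shifted_op_kernel_isometry .
  show ?thesis
  proof (rule universal_of_right_inverse[OF V(1) WL(1,2) c_linear_shifted_op V(2) WL(3,4)])
    fix f :: "complex \<Rightarrow> complex"
    assume f: "f \<in> hardy2"
    have "hardy_fun (shifted_op a b (Hardy f)) = hardy_fun (affine_op a b (Hardy f)) - hardy_fun ((1 / a) *\<^sub>R Hardy f)"
      by (simp add: shifted_op_def blinfun.diff_left blinfun.scaleR_left minus_hardy.rep_eq)
    then show "composition_operator (\<lambda>w. of_real a * w + b) f - fun_scale (of_real (1 / a)) f
        = hardy_fun (shifted_op a b (Hardy f))"
      using a b f by (simp add: hardy_fun_affine_op' Hardy_inverse scaleR_hardy.rep_eq)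
  qed
qed

end

section \<open>Obstructions to universality\<close>

text \<open>
  \<open>R\<close> is the inverse of the similarity between the restriction of \<open>Op\<close> to a closed invariant subspace
  and \<open>\<alpha> T\<close>.
\<close>

lemma universal_operator_model:
  assumes univ: "universal_operator hardy2_norm hardy2 Op" and T: "bounded_operator hardy2_norm hardy2 hardy2 T"
  obtains \<alpha> R where "\<alpha> \<noteq> 0" "\<And>g. g \<in> hardy2 \<Longrightarrow> R g \<in> hardy2" "R 0 = 0"
    "\<And>g. g \<in> hardy2 \<Longrightarrow> R g = 0 \<Longrightarrow> g = 0" "\<And>g. g \<in> hardy2 \<Longrightarrow> Op (R g) = R (fun_scale \<alpha> (T g))"
proof -
  obtain \<alpha> M where M: "\<alpha> \<noteq> 0" "closed_subspace hardy2_norm hardy2 M" "Op ` M \<subseteq> M"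
      "similar_operators hardy2_norm M Op hardy2 (\<lambda>f. fun_scale \<alpha> (T f))"
    using univ T unfolding universal_operator_def by blast
  obtain S R where S: "bounded_operator hardy2_norm M hardy2 S" and R: "bounded_operator hardy2_norm hardy2 M R"
      and RS: "\<forall>f\<in>M. R (S f) = f" and SR: "\<forall>g\<in>hardy2. S (R g) = g"
      and inter: "\<forall>f\<in>M. S (Op f) = fun_scale \<alpha> (T (S f))"
    using M(4) unfolding similar_operators_def by blast
  have RM: "R g \<in> M" if "g \<in> hardy2" for g
    using R that by (simp add: bounded_operator_def)
  have "R (fun_scale 0 0) = fun_scale 0 (R 0)"
    using R hardy2_zero unfolding bounded_operator_def by blast
  then have R0: "R 0 = 0"
    by (simp add: fun_scale_simps)
  have "0 \<in> M" "M \<subseteq> hardy2"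
    using M(2) cfun.subspace_0 by (auto simp: closed_subspace_def)
  then have "S (fun_scale 0 0) = fun_scale 0 (S 0)"
    using S unfolding bounded_operator_def by blast
  then have S0: "S 0 = 0"
    by (simp add: fun_scale_simps)
  show ?thesis
  proof (rule that[OF M(1)])
    show "R g \<in> hardy2" if "g \<in> hardy2" for g
      using RM[OF that] \<open>M \<subseteq> hardy2\<close> by blast
    show "R 0 = 0" by (rule R0)
    show "g = 0" if "g \<in> hardy2" "R g = 0" for g
      using SR that S0 by metis
    show "Op (R g) = R (fun_scale \<alpha> (T g))" if g: "g \<in> hardy2" for g
    proof -
      have "S (Op (R g)) = fun_scale \<alpha> (T g)"
        using inter RM[OF g] SR g by simp
      moreover have "Op (R g) \<in> M"
        using RM[OF g] M(3) by blast
      ultimately show ?thesis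
        using RS by metis
    qed
  qed
qed

definition symbol_op :: "real \<Rightarrow> complex \<Rightarrow> complex \<Rightarrow> (complex \<Rightarrow> complex) \<Rightarrow> (complex \<Rightarrow> complex)" where
  "symbol_op a b \<mu> f = composition_operator (\<lambda>w. of_real a * w + b) f - fun_scale \<mu> f"

lemma symbol_op_hardy:
  assumes "a > 0" "0 \<le> Re b"
  shows "symbol_op a b \<mu> (hardy_fun f) = hardy_fun (affine_op a b f - scaleC \<mu> f)"
  using assms by (simp add: symbol_op_def minus_hardy.rep_eq scaleC.rep_eq hardy_fun_affine_op')

text \<open>
  Ingredients of the rank one operator \<open>T f = f 1 h\<close>: its square vanishes because \<open>h\<close> vanishes at 1,
  while \<open>T k \<noteq> 0\<close>.
\<close>

lemma hardy_nonzero_pair: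
  obtains h k :: hardy where "h \<noteq> 0" "hardy_fun h 1 = 0" "hardy_fun k 1 \<noteq> 0"
proof -
  have nz: "w + 1 \<noteq> 0" if "0 < Re w" for w :: complex
    using that by (auto simp: complex_eq_iff)
  have q: "(\<lambda>w. 1 / (w + 1)) holomorphic_on right_half_plane"
    using nz by (intro holomorphic_intros) auto
  have q_le: "cmod (1 / (w + 1)) \<le> 1" if "0 < Re w" for w
    using that nz[OF that] complex_Re_le_cmod[of "w + 1"] by (simp add: norm_divide divide_le_eq)
  obtain h where h: "\<And>w. 0 < Re w \<Longrightarrow> hardy_fun h w = (\<Prod>j<1::nat. 1 / (w + 1) - 1 / 2) / (w + 1)"
    using product_test_function[OF q q_le, of 1 "\<lambda>_. 1 / 2" 1] by auto
  obtain k where k: "\<And>w. 0 < Re w \<Longrightarrow> hardy_fun k w = (\<Prod>j<0::nat. 1 / (w + 1) - 1 / 2) / (w + 1)"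
    using product_test_function[OF q q_le, of 1 "\<lambda>_. 1 / 2" 0] by auto
  have "hardy_fun h 2 \<noteq> 0"
    by (simp add: h)
  then have "h \<noteq> 0" by auto
  moreover have "hardy_fun h 1 = 0" "hardy_fun k 1 \<noteq> 0"
    by (simp_all add: h k)
  ultimately show ?thesis
    using that by blast
qed

text \<open>
  A universal operator models \<open>T = 0\<close>.
\<close>

lemma universal_imp_eigenvector:
  assumes ab: "a > 0" "0 \<le> Re b" and univ: "universal_operator hardy2_norm hardy2 (symbol_op a b \<mu>)"
  obtains f where "f \<noteq> 0" "affine_op a b f = scaleC \<mu> f"
proof -
  have "bounded_operator hardy2_norm hardy2 hardy2 (\<lambda>_. 0)"
    using hardy2_zero hardy2_norm_scale[OF hardy2_zero, of 0]
    by (auto simp: bounded_operator_def fun_scale_simps intro!: exI[of _ 0])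
  from universal_operator_model[OF univ this] obtain \<alpha> R where R: "\<And>g. g \<in> hardy2 \<Longrightarrow> R g \<in> hardy2" "R 0 = 0"
    "\<And>g. g \<in> hardy2 \<Longrightarrow> R g = 0 \<Longrightarrow> g = 0" "\<And>g. g \<in> hardy2 \<Longrightarrow> symbol_op a b \<mu> (R g) = R (fun_scale \<alpha> 0)"
    by metis
  obtain h :: hardy where h: "h \<noteq> 0"
    using hardy_nonzero_pair by metis
  define f where "f = Hardy (R (hardy_fun h))"
  have f: "hardy_fun f = R (hardy_fun h)"
    unfolding f_def by (intro Hardy_inverse R hardy_fun)
  show ?thesis
  proof
    show "f \<noteq> 0"
      using R(3)[OF hardy_fun, of h] h f by (auto simp: zero_hardy.rep_eq hardy_fun_inject simp flip: zero_hardy.rep_eq)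
    have "hardy_fun (affine_op a b f - scaleC \<mu> f) = hardy_fun 0"
      unfolding symbol_op_hardy[OF ab, symmetric] f R(4)[OF hardy_fun] by (simp add: fun_scale_simps R(2) zero_hardy.rep_eq)
    then show "affine_op a b f = scaleC \<mu> f"
      by (simp add: hardy_fun_inject)
  qed
qed

text \<open>
  A universal operator models the nilpotent operator \<open>T f = f 1 h\<close>; the chain is the image of \<open>k\<close> and
  of a multiple of \<open>h\<close>.
\<close>

lemma universal_imp_jordan_chain:
  assumes ab: "a > 0" "0 \<le> Re b" and univ: "universal_operator hardy2_norm hardy2 (symbol_op a b \<mu>)"
  obtains f g where "g \<noteq> 0" "affine_op a b f = scaleC \<mu> f + g" "affine_op a b g = scaleC \<mu> g"
proof -
  obtain h k :: hardy where hk: "h \<noteq> 0" "hardy_fun h 1 = 0" "hardy_fun k 1 \<noteq> 0"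
    by (rule hardy_nonzero_pair)
  define T where "T f = fun_scale (f 1) (hardy_fun h)" for f :: "complex \<Rightarrow> complex"
  have "bounded_operator hardy2_norm hardy2 hardy2 T"
    unfolding bounded_operator_def
  proof (intro conjI ballI allI)
    show "T f \<in> hardy2" for f
      unfolding T_def by (intro hardy2_scale hardy_fun)
    show "\<exists>K. \<forall>f\<in>hardy2. hardy2_norm (T f) \<le> K * hardy2_norm f"
    proof (intro exI ballI)
      fix f
      assume "f \<in> hardy2"
      then have "cmod (f 1) * norm h \<le> (2 * hardy2_norm f) * norm h"
        using hardy2_pointwise_bound[of f 1] by (intro mult_right_mono) auto
      then show "hardy2_norm (T f) \<le> (2 * norm h) * hardy2_norm f"
        by (simp add: T_def hardy2_norm_scale[OF hardy_fun] hardy_norm_eq mult_ac)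
    qed
  qed (auto simp: T_def fun_scale_def fun_eq_iff algebra_simps)
  from universal_operator_model[OF univ this] obtain \<alpha> R where \<alpha>: "\<alpha> \<noteq> 0"
    and R: "\<And>g. g \<in> hardy2 \<Longrightarrow> R g \<in> hardy2" "R 0 = 0" "\<And>g. g \<in> hardy2 \<Longrightarrow> R g = 0 \<Longrightarrow> g = 0"
      "\<And>g. g \<in> hardy2 \<Longrightarrow> symbol_op a b \<mu> (R g) = R (fun_scale \<alpha> (T g))"
    by metis
  define H where "H = scaleC (\<alpha> * hardy_fun k 1) h"
  have TH: "fun_scale \<alpha> (T (hardy_fun k)) = hardy_fun H" "fun_scale \<alpha> (T (hardy_fun H)) = 0"
    by (simp_all add: T_def H_def scaleC.rep_eq fun_scale_def hk fun_eq_iff)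
  have "H \<noteq> 0"
  proof
    assume "H = 0"
    then have "norm H = 0" by simp
    then show False
      using hk \<alpha> by (simp add: H_def norm_scaleC)
  qed
  define f g where "f = Hardy (R (hardy_fun k))" and "g = Hardy (R (hardy_fun H))"
  have fg: "hardy_fun f = R (hardy_fun k)" "hardy_fun g = R (hardy_fun H)"
    unfolding f_def g_def by (intro Hardy_inverse R hardy_fun)+
  have "hardy_fun (affine_op a b f - scaleC \<mu> f) = hardy_fun g"
    unfolding symbol_op_hardy[OF ab, symmetric] fg R(4)[OF hardy_fun] TH ..
  then have 1: "affine_op a b f = scaleC \<mu> f + g"
    by (simp add: hardy_fun_inject algebra_simps)
  have "hardy_fun (affine_op a b g - scaleC \<mu> g) = hardy_fun 0"
    unfolding symbol_op_hardy[OF ab, symmetric] fg R(4)[OF hardy_fun] TH R(2) zero_hardy.rep_eq ..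
  then have 2: "affine_op a b g = scaleC \<mu> g"
    by (simp add: hardy_fun_inject)
  have "g \<noteq> 0"
  proof
    assume "g = 0"
    then have "R (hardy_fun H) = 0"
      using fg(2) zero_hardy.rep_eq by simp
    then have "hardy_fun H = hardy_fun 0"
      using R(3)[OF hardy_fun] by (simp add: zero_hardy.rep_eq)
    then show False
      using \<open>H \<noteq> 0\<close> by (simp add: hardy_fun_inject)
  qed
  then show ?thesis
    using that 1 2 by blast
qed

text \<open>
  Along a Jordan chain the iterates of \<open>f\<close>, rescaled by the norm of the operator, would grow linearly,
  whereas they all have the norm of \<open>f\<close>.
\<close>

lemma not_universal_if_scaled_isometry:
  assumes a: "a > 0" and b: "Re b = 0"
  shows "\<not> universal_operator hardy2_norm hardy2 (symbol_op a b \<mu>)"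
proof
  assume "universal_operator hardy2_norm hardy2 (symbol_op a b \<mu>)"
  then obtain f g where fg: "g \<noteq> 0" "affine_op a b f = scaleC \<mu> f + g" "affine_op a b g = scaleC \<mu> g"
    using universal_imp_jordan_chain[of a b \<mu>] a b by (metis order_refl)
  define \<kappa> where "\<kappa> = 1 / sqrt a"
  have \<kappa>: "\<kappa> > 0" using a by (simp add: \<kappa>_def)
  have norm_C: "norm (affine_op a b x) = \<kappa> * norm x" for x
    using norm_affine_op_eq[OF a b] by (simp add: \<kappa>_def)
  have norm_Cn: "norm ((blinfun_apply (affine_op a b) ^^ n) x) = \<kappa> ^ n * norm x" for n x
    by (induction n) (simp_all add: norm_C)
  have "cmod \<mu> * norm g = \<kappa> * norm g"
    using norm_C[of g] by (simp add: fg(3) norm_scaleC)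
  then have \<mu>: "cmod \<mu> = \<kappa>"
    using fg(1) by simp
  have iter: "(blinfun_apply (affine_op a b) ^^ Suc n) f = scaleC (\<mu> ^ Suc n) f + scaleC (of_nat (Suc n) * \<mu> ^ n) g" for n
  proof (induction n)
    case 0
    show ?case
      using scaleC_simps(4)[of 1 g] by (simp add: fg)
  next
    case (Suc n)
    have "(blinfun_apply (affine_op a b) ^^ Suc (Suc n)) f
        = scaleC (\<mu> ^ Suc n) (affine_op a b f) + scaleC (of_nat (Suc n) * \<mu> ^ n) (affine_op a b g)"
      using Suc a b by (simp add: blinfun.add_right affine_op_scaleC)
    also have "\<dots> = scaleC (\<mu> ^ Suc (Suc n)) f + scaleC (of_nat (Suc (Suc n)) * \<mu> ^ Suc n) g"
      by (rule hardy_eqI) (simp add: fg algebra_simps)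
    finally show ?case .
  qed
  have "real (Suc n) * norm g \<le> 2 * \<kappa> * norm f" for n
  proof -
    have "scaleC (of_nat (Suc n) * \<mu> ^ n) g = (blinfun_apply (affine_op a b) ^^ Suc n) f - scaleC (\<mu> ^ Suc n) f"
      by (simp add: iter del: funpow.simps power_Suc of_nat_Suc)
    then have "norm (scaleC (of_nat (Suc n) * \<mu> ^ n) g)
        \<le> norm ((blinfun_apply (affine_op a b) ^^ Suc n) f) + norm (scaleC (\<mu> ^ Suc n) f)"
      using norm_triangle_ineq4 by metis
    then have "real (Suc n) * \<kappa> ^ n * norm g \<le> 2 * (\<kappa> ^ Suc n * norm f)"
      unfolding norm_Cn norm_scaleC norm_mult norm_power \<mu> norm_of_nat by (simp add: mult_ac)
    then have "\<kappa> ^ n * (real (Suc n) * norm g) \<le> \<kappa> ^ n * (2 * \<kappa> * norm f)"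
      by (simp add: mult_ac)
    then show ?thesis
      using \<kappa> by simp
  qed
  moreover obtain n where "2 * \<kappa> * norm f / norm g < real n"
    using reals_Archimedean2 by blast
  ultimately show False
    using fg(1) by (smt (verit) divide_less_eq of_nat_Suc zero_less_norm_iff)
qed

text \<open>
  The symbol has an attracting fixed point \<open>p\<close> in the half-plane. On the horizontal ray to the right
  of \<open>p\<close>, boundedness near \<open>p\<close> forces \<open>|\<mu>| \<le> 1\<close>; iterating backwards towards infinity, where
  \<open>f (p + t)\<close> is bounded by a multiple of \<open>1 / sqrt t\<close>, then forces an eigenfunction to vanish on the
  ray.
\<close>

lemma not_universal_if_contracting:
  assumes a: "0 < a" "a < 1" and b: "0 < Re b"
  shows "\<not> universal_operator hardy2_norm hardy2 (symbol_op a b \<mu>)"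
proof
  assume "universal_operator hardy2_norm hardy2 (symbol_op a b \<mu>)"
  then obtain f where f: "f \<noteq> 0" "affine_op a b f = scaleC \<mu> f"
    using universal_imp_eigenvector[of a b \<mu>] a b by (metis less_imp_le)
  define p where "p = b / of_real (1 - a)"
  have "of_real (1 - a) \<noteq> (0::complex)"
    using a by (simp only: of_real_eq_0_iff)
  then have "p * of_real (1 - a) = b"
    by (simp add: p_def)
  then have fix_p: "of_real a * p + b = p"
    by (simp add: algebra_simps)
  have Re_p: "0 < Re p"
    using a b by (simp add: p_def Re_divide_of_real)
  have eig: "hardy_fun f (of_real a * w + b) = \<mu> * hardy_fun f w" if "0 < Re w" for w
    using hardy_fun_affine_op[of a b w f] a b that by (simp add: f(2))
  have iter: "hardy_fun f (p + of_real (a ^ n * t)) = \<mu> ^ n * hardy_fun f (p + of_real t)" if "0 < t" for n t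
  proof (induction n)
    case (Suc n)
    have pos: "0 < Re (p + of_real (a ^ n * t))"
      using Re_p a that by (simp add: add_pos_pos)
    have "of_real a * (p + of_real (a ^ n * t)) + b = (of_real a * p + b) + of_real (a ^ Suc n * t)"
      by (simp add: algebra_simps)
    then have "hardy_fun f (p + of_real (a ^ Suc n * t)) = \<mu> * hardy_fun f (p + of_real (a ^ n * t))"
      using eig[OF pos] fix_p by simp
    then show ?case
      using Suc by simp
  qed simp
  have zero: "hardy_fun f (p + of_real t) = 0" if t: "0 < t" for t
  proof (rule ccontr)
    define v where "v = hardy_fun f (p + of_real t)"
    assume "hardy_fun f (p + of_real t) \<noteq> 0"
    then have v: "0 < cmod v" by (simp add: v_def)
    have "cmod \<mu> ^ n * cmod v \<le> 2 * norm f / sqrt (Re p)" for n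
    proof -
      have "cmod \<mu> ^ n * cmod v = cmod (hardy_fun f (p + of_real (a ^ n * t)))"
        by (simp only: iter[OF t] v_def norm_mult norm_power)
      also have "\<dots> \<le> 2 * norm f / sqrt (Re (p + of_real (a ^ n * t)))"
        using Re_p a t by (intro hardy_point_bound) (simp add: add_pos_pos)
      also have "\<dots> \<le> 2 * norm f / sqrt (Re p)"
        using Re_p a t by (intro divide_left_mono mult_pos_pos) (auto simp: add_pos_pos)
      finally show ?thesis .
    qed
    then have bounded: "cmod \<mu> ^ n \<le> 2 * norm f / sqrt (Re p) / cmod v" for n
      by (rule mult_imp_le_div_pos[OF v])
    have \<mu>: "cmod \<mu> \<le> 1"
    proof (rule ccontr)
      assume "\<not> cmod \<mu> \<le> 1"
      then obtain n where "2 * norm f / sqrt (Re p) / cmod v < cmod \<mu> ^ n"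
        using real_arch_pow[of "cmod \<mu>"] by auto
      then show False
        using bounded[of n] by simp
    qed
    have "cmod v \<le> 2 * norm f / sqrt t * sqrt a ^ n" for n
    proof -
      have tn: "0 < t / a ^ n"
        using a t by simp
      have "v = \<mu> ^ n * hardy_fun f (p + of_real (t / a ^ n))"
        using iter[OF tn, of n] a by (simp add: v_def)
      then have "cmod v = cmod \<mu> ^ n * cmod (hardy_fun f (p + of_real (t / a ^ n)))"
        by (simp only: norm_mult norm_power)
      also have "\<dots> \<le> 1 * cmod (hardy_fun f (p + of_real (t / a ^ n)))"
        using \<mu> by (intro mult_right_mono power_le_one) auto
      also have "\<dots> \<le> 1 * (2 * norm f / sqrt (Re (p + of_real (t / a ^ n))))"
        using Re_p tn by (intro mult_left_mono hardy_point_bound) (auto simp: add_pos_pos)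
      also have "\<dots> \<le> 1 * (2 * norm f / sqrt (t / a ^ n))"
      proof (intro mult_left_mono divide_left_mono mult_pos_pos)
        show "sqrt (t / a ^ n) \<le> sqrt (Re (p + of_real (t / a ^ n)))"
          using Re_p by simp
      qed (use Re_p tn in \<open>auto simp: add_pos_pos\<close>)
      also have "\<dots> = 2 * norm f / sqrt t * sqrt a ^ n"
        by (simp add: real_sqrt_divide real_sqrt_power)
      finally show ?thesis .
    qed
    moreover have "(\<lambda>n. 2 * norm f / sqrt t * sqrt a ^ n) \<longlonglongrightarrow> 2 * norm f / sqrt t * 0"
      using a by (intro tendsto_intros LIMSEQ_realpow_zero) auto
    ultimately have "cmod v \<le> 2 * norm f / sqrt t * 0"
      by (intro LIMSEQ_le_const) auto
    then show False
      using v by simp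
  qed
  have "f = 0"
  proof (rule hardy_eq_0_if_accumulating_zeros[of "\<lambda>n. p + of_real (1 + 1 / real (Suc n))" "p + of_real (1 + 0)"])
    show "(\<lambda>n. p + of_real (1 + 1 / real (Suc n))) \<longlonglongrightarrow> p + of_real (1 + 0)"
      using LIMSEQ_inverse_real_of_nat by (intro tendsto_intros) (simp add: inverse_eq_divide)
    show "hardy_fun f (p + of_real (1 + 1 / real (Suc n))) = 0" for n
      by (rule zero) (simp add: add_pos_pos)
  qed (use Re_p in \<open>auto simp: add_pos_pos simp flip: of_real_add\<close>)
  then show False
    using f(1) by simp
qed

text \<open>
  Multiplying an eigenfunction by \<open>exp (- \<rho> w)\<close>, where \<open>\<rho> = ln |\<mu>| / Re b\<close>, makes its modulus periodic
  with period \<open>b\<close> and hence bounded. Increments of a bounded analytic function tend to 0 far from the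
  imaginary axis, so by periodicity they vanish. The eigenfunction therefore has constant modulus on
  vertical lines and can be square integrable only if it is zero.
\<close>

lemma not_universal_if_translation:
  assumes b: "0 < Re b"
  shows "\<not> universal_operator hardy2_norm hardy2 (symbol_op 1 b \<mu>)"
proof
  assume "universal_operator hardy2_norm hardy2 (symbol_op 1 b \<mu>)"
  then obtain f where f: "f \<noteq> 0" "affine_op 1 b f = scaleC \<mu> f"
    using universal_imp_eigenvector[of 1 b \<mu>] b by (metis less_imp_le zero_less_one)
  have eig: "hardy_fun f (w + b) = \<mu> * hardy_fun f w" if "0 < Re w" for w
    using hardy_fun_affine_op[of 1 b w f] b that by (simp add: f(2))
  have vertical: "f = 0" if "0 < x" "\<And>t. hardy_fun f (Complex x t) = 0" for x
  proof (rule hardy_eq_0_if_accumulating_zeros[of "\<lambda>n. Complex x (1 / real (Suc n))" "Complex x 0"])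
    show "(\<lambda>n. Complex x (1 / real (Suc n))) \<longlonglongrightarrow> Complex x 0"
      unfolding Complex_eq
      using LIMSEQ_inverse_real_of_nat by (intro tendsto_intros) (auto simp: inverse_eq_divide)
  qed (use that in auto)
  have "\<mu> \<noteq> 0"
  proof
    assume "\<mu> = 0"
    have "hardy_fun f (Complex (Re b + 1) t) = 0" for t
      using eig[of "Complex (Re b + 1) t - b"] \<open>\<mu> = 0\<close> by simp
    then show False
      using vertical[of "Re b + 1"] b f(1) by simp
  qed
  define \<rho> where "\<rho> = ln (cmod \<mu>) / Re b"
  (* Shifting by 1 keeps away from the imaginary axis, where the pointwise bound blows up. *)
  define G where "G w = hardy_fun f (w + 1) * exp (- of_real \<rho> * w)" for w
  define \<kappa> where "\<kappa> = \<mu> * exp (- of_real \<rho> * b)"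
  have "cmod (exp (- of_real \<rho> * b)) = exp (- ln (cmod \<mu>))"
    using b by (simp add: \<rho>_def)
  then have \<kappa>: "cmod \<kappa> = 1"
    using \<open>\<mu> \<noteq> 0\<close> by (simp add: \<kappa>_def norm_mult exp_minus)
  have G_step: "G (w + b) = \<kappa> * G w" if "0 \<le> Re w" for w
    using eig[of "w + 1"] that by (simp add: G_def \<kappa>_def add_ac distrib_left exp_add mult_ac exp_diff exp_minus divide_inverse)
  have G_iter: "G (w + of_nat n * b) = \<kappa> ^ n * G w" if "0 \<le> Re w" for w n
  proof (induction n)
    case (Suc n)
    have "0 \<le> Re (w + of_nat n * b)"
      using that b by simp
    from G_step[OF this] show ?case
      using Suc by (simp add: algebra_simps)
  qed simp
  define B where "B = 2 * norm f * exp (\<bar>\<rho>\<bar> * Re b)"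
  have bound: "cmod (G w) \<le> B" if w: "0 < Re w" for w
  proof -
    define n where "n = nat \<lfloor>Re w / Re b\<rfloor>"
    define v where "v = w - of_nat n * b"
    have "0 \<le> Re w / Re b"
      using w b by simp
    then have "real n \<le> Re w / Re b" "Re w / Re b < real n + 1"
      unfolding n_def by linarith+
    then have v: "0 \<le> Re v" "Re v \<le> Re b"
      using b by (simp_all add: v_def field_simps)
    have "cmod (G w) = cmod (G v)"
      using G_iter[OF v(1), of n] \<kappa> by (simp add: v_def norm_mult norm_power)
    also have "\<dots> = cmod (hardy_fun f (v + 1)) * exp (- \<rho> * Re v)"
      by (simp add: G_def norm_mult)
    also have "\<dots> \<le> (2 * norm f) * exp (\<bar>\<rho>\<bar> * Re b)"
    proof (rule mult_mono)
      have "cmod (hardy_fun f (v + 1)) \<le> 2 * norm f / sqrt (Re (v + 1))"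
        using v by (intro hardy_point_bound) simp
      also have "\<dots> \<le> 2 * norm f / 1"
        using v by (intro divide_left_mono) auto
      finally show "cmod (hardy_fun f (v + 1)) \<le> 2 * norm f" by simp
      have "- \<rho> * Re v \<le> \<bar>\<rho>\<bar> * Re v"
        using v by (intro mult_right_mono) auto
      also have "\<dots> \<le> \<bar>\<rho>\<bar> * Re b"
        using v by (intro mult_left_mono) auto
      finally show "exp (- \<rho> * Re v) \<le> exp (\<bar>\<rho>\<bar> * Re b)" by simp
    qed auto
    finally show ?thesis by (simp add: B_def)
  qed
  have "(\<lambda>w. hardy_fun f (w + 1)) holomorphic_on right_half_plane"
    by (rule holomorphic_on_compose_gen[OF _ hardy_fun_holomorphic, unfolded o_def]) (auto intro!: holomorphic_intros)
  then have hol: "G holomorphic_on right_half_plane"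
    unfolding G_def by (intro holomorphic_intros)
  have const: "G (1 + \<i> * of_real t) = G 1" for t
  proof -
    have "cmod (G (1 + \<i> * of_real t) - G 1) \<le> B * cmod (\<i> * of_real t) / (1 + real n * Re b)" for n
    proof -
      have "G (1 + \<i> * of_real t + of_nat n * b) - G (1 + of_nat n * b) = \<kappa> ^ n * (G (1 + \<i> * of_real t) - G 1)"
        by (simp add: G_iter right_diff_distrib)
      then have "cmod (G (1 + \<i> * of_real t) - G 1) = cmod (G ((1 + of_nat n * b) + \<i> * of_real t) - G (1 + of_nat n * b))"
        by (simp add: norm_mult norm_power \<kappa> add_ac)
      also have "\<dots> \<le> B / Re (1 + of_nat n * b) * cmod (\<i> * of_real t)"
        using b by (intro half_plane_increment_bound[OF hol bound]) (auto simp: add_pos_nonneg)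
      finally show ?thesis by simp
    qed
    moreover have "(\<lambda>n. B * cmod (\<i> * of_real t) / (1 + real n * Re b)) \<longlonglongrightarrow> 0"
      using b
      by (intro tendsto_divide_0[OF tendsto_const] filterlim_at_top_imp_at_infinity
          filterlim_tendsto_add_at_top[OF tendsto_const]
          filterlim_at_top_mult_tendsto_pos[OF tendsto_const] filterlim_real_sequentially)
    ultimately have "cmod (G (1 + \<i> * of_real t) - G 1) \<le> 0"
      by (intro LIMSEQ_le_const) auto
    then show ?thesis by simp
  qed
  define m where "m = cmod (hardy_fun f 2)"
  have modulus: "cmod (hardy_fun f (Complex 2 t)) = m" for t
  proof -
    have "cmod (G (1 + \<i> * of_real t)) = cmod (hardy_fun f (Complex 2 t)) * exp (- \<rho>)"
      by (simp add: G_def norm_mult Complex_eq add_ac)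
    moreover have "cmod (G 1) = m * exp (- \<rho>)"
      by (simp add: G_def norm_mult m_def)
    ultimately show ?thesis
      using const[of t] by simp
  qed
  have "m = 0"
  proof (rule ccontr)
    assume "m \<noteq> 0"
    then have m: "0 < m" by (simp add: m_def)
    (* The length of the segment is chosen so that a constant modulus m exceeds the norm of f. *)
    define R where "R = ((norm f)\<^sup>2 / m\<^sup>2 + 1) / 2"
    have R: "0 \<le> R"
      by (simp add: R_def)
    have "l2_norm_on (-R) R (\<lambda>t. hardy_fun f (Complex 2 t)) \<le> norm f"
      unfolding hardy_norm_eq by (intro hardy2_segment hardy_fun) simp
    then have "(l2_norm_on (-R) R (\<lambda>t. hardy_fun f (Complex 2 t)))\<^sup>2 \<le> (norm f)\<^sup>2"
      by (intro power_mono) auto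
    then have "2 * R * m\<^sup>2 \<le> (norm f)\<^sup>2"
      using R by (simp add: l2_norm_on_def modulus)
    moreover have "2 * R * m\<^sup>2 = (norm f)\<^sup>2 + m\<^sup>2"
      using m by (simp add: R_def field_simps)
    ultimately show False
      using m by simp
  qed
  then have "f = 0"
    using vertical[of 2] modulus by simp
  then show False
    using f(1) by simp
qed

theorem theorem1:
  fixes \<psi> :: "complex \<Rightarrow> complex" and a :: real and b :: complex
  assumes "\<psi> = (\<lambda>w. of_real a * w + b)" and "a > 0" and "Re b \<ge> 0"
  shows "(\<exists>\<mu>::complex. universal_operator hardy2_norm hardy2
             (\<lambda>f. composition_operator \<psi> f - fun_scale \<mu> f))
         \<longleftrightarrow> a \<in> {1<..} \<and> Re b > 0"
proof
  assume "\<exists>\<mu>. universal_operator hardy2_norm hardy2 (\<lambda>f. composition_operator \<psi> f - fun_scale \<mu> f)"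
  then obtain \<mu> where \<mu>: "universal_operator hardy2_norm hardy2 (symbol_op a b \<mu>)"
    unfolding assms(1) symbol_op_def[abs_def] by blast
  have "Re b \<noteq> 0"
    using not_universal_if_scaled_isometry[of a b \<mu>] \<mu> assms(2) by blast
  then have "0 < Re b"
    using assms(3) by simp
  moreover have "\<not> a < 1"
    using not_universal_if_contracting[of a b \<mu>] \<mu> assms(2) \<open>0 < Re b\<close> by blast
  moreover have "a \<noteq> 1"
    using not_universal_if_translation[of b \<mu>] \<mu> \<open>0 < Re b\<close> by blast
  ultimately show "a \<in> {1<..} \<and> Re b > 0"
    by auto
next
  assume "a \<in> {1<..} \<and> Re b > 0"
  then show "\<exists>\<mu>. universal_operator hardy2_norm hardy2 (\<lambda>f. composition_operator \<psi> f - fun_scale \<mu> f)"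
    unfolding assms(1) using universal_expanding[of a b] by blast
qed

end
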